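(* Let $(\phi,k)$ be an instance of $\textsc{WSAT}(\Gamma^{+}_{2,1})$, let $m$ be such that $\max\{\mathrm{var}(\phi),\mathrm{cl}(\phi)\}\le 2^{m}$, and let $p$ be the length of the longest clause of $\phi$. Then there is a $(p\cdot m\log m,\ p\cdot m\log m)$-restricted probabilistic FPT-time Turing machine that rejects $(\phi,k)$ with high probability if $(\phi,k)$ is a No-instance of $\textsc{WSAT}(\Gamma^{+}_{2,1})$. That is, $\textsc{WSAT}(\Gamma^{+}_{2,1})\in p\text{-PCP}(p\cdot m\log m,\ p\cdot m\log m)$.
   Context: $\Gamma^{+}_{2,1}$ is the class of propositional CNF formulas (conjunctions of clauses of arbitrary length) in which no literal is negated. $\mathrm{var}(\phi)$, $\mathrm{cl}(\phi)$ are the numbers of variables and clauses. $\textsc{WSAT}(\Gamma^{+}_{2,1})$: given $\phi\in\Gamma^{+}_{2,1}$ and parameter $k$, decide whether $\phi$ has a satisfying assignment setting exactly $k$ variables to TRUE. A $p$-PCP for a parameterized problem is a probabilistic Turing machine running in time $f(k)|x|^{O(1)}$ ($f$ computable) with oracle access to a proof string, such that Yes-instances are accepted with probability $1$ for some proof and No-instances are accepted with probability at most $1/2$ for every proof; it is $(r,p)$-restricted if it uses $O(r)$ random bits and reads $O(p)$ proof bits; $p\text{-PCP}(r,p)$ is the class of problems having such a verifier. *)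

theory Defs
  imports "HOL-Probability.Probability_Mass_Function"
begin

section \<open>Computable functions\<close>

text \<open>Kleene's partial recursive functions; a program carries no arity, so a program applied to
  too short an argument list simply has no value.\<close>

datatype recf =
    Zero
  | Succ
  | Proj nat
  | Comp recf "recf list"
  | PrimRec recf recf
  | Mu recf

inductive rec_eval :: "recf \<Rightarrow> nat list \<Rightarrow> nat \<Rightarrow> bool" where
  "rec_eval Zero xs 0"
| "rec_eval Succ (x # xs) (Suc x)"
| "i < length xs \<Longrightarrow> rec_eval (Proj i) xs (xs ! i)"
| "list_all2 (\<lambda>g y. rec_eval g xs y) gs ys \<Longrightarrow> rec_eval f ys z \<Longrightarrow> rec_eval (Comp f gs) xs z"
| "rec_eval f xs y \<Longrightarrow> rec_eval (PrimRec f g) (0 # xs) y"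
| "rec_eval (PrimRec f g) (n # xs) y \<Longrightarrow> rec_eval g (n # y # xs) z \<Longrightarrow>
     rec_eval (PrimRec f g) (Suc n # xs) z"
| "rec_eval f (n # xs) 0 \<Longrightarrow> (\<forall>i<n. \<exists>y. rec_eval f (i # xs) (Suc y)) \<Longrightarrow> rec_eval (Mu f) xs n"

definition computable :: "(nat \<Rightarrow> nat) \<Rightarrow> bool" where
  "computable f \<longleftrightarrow> (\<exists>e. \<forall>n. rec_eval e [n] (f n))"


section \<open>Probabilistic Turing machines with oracle access to a proof string\<close>

text \<open>Tapes are one-way infinite; a move to the left on cell 0 leaves the head where it is.
  Symbol 0 is the blank, symbols 1 and 2 are the bits 0 and 1; further symbols are
  available up to the (finite) alphabet size of the machine.\<close>

type_synonym symbol = nat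
type_synonym tape = "(nat \<Rightarrow> symbol) \<times> nat"

datatype dir = GoLeft | Stay | GoRight

text \<open>A machine is a list of instructions, the instruction at index \<open>s\<close> describing what
  happens in state \<open>s\<close>. \<open>Step \<delta>\<close> is an ordinary multitape transition: from the scanned
  symbols it computes the next state and, for each tape, the symbol to write and the head move.
  \<open>Toss s1 s0\<close> tosses a fair coin and goes to \<open>s1\<close> or \<open>s0\<close> accordingly;
  \<open>Query s1 s0\<close> does the same with the addressed bit of the proof string.\<close>

datatype instr =
    Step "symbol list \<Rightarrow> nat \<times> (symbol \<times> dir) list"
  | Toss nat nat
  | Query nat nat
  | Accept
  | Reject

record ptm =
  num_symbols :: nat
  num_tapes :: nat
  prog :: "instr list"

fun wf_instr :: "ptm \<Rightarrow> instr \<Rightarrow> bool" where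
  "wf_instr M (Step \<delta>) \<longleftrightarrow>
     (\<forall>ss. length ss = num_tapes M \<and> set ss \<subseteq> {..<num_symbols M} \<longrightarrow>
        fst (\<delta> ss) < length (prog M) \<and>
        length (snd (\<delta> ss)) = num_tapes M \<and>
        fst ` set (snd (\<delta> ss)) \<subseteq> {..<num_symbols M})"
| "wf_instr M (Toss s1 s0) \<longleftrightarrow> s1 < length (prog M) \<and> s0 < length (prog M)"
| "wf_instr M (Query s1 s0) \<longleftrightarrow> s1 < length (prog M) \<and> s0 < length (prog M)"
| "wf_instr M Accept \<longleftrightarrow> True"
| "wf_instr M Reject \<longleftrightarrow> True"

text \<open>Tape 0 is the input tape and tape 1 the query tape.\<close>

definition wf_ptm :: "ptm \<Rightarrow> bool" where
  "wf_ptm M \<longleftrightarrow> num_symbols M \<ge> 3 \<and> num_tapes M \<ge> 2 \<and> prog M \<noteq> [] \<and>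
     (\<forall>ins \<in> set (prog M). wf_instr M ins)"

record config =
  state :: nat
  tapes :: "tape list"
  coins :: nat   \<comment> \<open>number of random bits used so far\<close>
  queries :: nat \<comment> \<open>number of proof bits read so far\<close>

definition scan :: "tape \<Rightarrow> symbol" where
  "scan tp = fst tp (snd tp)"

fun act :: "tape \<Rightarrow> symbol \<times> dir \<Rightarrow> tape" where
  "act (u, i) (a, d) =
     (u(i := a), case d of GoLeft \<Rightarrow> i - 1 | Stay \<Rightarrow> i | GoRight \<Rightarrow> Suc i)"

text \<open>The address on the query tape is the maximal block of bits starting in cell 0, read as a
  binary number with the least significant bit first.\<close>

definition address :: "tape \<Rightarrow> nat" where
  "address tp = (let u = fst tp; l = (LEAST i. u i \<notin> {1, 2}) in \<Sum>i<l. (u i - 1) * 2 ^ i)"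

text \<open>Addresses beyond the end of the proof string are answered by 0.\<close>

definition proof_bit :: "bool list \<Rightarrow> nat \<Rightarrow> bool" where
  "proof_bit \<pi> i \<longleftrightarrow> i < length \<pi> \<and> \<pi> ! i"

definition step :: "ptm \<Rightarrow> bool list \<Rightarrow> config \<Rightarrow> config pmf" where
  "step M \<pi> c = (case prog M ! state c of
      Step \<delta> \<Rightarrow> (let (s, as) = \<delta> (map scan (tapes c)) in
        return_pmf (c\<lparr>state := s, tapes := map2 act (tapes c) as\<rparr>))
    | Toss s1 s0 \<Rightarrow>
        map_pmf (\<lambda>b. c\<lparr>state := (if b then s1 else s0), coins := Suc (coins c)\<rparr>)
          (bernoulli_pmf (1/2))
    | Query s1 s0 \<Rightarrow>
        return_pmf (c\<lparr>state := (if proof_bit \<pi> (address (tapes c ! 1)) then s1 else s0),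
          queries := Suc (queries c)\<rparr>)
    | Accept \<Rightarrow> return_pmf c
    | Reject \<Rightarrow> return_pmf c)"

definition input_tape :: "symbol list \<Rightarrow> tape" where
  "input_tape w = ((\<lambda>i. if i < length w then w ! i else 0), 0)"

definition init :: "ptm \<Rightarrow> symbol list \<Rightarrow> config" where
  "init M w = \<lparr>state = 0, tapes = input_tape w # replicate (num_tapes M - 1) (input_tape []),
     coins = 0, queries = 0\<rparr>"

text \<open>The distribution of the configuration after \<open>t\<close> steps on input \<open>w\<close> with proof \<open>\<pi>\<close>.\<close>

fun run :: "ptm \<Rightarrow> bool list \<Rightarrow> symbol list \<Rightarrow> nat \<Rightarrow> config pmf" where
  "run M \<pi> w 0 = return_pmf (init M w)"
| "run M \<pi> w (Suc t) = bind_pmf (run M \<pi> w t) (step M \<pi>)"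

definition accepting :: "ptm \<Rightarrow> config \<Rightarrow> bool" where
  "accepting M c \<longleftrightarrow> prog M ! state c = Accept"

definition halted :: "ptm \<Rightarrow> config \<Rightarrow> bool" where
  "halted M c \<longleftrightarrow> prog M ! state c \<in> {Accept, Reject}"

definition accept_prob :: "ptm \<Rightarrow> bool list \<Rightarrow> symbol list \<Rightarrow> real" where
  "accept_prob M \<pi> w = (SUP t. measure_pmf.prob (run M \<pi> w t) {c. accepting M c})"


section \<open>Parameterized problems and parameterized PCPs\<close>

text \<open>The No-instances are those in \<open>instances P - yes P\<close>. Encodings must not use the blank
  symbol 0 (this is enforced for every verifier below).\<close>

record 'a param_problem =
  instances :: "'a set"
  yes :: "'a set"
  enc :: "'a \<Rightarrow> symbol list"
  param :: "'a \<Rightarrow> nat"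

definition fpt_time :: "'a param_problem \<Rightarrow> ptm \<Rightarrow> bool" where
  "fpt_time P M \<longleftrightarrow> (\<exists>f d. computable f \<and>
     (\<forall>x \<in> instances P. \<forall>\<pi>.
        \<forall>c \<in> set_pmf (run M \<pi> (enc P x) (f (param P x) * length (enc P x) ^ d)). halted M c))"

definition pcp_verifier :: "'a param_problem \<Rightarrow> ptm \<Rightarrow> bool" where
  "pcp_verifier P M \<longleftrightarrow> wf_ptm M \<and>
     (\<forall>x \<in> instances P. set (enc P x) \<subseteq> {1..<num_symbols M}) \<and>
     fpt_time P M \<and>
     (\<forall>x \<in> instances P. x \<in> yes P \<longrightarrow> (\<exists>\<pi>. accept_prob M \<pi> (enc P x) = 1)) \<and>
     (\<forall>x \<in> instances P. x \<notin> yes P \<longrightarrow> (\<forall>\<pi>. accept_prob M \<pi> (enc P x) \<le> 1/2))"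

definition restricted :: "'a param_problem \<Rightarrow> ('a \<Rightarrow> real) \<Rightarrow> ('a \<Rightarrow> real) \<Rightarrow> ptm \<Rightarrow> bool" where
  "restricted P r q M \<longleftrightarrow> (\<exists>C::real. \<forall>x \<in> instances P. \<forall>\<pi> t. \<forall>c \<in> set_pmf (run M \<pi> (enc P x) t).
     real (coins c) \<le> C * r x \<and> real (queries c) \<le> C * q x)"

definition p_PCP :: "('a \<Rightarrow> real) \<Rightarrow> ('a \<Rightarrow> real) \<Rightarrow> 'a param_problem set" where
  "p_PCP r q = {P. \<exists>M. pcp_verifier P M \<and> restricted P r q M}"


section \<open>Weighted satisfiability of positive CNF formulas\<close>

datatype literal = Pos nat | Neg nat

type_synonym clause = "literal list"
type_synonym cnf = "clause list"

fun var_of :: "literal \<Rightarrow> nat" where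
  "var_of (Pos x) = x"
| "var_of (Neg x) = x"

fun sat_literal :: "(nat \<Rightarrow> bool) \<Rightarrow> literal \<Rightarrow> bool" where
  "sat_literal \<alpha> (Pos x) \<longleftrightarrow> \<alpha> x"
| "sat_literal \<alpha> (Neg x) \<longleftrightarrow> \<not> \<alpha> x"

definition satisfies :: "(nat \<Rightarrow> bool) \<Rightarrow> cnf \<Rightarrow> bool" where
  "satisfies \<alpha> \<phi> \<longleftrightarrow> (\<forall>C \<in> set \<phi>. \<exists>l \<in> set C. sat_literal \<alpha> l)"

definition vars :: "cnf \<Rightarrow> nat set" where
  "vars \<phi> = (\<Union>C \<in> set \<phi>. var_of ` set C)"

definition num_vars :: "cnf \<Rightarrow> nat" where
  "num_vars \<phi> = card (vars \<phi>)"

definition num_clauses :: "cnf \<Rightarrow> nat" where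
  "num_clauses \<phi> = length \<phi>"

text \<open>The length of the longest clause, 0 for the formula without clauses.\<close>

definition max_clause_length :: "cnf \<Rightarrow> nat" where
  "max_clause_length \<phi> = Max (insert 0 (length ` set \<phi>))"

text \<open>The class $\Gamma^+_{2,1}$.\<close>

definition Gamma21_pos :: "cnf set" where
  "Gamma21_pos = {\<phi>. \<forall>C \<in> set \<phi>. \<forall>l \<in> set C. \<exists>x. l = Pos x}"

definition has_weighted_sat :: "cnf \<Rightarrow> nat \<Rightarrow> bool" where
  "has_weighted_sat \<phi> k \<longleftrightarrow> (\<exists>\<alpha>. satisfies \<alpha> \<phi> \<and> card {x \<in> vars \<phi>. \<alpha> x} = k)"

text \<open>Instances are written over the alphabet \<open>{1,\<dots>,6}\<close>: numbers in binary (symbols 1 and 2,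
  least significant bit first, 0 being the empty word), 3 and 4 announce a positive and a negative
  literal, 5 announces a clause, and 6 separates the formula from the parameter.\<close>

fun enc_nat :: "nat \<Rightarrow> symbol list" where
  "enc_nat n = (if n = 0 then [] else (if even n then 1 else 2) # enc_nat (n div 2))"

declare enc_nat.simps [simp del]

fun enc_literal :: "literal \<Rightarrow> symbol list" where
  "enc_literal (Pos x) = 3 # enc_nat x"
| "enc_literal (Neg x) = 4 # enc_nat x"

definition enc_clause :: "clause \<Rightarrow> symbol list" where
  "enc_clause C = 5 # concat (map enc_literal C)"

definition enc_instance :: "cnf \<times> nat \<Rightarrow> symbol list" where
  "enc_instance = (\<lambda>(\<phi>, k). concat (map enc_clause \<phi>) @ 6 # enc_nat k)"

definition WSAT :: "cnf set \<Rightarrow> (cnf \<times> nat) param_problem" where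
  "WSAT \<Phi> = \<lparr>instances = \<Phi> \<times> UNIV, yes = {(\<phi>, k). \<phi> \<in> \<Phi> \<and> has_weighted_sat \<phi> k},
     enc = enc_instance, param = snd\<rparr>"

end

theory Submission
  imports Defs
begin

text \<open>Let \<open>n\<close> be the number of variables of \<open>\<phi>\<close>. Since \<open>\<phi>\<close> is monotone, it has a satisfying
  assignment of weight exactly \<open>k\<close> as soon as \<open>n \<ge> k\<close> and some set of at most \<open>k\<close> variables hits
  every clause. No random bits are needed.

  If \<open>n \<ge> 2 ^ (k + 1)\<close>, the verifier runs \<open>k\<close> rounds: it finds the first clause that is not hit
  yet and reads the proof bits of its variables until it meets a 1; that variable is set to true.
  The proof bit of a variable is addressed by the name of the variable, so an honest proof is the
  characteristic string of a hitting set. This takes at most \<open>k * p\<close> queries, and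
  \<open>k + 1 \<le> m\<close> makes \<open>k * p \<le> p * m * log m\<close>.

  If \<open>n < 2 ^ (k + 1)\<close>, all \<open>2 ^ n \<le> 2 ^ 2 ^ (k + 1)\<close> assignments are tried without any query,
  which is fixed-parameter time.

  The machine is compiled from a small while language over tapes, and programs are verified by
  weakest preconditions that carry the elapsed time and the number of queries.\<close>

section \<open>A while language over tapes and its compilation\<close>

text \<open>The number \<open>m\<close> bounds only the logarithm of the formula size, so the budget
  \<open>p * m * log 2 m\<close> may be far below \<open>k * p\<close>, and it is 0 for
  \<open>m <= 1\<close>. Reading a hitting set off the proof is therefore affordable only for
  formulas with many variables. For the others the budget may forbid every query, but then the
  number of variables is bounded in terms of \<open>k\<close>, and any computable function of
  \<open>k\<close> may be spent on a search. The function \<open>m\<close> is arbitrary and not part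
  of the input, so the machine cannot compare anything with it; it compares the number of variables
  with \<open>2 ^ Suc k\<close>, to which it can count. The exponent is \<open>Suc k\<close> rather
  than \<open>k\<close> because of the logarithm: for \<open>k >= 1\<close> it forces
  \<open>m >= 2\<close>, hence \<open>log 2 m >= 1\<close>, while \<open>2 ^ k\<close> would admit
  \<open>k = m = 1\<close>, where the budget is 0. A false proof is harmless because proof bits only
  suggest variables: the machine itself checks that the chosen ones, at most \<open>k\<close>, hit
  all clauses. So No-instances are rejected with certainty.\<close>

datatype cmd =
    Skip
  | Op nat "symbol list \<Rightarrow> symbol" dir
  | Seq cmd cmd (infixr ";;" 60)
  | Cond "symbol list \<Rightarrow> bool" cmd cmd
  | While "symbol list \<Rightarrow> bool" cmd
  | Ask cmd cmd

text \<open>The counts are those of the compiled code: besides the test, a first branch or a loop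
  body pays for the jump that follows it in the code.\<close>

inductive exec :: "bool list \<Rightarrow> cmd \<Rightarrow> tape list \<Rightarrow> nat \<Rightarrow> nat \<Rightarrow> tape list \<Rightarrow> bool" for \<pi> where
  Skip: "exec \<pi> Skip s 0 0 s"
| Op: "exec \<pi> (Op i g d) s 1 0 (s[i := act (s ! i) (g (map scan s), d)])"
| Seq: "exec \<pi> c1 s n1 r1 s1 \<Longrightarrow> exec \<pi> c2 s1 n2 r2 s2 \<Longrightarrow> exec \<pi> (c1 ;; c2) s (n1 + n2) (r1 + r2) s2"
| CondT: "p (map scan s) \<Longrightarrow> exec \<pi> c1 s n r s1 \<Longrightarrow> exec \<pi> (Cond p c1 c2) s (n + 2) r s1"
| CondF: "\<not> p (map scan s) \<Longrightarrow> exec \<pi> c2 s n r s1 \<Longrightarrow> exec \<pi> (Cond p c1 c2) s (n + 1) r s1"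
| WhileT: "p (map scan s) \<Longrightarrow> exec \<pi> c s n1 r1 s1 \<Longrightarrow> exec \<pi> (While p c) s1 n2 r2 s2 \<Longrightarrow>
    exec \<pi> (While p c) s (n1 + 2 + n2) (r1 + r2) s2"
| WhileF: "\<not> p (map scan s) \<Longrightarrow> exec \<pi> (While p c) s 1 0 s"
| AskT: "proof_bit \<pi> (address (s ! 1)) \<Longrightarrow> exec \<pi> c1 s n r s1 \<Longrightarrow> exec \<pi> (Ask c1 c2) s (n + 2) (Suc r) s1"
| AskF: "\<not> proof_bit \<pi> (address (s ! 1)) \<Longrightarrow> exec \<pi> c2 s n r s1 \<Longrightarrow> exec \<pi> (Ask c1 c2) s (n + 1) (Suc r) s1"

inductive_cases exec_SkipE: "exec \<pi> Skip s n r s'"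
inductive_cases exec_OpE: "exec \<pi> (Op i g d) s n r s'"
inductive_cases exec_SeqE: "exec \<pi> (c1 ;; c2) s n r s'"
inductive_cases exec_CondE: "exec \<pi> (Cond p c1 c2) s n r s'"
inductive_cases exec_WhileE: "exec \<pi> (While p c) s n r s'"
inductive_cases exec_AskE: "exec \<pi> (Ask c1 c2) s n r s'"

fun csize :: "cmd \<Rightarrow> nat" where
  "csize Skip = 0"
| "csize (Op i g d) = 1"
| "csize (c1 ;; c2) = csize c1 + csize c2"
| "csize (Cond p c1 c2) = csize c1 + csize c2 + 2"
| "csize (While p c) = csize c + 2"
| "csize (Ask c1 c2) = csize c1 + csize c2 + 2"

definition stay :: "symbol list \<Rightarrow> (symbol \<times> dir) list" where
  "stay = map (\<lambda>a. (a, Stay))"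

definition branch :: "(symbol list \<Rightarrow> bool) \<Rightarrow> nat \<Rightarrow> nat \<Rightarrow> instr" where
  "branch p a b = Step (\<lambda>ss. (if p ss then a else b, stay ss))"

text \<open>Addresses are absolute, and control leaves at \<open>a + csize c\<close>. A jump is a
  \<open>branch\<close> on a constant condition; its other target is 0 because that address is valid
  in every program.\<close>

fun compile :: "nat \<Rightarrow> cmd \<Rightarrow> instr list" where
  "compile a Skip = []"
| "compile a (Op i g d) = [Step (\<lambda>ss. (Suc a, (stay ss)[i := (g ss, d)]))]"
| "compile a (c1 ;; c2) = compile a c1 @ compile (a + csize c1) c2"
| "compile a (Cond p c1 c2) = branch p (a + 1) (a + csize c1 + 2) # compile (a + 1) c1 @
     branch (\<lambda>_. True) (a + csize c1 + csize c2 + 2) 0 # compile (a + csize c1 + 2) c2"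
| "compile a (While p c) = branch p (a + 1) (a + csize c + 2) # compile (a + 1) c @
     [branch (\<lambda>_. True) a 0]"
| "compile a (Ask c1 c2) = Query (a + 1) (a + csize c1 + 2) # compile (a + 1) c1 @
     branch (\<lambda>_. True) (a + csize c1 + csize c2 + 2) 0 # compile (a + csize c1 + 2) c2"

lemma length_compile [simp]: "length (compile a c) = csize c"
  by (induction c arbitrary: a) auto

definition code_at :: "instr list \<Rightarrow> nat \<Rightarrow> instr list \<Rightarrow> bool" where
  "code_at P a is \<longleftrightarrow> (\<exists>us vs. P = us @ is @ vs \<and> length us = a)"

lemma code_at_Cons: "code_at P a (i # is) \<longleftrightarrow> P ! a = i \<and> a < length P \<and> code_at P (Suc a) is"
proof
  assume "code_at P a (i # is)"
  then obtain us vs where "P = us @ (i # is) @ vs" "length us = a" by (auto simp: code_at_def)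
  thus "P ! a = i \<and> a < length P \<and> code_at P (Suc a) is"
    unfolding code_at_def by (intro conjI exI[of _ "us @ [i]"] exI[of _ vs]) auto
next
  assume *: "P ! a = i \<and> a < length P \<and> code_at P (Suc a) is"
  then obtain us vs where P: "P = us @ is @ vs" "length us = Suc a" by (auto simp: code_at_def)
  then obtain us' x where "us = us' @ [x]" by (metis length_Suc_conv_rev)
  thus "code_at P a (i # is)" using * P by (auto simp: code_at_def nth_append)
qed

lemma code_at_append: "code_at P a (is @ js) \<Longrightarrow> code_at P a is \<and> code_at P (a + length is) js"
proof -
  assume "code_at P a (is @ js)"
  then obtain us vs where P: "P = us @ (is @ js) @ vs" "length us = a" by (auto simp: code_at_def)
  have "code_at P a is" unfolding code_at_def using P by (intro exI[of _ us] exI[of _ "js @ vs"]) auto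
  moreover have "code_at P (a + length is) js" unfolding code_at_def using P
    by (intro exI[of _ "us @ is"] exI[of _ vs]) auto
  ultimately show ?thesis by simp
qed

text \<open>Compiled programs toss no coins, so a run iterates a function and each
  \<open>step\<close> is a point mass; probabilities return only in \<open>run_machine\<close> and
  \<open>machine_correct\<close>.\<close>

definition dstep :: "ptm \<Rightarrow> bool list \<Rightarrow> config \<Rightarrow> config" where
  "dstep M \<pi> c = (case prog M ! state c of
      Step \<delta> \<Rightarrow> (let (s, as) = \<delta> (map scan (tapes c)) in
        c\<lparr>state := s, tapes := map2 act (tapes c) as\<rparr>)
    | Query s1 s0 \<Rightarrow>
        c\<lparr>state := (if proof_bit \<pi> (address (tapes c ! 1)) then s1 else s0),
          queries := Suc (queries c)\<rparr>
    | _ \<Rightarrow> c)"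

lemma act_scan_stay [simp]: "act t (scan t, Stay) = t"
  by (cases t) (auto simp: scan_def)

lemma map2_act_stay [simp]: "map2 act s (stay (map scan s)) = s"
  by (induction s) (auto simp: stay_def)

lemma map2_act_upd:
  "map2 act s ((stay (map scan s))[i := x]) = s[i := act (s ! i) x]"
  by (cases "i < length s") (auto simp: stay_def nth_list_update intro!: nth_equalityI)

abbreviation conf :: "nat \<Rightarrow> tape list \<Rightarrow> nat \<Rightarrow> config" where
  "conf a s q \<equiv> \<lparr>state = a, tapes = s, coins = 0, queries = q\<rparr>"

lemma dstep_branch:
  "prog M ! a = branch p b1 b2 \<Longrightarrow>
   dstep M \<pi> (conf a s q) = conf (if p (map scan s) then b1 else b2) s q"
  by (auto simp: dstep_def branch_def)

text \<open>The induction is on the execution rather than the program, since a loop runs the same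
  code again: its second induction hypothesis starts at the same address \<open>a\<close>.\<close>

lemma exec_compile:
  "exec \<pi> c s n r s' \<Longrightarrow> code_at (prog M) a (compile a c) \<Longrightarrow>
   (dstep M \<pi> ^^ n) (conf a s q) = conf (a + csize c) s' (q + r)"
proof (induction arbitrary: a q rule: exec.induct)
  case (Skip s)
  then show ?case by simp
next
  case (Op i g d s)
  then show ?case by (auto simp: code_at_Cons dstep_def map2_act_upd)
next
  case (Seq c1 s n1 r1 s1 c2 n2 r2 s2)
  from Seq.prems have 1: "code_at (prog M) a (compile a c1)"
    and 2: "code_at (prog M) (a + csize c1) (compile (a + csize c1) c2)"
    using code_at_append by fastforce+
  show ?case using Seq.IH(1)[OF 1, of q] Seq.IH(2)[OF 2, of "q + r1"]
    by (subst add.commute) (simp add: funpow_add add.assoc)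
next
  case (CondT p s c1 n r s1 c2)
  from CondT.prems have 0: "prog M ! a = branch p (a + 1) (a + csize c1 + 2)"
    and *: "code_at (prog M) (a + 1) (compile (a + 1) c1)"
    and 2: "prog M ! (a + 1 + csize c1) = branch (\<lambda>_. True) (a + csize c1 + csize c2 + 2) 0"
    by (auto simp: code_at_Cons dest!: code_at_append)
  \<comment> \<open>Of the two extra steps one is the test before the body;
    \<open>funpow_swap1\<close> moves the other past the body, where it becomes the jump.\<close>
  show ?case using CondT.IH[OF *, of q] CondT.hyps(1)
    by (simp add: numeral_2_eq_2 dstep_branch[OF 0] dstep_branch[OF 2]  funpow_Suc_right del: funpow.simps)
      (simp add: dstep_branch[OF 2[simplified]] funpow_swap1[symmetric])
next
  case (CondF p s c2 n r s1 c1)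
  from CondF.prems have 0: "prog M ! a = branch p (a + 1) (a + csize c1 + 2)"
    and *: "code_at (prog M) (a + csize c1 + 2) (compile (a + csize c1 + 2) c2)"
    by (auto simp: code_at_Cons dest!: code_at_append)
  show ?case using CondF.IH[OF *, of q] CondF.hyps(1)
    by (simp add: dstep_branch[OF 0] funpow_Suc_right add_ac del: funpow.simps)
next
  case (WhileT p s c n1 r1 s1 n2 r2 s2)
  from WhileT.prems have 0: "prog M ! a = branch p (a + 1) (a + csize c + 2)"
    and *: "code_at (prog M) (a + 1) (compile (a + 1) c)"
    and 2: "prog M ! (a + 1 + csize c) = branch (\<lambda>_. True) a 0"
    by (auto simp: code_at_Cons dest!: code_at_append)
  have 3: "(dstep M \<pi> ^^ (n1 + 2)) (conf a s q) = conf a s1 (q + r1)"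
    using WhileT.IH(1)[OF *, of q] WhileT.hyps(1)
    by (simp add: numeral_2_eq_2 dstep_branch[OF 0] funpow_Suc_right del: funpow.simps)
      (simp add: dstep_branch[OF 2[simplified]] funpow_swap1[symmetric])
  have "(dstep M \<pi> ^^ (n2 + (n1 + 2))) (conf a s q) = (dstep M \<pi> ^^ n2) (conf a s1 (q + r1))"
    by (subst funpow_add) (simp only: o_apply 3)
  thus ?case using WhileT.IH(2)[OF WhileT.prems, of "q + r1"]
    by (simp only: add.commute[of "n1 + 2"] add.assoc[of q])
next
  case (WhileF p s c)
  from WhileF.prems have 0: "prog M ! a = branch p (a + 1) (a + csize c + 2)"
    by (auto simp: code_at_Cons dest!: code_at_append)
  show ?case using WhileF.hyps(1) by (simp add: dstep_branch[OF 0])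
next
  case (AskT s c1 n r s1 c2)
  from AskT.prems have 0: "prog M ! a = Query (a + 1) (a + csize c1 + 2)"
    and *: "code_at (prog M) (a + 1) (compile (a + 1) c1)"
    and 2: "prog M ! (a + 1 + csize c1) = branch (\<lambda>_. True) (a + csize c1 + csize c2 + 2) 0"
    by (auto simp: code_at_Cons dest!: code_at_append)
  have 3: "dstep M \<pi> (conf a s q) = conf (a + 1) s (Suc q)"
    using AskT.hyps 0 by (simp add: dstep_def)
  show ?case using AskT.IH[OF *, of "Suc q"] 
    by (simp add: numeral_2_eq_2 3 funpow_Suc_right del: funpow.simps)
      (simp add: dstep_branch[OF 2[simplified]] funpow_swap1[symmetric])
next
  case (AskF s c2 n r s1 c1)
  from AskF.prems have 0: "prog M ! a = Query (a + 1) (a + csize c1 + 2)"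
    and *: "code_at (prog M) (a + csize c1 + 2) (compile (a + csize c1 + 2) c2)"
    by (auto simp: code_at_Cons dest!: code_at_append)
  have 3: "dstep M \<pi> (conf a s q) = conf (a + csize c1 + 2) s (Suc q)"
    using AskF.hyps 0 by (simp add: dstep_def)
  show ?case using AskF.IH[OF *, of "Suc q"]
    by (simp add: 3 funpow_Suc_right add_ac del: funpow.simps)
qed

section \<open>Well-formedness of compiled machines\<close>

fun wf_cmd :: "nat \<Rightarrow> nat \<Rightarrow> cmd \<Rightarrow> bool" where
  "wf_cmd T N Skip \<longleftrightarrow> True"
| "wf_cmd T N (Op i g d) \<longleftrightarrow> (\<forall>ss. length ss = T \<longrightarrow> set ss \<subseteq> {..<N} \<longrightarrow> g ss < N)"
| "wf_cmd T N (c1 ;; c2) \<longleftrightarrow> wf_cmd T N c1 \<and> wf_cmd T N c2"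
| "wf_cmd T N (Cond p c1 c2) \<longleftrightarrow> wf_cmd T N c1 \<and> wf_cmd T N c2"
| "wf_cmd T N (While p c) \<longleftrightarrow> wf_cmd T N c"
| "wf_cmd T N (Ask c1 c2) \<longleftrightarrow> wf_cmd T N c1 \<and> wf_cmd T N c2"

lemma wf_branch: "a < length (prog M) \<Longrightarrow> b < length (prog M) \<Longrightarrow> wf_instr M (branch p a b)"
  by (auto simp: branch_def stay_def)

text \<open>The inequality is strict because a program falls through to address
  \<open>a + csize c\<close>, which must still hold an instruction; \<open>machine\<close> puts the
  final test there.\<close>

lemma wf_compile:
  "wf_cmd (num_tapes M) (num_symbols M) c \<Longrightarrow> a + csize c < length (prog M) \<Longrightarrow>
   i \<in> set (compile a c) \<Longrightarrow> wf_instr M i"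
proof (induction c arbitrary: a)
  case (Op i g d)
  then show ?case
    by (auto simp: stay_def dest!: set_update_subset_insert[THEN subsetD])
next
  case (Seq c1 c2)
  then show ?case using Seq.IH(1)[of a] Seq.IH(2)[of "a + csize c1"] by auto
next
  case (Cond p c1 c2)
  then show ?case using Cond.IH(1)[of "a + 1"] Cond.IH(2)[of "a + csize c1 + 2"]
    by (auto intro!: wf_branch)
next
  case (While p c)
  then show ?case using While.IH[of "a + 1"] by (auto intro!: wf_branch)
next
  case (Ask c1 c2)
  then show ?case using Ask.IH(1)[of "a + 1"] Ask.IH(2)[of "a + csize c1 + 2"]
    by (auto intro!: wf_branch)
qed auto

definition machine :: "nat \<Rightarrow> nat \<Rightarrow> cmd \<Rightarrow> (symbol list \<Rightarrow> bool) \<Rightarrow> ptm" where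
  "machine T N c p = \<lparr>num_symbols = N, num_tapes = T,
     prog = compile 0 c @ [branch p (csize c + 1) (csize c + 2), Accept, Reject]\<rparr>"

lemma wf_machine:
  assumes "wf_cmd T N c" "N \<ge> 3" "T \<ge> 2"
  shows "wf_ptm (machine T N c p)"
proof -
  let ?M = "machine T N c p"
  have *: "length (prog ?M) = csize c + 3" "num_tapes ?M = T" "num_symbols ?M = N"
    by (auto simp: machine_def)
  have "wf_instr ?M i" if "i \<in> set (prog ?M)" for i
  proof -
    from that have "i \<in> set (compile 0 c) \<or> i = branch p (csize c + 1) (csize c + 2) \<or> i = Accept \<or> i = Reject"
      by (auto simp: machine_def)
    thus ?thesis using wf_compile[of ?M c 0 i] assms(1) * wf_branch[of _ ?M] by auto
  qed
  thus ?thesis using assms * by (auto simp: wf_ptm_def)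
qed

section \<open>Runs of machines without coins\<close>

lemma no_toss_compile: "Toss a b \<notin> set (compile n c)"
  by (induction c arbitrary: n) (auto simp: branch_def)

lemma dstep_absorb: "halted M c \<Longrightarrow> dstep M \<pi> c = c"
  by (auto simp: halted_def dstep_def)

lemma funpow_dstep_absorb: "halted M c \<Longrightarrow> (dstep M \<pi> ^^ n) c = c"
  by (induction n) (auto simp: dstep_absorb)

lemma queries_dstep: "queries c \<le> queries (dstep M \<pi> c)"
  by (auto simp: dstep_def split: instr.splits prod.splits)

lemma queries_funpow: "queries c \<le> queries ((dstep M \<pi> ^^ n) c)"
  by (induction n) (auto intro: order_trans[OF _ queries_dstep])

lemma coins_dstep [simp]: "coins (dstep M \<pi> c) = coins c"
  by (auto simp: dstep_def split: instr.splits prod.splits)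

lemma coins_funpow [simp]: "coins ((dstep M \<pi> ^^ n) c) = coins c"
  by (induction n) auto

lemma step_dstep: "(\<And>a b. prog M ! state c \<noteq> Toss a b) \<Longrightarrow> step M \<pi> c = return_pmf (dstep M \<pi> c)"
  by (auto simp: step_def dstep_def Let_def split: instr.splits prod.splits)

text \<open>The instruction \<open>prog M ! state c\<close> is known only for states in range, and
  \<open>wf_instr\<close> constrains a transition only on scanned words of the right length over the
  alphabet. This invariant supplies both, so that \<open>run_machine\<close> can exclude a
  \<open>Toss\<close>.\<close>

lemma wf_dstep:
  assumes "wf_ptm M" "state c < length (prog M)" "length (tapes c) = num_tapes M"
    "\<forall>t \<in> set (tapes c). \<forall>i. fst t i < num_symbols M"
  shows "state (dstep M \<pi> c) < length (prog M) \<and> length (tapes (dstep M \<pi> c)) = num_tapes M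
    \<and> (\<forall>t \<in> set (tapes (dstep M \<pi> c)). \<forall>i. fst t i < num_symbols M)"
proof -
  have wf: "wf_instr M (prog M ! state c)" using assms by (auto simp: wf_ptm_def)
  show ?thesis
  proof (cases "prog M ! state c")
    case (Step \<delta>)
    let ?ss = "map scan (tapes c)"
    have "length ?ss = num_tapes M" "set ?ss \<subseteq> {..<num_symbols M}"
      using assms by (auto simp: scan_def)
    hence *: "fst (\<delta> ?ss) < length (prog M)" "length (snd (\<delta> ?ss)) = num_tapes M"
       "fst ` set (snd (\<delta> ?ss)) \<subseteq> {..<num_symbols M}" using wf Step by auto
    have "fst t i < num_symbols M" if "t \<in> set (map2 act (tapes c) (snd (\<delta> ?ss)))" for t i
    proof -
      from that obtain z where "z \<in> set (zip (tapes c) (snd (\<delta> ?ss)))" "t = act (fst z) (snd z)"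
        by auto
      then obtain u a where "t = act u a" "u \<in> set (tapes c)" "a \<in> set (snd (\<delta> ?ss))"
        by (metis prod.collapse set_zip_leftD set_zip_rightD)
      thus ?thesis using assms(4) *(3) by (cases u; cases a) fastforce
    qed
    thus ?thesis using * assms Step by (auto simp: dstep_def split: prod.splits)
  qed (use wf assms in \<open>auto simp: dstep_def\<close>)
qed

lemma run_machine:
  fixes p :: "symbol list \<Rightarrow> bool"
  assumes wf: "wf_cmd T N c" "N \<ge> 3" "T \<ge> 2" and w: "set w \<subseteq> {..<N}"
  defines "M \<equiv> machine T N c p"
  shows "run M \<pi> w t = return_pmf ((dstep M \<pi> ^^ t) (init M w))"
proof (induction t)
  case (Suc t)
  have M: "wf_ptm M" using wf_machine[OF wf] by (simp add: M_def)
  let ?c = "(dstep M \<pi> ^^ t) (init M w)"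
  have "state ?c < length (prog M) \<and> length (tapes ?c) = num_tapes M
    \<and> (\<forall>t \<in> set (tapes ?c). \<forall>i. fst t i < num_symbols M)"
  proof (induction t)
    case 0
    have "prog M \<noteq> []" "2 \<le> num_tapes M" "3 \<le> num_symbols M" "num_symbols M = N"
      using M by (auto simp: wf_ptm_def M_def machine_def)
    moreover from this have "\<forall>i. fst (input_tape w) i < num_symbols M" "\<forall>i. fst (input_tape []) i < num_symbols M"
      using w by (auto simp: input_tape_def subset_iff)
    ultimately show ?case by (auto simp: init_def)
  next
    case (Suc t)
    then show ?case using wf_dstep[OF M] by auto
  qed
  hence "prog M ! state ?c \<in> set (prog M)" by auto
  hence "prog M ! state ?c \<noteq> Toss a b" for a b
    by (auto simp: M_def machine_def branch_def no_toss_compile)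
  from step_dstep[OF this] show ?case by (simp add: Suc bind_return_pmf)
qed simp

text \<open>Halted configurations are fixed points of \<open>dstep\<close>, so the run is constant
  from step \<open>Suc n\<close> on. The query count is monotone and hence never exceeds its final
  value, and the acceptance probabilities form a 0-1 sequence whose supremum is its final
  value.\<close>

lemma machine_correct:
  fixes p :: "symbol list \<Rightarrow> bool"
  assumes wf: "wf_cmd T N c" "N \<ge> 3" "T \<ge> 2" and w: "set w \<subseteq> {..<N}"
  defines "M \<equiv> machine T N c p"
  assumes exec: "exec \<pi> c (input_tape w # replicate (T - 1) (input_tape [])) n r s'"
  shows "t > n \<Longrightarrow> x \<in> set_pmf (run M \<pi> w t) \<Longrightarrow> halted M x"
    and "x \<in> set_pmf (run M \<pi> w t) \<Longrightarrow> coins x = 0 \<and> queries x \<le> r"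
    and "accept_prob M \<pi> w = (if p (map scan s') then 1 else 0)"
proof -
  note run = run_machine[OF wf w, of p \<pi>, folded M_def]
  let ?c = "\<lambda>t. (dstep M \<pi> ^^ t) (init M w)"
  have "code_at (prog M) 0 (compile 0 c)"
    by (auto simp: M_def machine_def code_at_def)
  from exec_compile[OF exec this, of 0]
  have n: "?c n = conf (csize c) s' r" by (simp add: init_def M_def machine_def)
  have b: "prog M ! csize c = branch p (csize c + 1) (csize c + 2)"
    and Acc: "prog M ! (csize c + 1) = Accept" and Rej: "prog M ! (csize c + 2) = Reject"
    by (auto simp: M_def machine_def nth_append)
  have n1: "?c (Suc n) = conf (csize c + (if p (map scan s') then 1 else 2)) s' r"
    using n dstep_branch[OF b] by auto
  hence h: "halted M (?c (Suc n))" using Acc Rej by (auto simp: halted_def)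
  have late: "?c t = ?c (Suc n)" if "t > n" for t
  proof -
    have "?c (t - Suc n + Suc n) = ?c (Suc n)"
      unfolding funpow_add o_apply by (rule funpow_dstep_absorb[OF h])
    thus ?thesis using that by simp
  qed
  show "t > n \<Longrightarrow> x \<in> set_pmf (run M \<pi> w t) \<Longrightarrow> halted M x"
    using late h run by simp
  have q: "queries (?c t) \<le> r" for t
  proof -
    have "queries (?c t) \<le> queries ((dstep M \<pi> ^^ Suc n) (?c t))" by (rule queries_funpow)
    also have "(dstep M \<pi> ^^ Suc n) (?c t) = ?c (Suc n + t)" unfolding funpow_add o_apply ..
    also have "\<dots> = ?c (Suc n)" by (rule late) simp
    finally show ?thesis by (simp only: n1 config.simps)
  qed
  show "x \<in> set_pmf (run M \<pi> w t) \<Longrightarrow> coins x = 0 \<and> queries x \<le> r"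
    using q run by (auto simp: init_def)
  have acc: "accepting M (?c (Suc n)) \<longleftrightarrow> p (map scan s')"
    unfolding n1 using Acc Rej by (auto simp: accepting_def)
  have prob: "measure_pmf.prob (run M \<pi> w t) {c. accepting M c} = (if accepting M (?c t) then 1 else 0)" for t
    by (simp add: run indicator_def)
  have early: "accepting M (?c (Suc n))" if "accepting M (?c t)" for t
  proof -
    have "halted M (?c t)" using that by (auto simp: halted_def accepting_def)
    hence "(dstep M \<pi> ^^ Suc n) (?c t) = ?c t" by (rule funpow_dstep_absorb)
    hence "?c (Suc n + t) = ?c t" unfolding funpow_add o_apply .
    moreover have "?c (Suc n + t) = ?c (Suc n)" by (rule late) simp
    ultimately show ?thesis using that by simp
  qed
  show "accept_prob M \<pi> w = (if p (map scan s') then 1 else 0)"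
  proof (cases "p (map scan s')")
    case True
    have "(SUP t. if accepting M (?c t) then 1 else (0::real)) = 1"
    proof (rule antisym)
      show "(SUP t. if accepting M (?c t) then 1 else (0::real)) \<le> 1"
        by (rule cSUP_least) auto
      have "1 = (if accepting M (?c (Suc n)) then 1 else (0::real))" using True acc by simp
      also have "\<dots> \<le> (SUP t. if accepting M (?c t) then 1 else 0)"
        by (rule cSUP_upper) (auto intro!: bdd_aboveI[of _ 1])
      finally show "1 \<le> (SUP t. if accepting M (?c t) then 1 else (0::real))" .
    qed
    thus ?thesis using True by (simp only: accept_prob_def prob if_True)
  next
    case False
    hence "\<not> accepting M (?c t)" for t using acc early by blast
    thus ?thesis using False by (simp add: accept_prob_def prob)
  qed
qed

section \<open>Weakest preconditions with time and query counters\<close>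

text \<open>In \<open>wp\<close>, the numbers \<open>t\<close> and \<open>q\<close> count the steps and queries made so far; rules for subroutines
  bound them only from above.\<close>

definition wp :: "bool list \<Rightarrow> cmd \<Rightarrow> (tape list \<Rightarrow> nat \<Rightarrow> nat \<Rightarrow> bool) \<Rightarrow> tape list \<Rightarrow> nat \<Rightarrow> nat \<Rightarrow> bool" where
  "wp \<pi> c Q s t q \<longleftrightarrow> (\<exists>n r s'. exec \<pi> c s n r s' \<and> Q s' (t + n) (q + r))"

lemma wp_Skip [simp]: "wp \<pi> Skip Q s t q \<longleftrightarrow> Q s t q"
  by (force simp: wp_def intro: exec.intros elim: exec_SkipE)

lemma wp_Op [simp]: "wp \<pi> (Op i g d) Q s t q \<longleftrightarrow> Q (s[i := act (s ! i) (g (map scan s), d)]) (Suc t) q"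
  by (force simp: wp_def intro: exec.Op elim: exec_OpE)

lemma wp_Seq [simp]: "wp \<pi> (c1 ;; c2) Q s t q \<longleftrightarrow> wp \<pi> c1 (wp \<pi> c2 Q) s t q"
  unfolding wp_def by (fastforce simp: add.assoc intro: exec.Seq elim!: exec_SeqE)

lemma wp_Cond [simp]: "wp \<pi> (Cond p c1 c2) Q s t q \<longleftrightarrow>
  (if p (map scan s) then wp \<pi> c1 (\<lambda>s t. Q s (Suc t)) s (Suc t) q else wp \<pi> c2 Q s (Suc t) q)"
  unfolding wp_def
  by (auto elim!: exec_CondE) (metis CondT CondF add_2_eq_Suc' add_Suc_right Suc_eq_plus1 add_Suc)+

text \<open>Kept out of the simp set, as the right side contains the loop again: the rules for loops
  unfold it once and leave the rest to an induction hypothesis.\<close>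

lemma wp_While: "wp \<pi> (While p c) Q s t q \<longleftrightarrow>
  (if p (map scan s) then wp \<pi> c (\<lambda>s t. wp \<pi> (While p c) Q s (Suc t)) s (Suc t) q else Q s (Suc t) q)"
proof
  assume "wp \<pi> (While p c) Q s t q"
  then obtain n r s' where e: "exec \<pi> (While p c) s n r s'" and Q: "Q s' (t + n) (q + r)"
    by (auto simp: wp_def)
  from e consider n1 r1 s1 n2 r2 where "p (map scan s)" "exec \<pi> c s n1 r1 s1"
      "exec \<pi> (While p c) s1 n2 r2 s'" "n = Suc (Suc (n1 + n2))" "r = r1 + r2"
    | "\<not> p (map scan s)" "n = Suc 0" "r = 0" "s' = s"
    by (rule exec_WhileE) blast+
  thus "if p (map scan s) then wp \<pi> c (\<lambda>s t. wp \<pi> (While p c) Q s (Suc t)) s (Suc t) q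
    else Q s (Suc t) q"
  proof cases
    case 1
    have "wp \<pi> (While p c) Q s1 (Suc (Suc t + n1)) (q + r1)"
      unfolding wp_def using 1 Q by (intro exI[of _ n2] exI[of _ r2] exI[of _ s']) (simp_all add: add_ac)
    with 1 show ?thesis by (simp only: if_True wp_def[of _ c])
      (intro exI[of _ n1] exI[of _ r1] exI[of _ s1]; simp)
  qed (use Q in auto)
next
  assume *: "if p (map scan s) then wp \<pi> c (\<lambda>s t. wp \<pi> (While p c) Q s (Suc t)) s (Suc t) q
    else Q s (Suc t) q"
  show "wp \<pi> (While p c) Q s t q"
  proof (cases "p (map scan s)")
    case True
    with * obtain n1 r1 s1 n2 r2 s2 where 1: "exec \<pi> c s n1 r1 s1" "exec \<pi> (While p c) s1 n2 r2 s2"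
      and Q: "Q s2 (Suc (Suc t + n1) + n2) (q + r1 + r2)" by (auto simp: wp_def)
    from Q have "Q s2 (t + (n1 + 2 + n2)) (q + (r1 + r2))" by (simp add: add_ac)
    with WhileT[OF True 1] show ?thesis unfolding wp_def by blast
  next
    case False
    with * have "Q s (t + 1) (q + 0)" by simp
    with WhileF[of p, OF False] show ?thesis unfolding wp_def by blast
  qed
qed

lemma wp_Ask [simp]: "wp \<pi> (Ask c1 c2) Q s t q \<longleftrightarrow>
  (if proof_bit \<pi> (address (s ! 1)) then wp \<pi> c1 (\<lambda>s t. Q s (Suc t)) s (Suc t) (Suc q)
   else wp \<pi> c2 Q s (Suc t) (Suc q))"
  unfolding wp_def
  by (auto elim!: exec_AskE) (metis AskT AskF add_2_eq_Suc' add_Suc_right Suc_eq_plus1 add_Suc One_nat_def)+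

lemma wp_mono:
  "wp \<pi> c Q s t q \<Longrightarrow> (\<And>s' t' q'. Q s' t' q' \<Longrightarrow> Q' s' t' q') \<Longrightarrow> wp \<pi> c Q' s t q"
  unfolding wp_def by blast

lemma list_update_Cons_numeral [simp]:
  "(x # xs)[numeral v := y] = x # xs[pred_numeral v := y]"
  by (simp add: numeral_eq_Suc)

section \<open>Tapes as two words around the head\<close>

fun hd0 :: "symbol list \<Rightarrow> symbol" where
  "hd0 [] = 0"
| "hd0 (a # _) = a"

text \<open>The tape that contains \<open>rev ls @ rs\<close> followed by blanks, with its head on the first symbol of \<open>rs\<close>.\<close>

definition tp :: "symbol list \<Rightarrow> symbol list \<Rightarrow> tape" where
  "tp ls rs = ((\<lambda>i. if i < length ls + length rs then (rev ls @ rs) ! i else 0), length ls)"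

lemma scan_tp [simp]: "scan (tp ls rs) = hd0 rs"
  by (cases rs) (auto simp: scan_def tp_def nth_append)

lemma input_tape_tp: "input_tape w = tp [] w"
  by (auto simp: input_tape_def tp_def)

lemma fst_act_tp: "fst (act (tp ls (a # rs)) (b, d)) = fst (tp ls (b # rs))"
  by (auto simp: tp_def fun_eq_iff nth_append nth_Cons split: nat.splits)

lemma fst_tp_shift: "fst (tp (x # ls) rs) = fst (tp ls (x # rs))"
  by (auto simp: tp_def)

text \<open>Blanks behind the last symbol are invisible, so a tape has several representations. Simp
  prefers the shorter one; \<open>tp_Nil_eq\<close> restores a blank where a cell is needed to act
  on.\<close>

lemma tp_0 [simp]: "tp ls [0] = tp ls []" "tp ls [x, 0] = tp ls [x]"
  by (auto simp: tp_def fun_eq_iff nth_append nth_Cons split: nat.splits)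

lemma tp_Nil_eq: "tp ls [] = tp ls [0]" by simp

lemma snd_act_tp: "snd (act (tp ls rs) (b, d)) = 
    (case d of GoLeft \<Rightarrow> length ls - 1 | Stay \<Rightarrow> length ls | GoRight \<Rightarrow> Suc (length ls))"
  by (auto simp: tp_def)

lemma snd_tp: "snd (tp ls rs) = length ls" by (simp add: tp_def)

lemma act_tp [simp]:
  "act (tp ls (a # rs)) (b, GoRight) = tp (b # ls) rs"
  "act (tp ls (a # rs)) (b, Stay) = tp ls (b # rs)"
  "act (tp (x # ls) (a # rs)) (b, GoLeft) = tp ls (x # b # rs)"
  "act (tp [] (a # rs)) (b, GoLeft) = tp [] (b # rs)"
  by (rule prod_eqI; simp only: fst_act_tp snd_act_tp snd_tp fst_tp_shift dir.case list.size diff_Suc_1 add_Suc_right; simp)+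

lemma act_tp_Nil [simp]:
  "act (tp ls []) (b, GoRight) = tp (b # ls) []"
  "act (tp ls []) (b, Stay) = tp ls [b]"
  "act (tp (x # ls) []) (b, GoLeft) = tp ls [x, b]"
  by (simp_all only: tp_Nil_eq[of ls] tp_Nil_eq[of "x # ls"] act_tp)

lemma act_tp_move [simp]:
  "act (tp ls rs) (hd0 rs, Stay) = tp ls rs"
  "act (tp (x # ls) rs) (hd0 rs, GoLeft) = tp ls (x # rs)"
  "act (tp [] rs) (hd0 rs, GoLeft) = tp [] rs"
proof -
  show "act (tp ls rs) (hd0 rs, Stay) = tp ls rs" by (cases rs) auto
  show "act (tp (x # ls) rs) (hd0 rs, GoLeft) = tp ls (x # rs)" by (cases rs) auto
  show "act (tp [] rs) (hd0 rs, GoLeft) = tp [] rs"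
    by (cases rs) (auto simp: tp_def fun_eq_iff)
qed

text \<open>Flags sit on tapes whose other contents are not tracked; \<open>put\<close> makes sense
  on an arbitrary tape, and \<open>scan_put\<close> is what later tests rely on.\<close>

definition put :: "symbol \<Rightarrow> tape \<Rightarrow> tape" where
  "put a t = act t (a, Stay)"

lemma scan_put [simp]: "scan (put a t) = a"
  by (cases t) (auto simp: put_def scan_def)

lemma put_put [simp]: "put a (put b t) = put a t"
  by (cases t) (auto simp: put_def)

lemma act_Stay: "act t (a, Stay) = put a t" by (simp add: put_def)

definition isbit :: "symbol \<Rightarrow> bool" where "isbit a \<longleftrightarrow> a = 1 \<or> a = 2"

lemma isbit_simps [simp]: "\<not> isbit 0" "isbit 1" "isbit (Suc 0)" "isbit 2"  "\<not> isbit 3" "\<not> isbit 4"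
  "\<not> isbit 5" "\<not> isbit 6" by (auto simp: isbit_def)

lemma list_all_enc_nat [simp]: "list_all isbit (enc_nat n)"
  by (induction n rule: enc_nat.induct) (subst enc_nat.simps, auto)

text \<open>Work tapes leave cell 0 blank, so that both ends of their contents can be recognised.\<close>

definition on :: "symbol list \<Rightarrow> tape \<Rightarrow> bool" where
  "on w t \<longleftrightarrow> (\<exists>ls rs. t = tp ls rs \<and> rev ls @ rs = 0 # w)"

lemma on_tp: "rev ls @ rs = 0 # w \<Longrightarrow> on w (tp ls rs)"
  by (auto simp: on_def)

abbreviation mv :: "nat \<Rightarrow> dir \<Rightarrow> cmd" where "mv i \<equiv> Op i (\<lambda>ss. ss ! i)"
abbreviation wr :: "nat \<Rightarrow> symbol \<Rightarrow> dir \<Rightarrow> cmd" where "wr i a \<equiv> Op i (\<lambda>_. a)"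
abbreviation cp :: "nat \<Rightarrow> nat \<Rightarrow> dir \<Rightarrow> cmd" where "cp i j \<equiv> Op i (\<lambda>ss. ss ! j)"

definition BackTo :: "nat \<Rightarrow> symbol \<Rightarrow> cmd" where
  "BackTo i a = mv i GoLeft ;; While (\<lambda>ss. ss ! i \<noteq> a) (mv i GoLeft)"

definition Rewind :: "nat \<Rightarrow> cmd" where
  "Rewind i = BackTo i 0 ;; mv i GoRight"

text \<open>Reverse induction, because the last symbol of \<open>w\<close> is met first. After one
  iteration the move in the loop body takes the part of the initial move, so \<open>BackTo\<close>
  itself reappears.\<close>

lemma wp_BackTo:
  assumes "i < length s" "s ! i = tp (rev w @ a # ls) rs" "a \<notin> set w"
    and "\<And>t'. t' \<le> t + 3 * length w + 4 \<Longrightarrow> Q (s[i := tp ls (a # w @ rs)]) t' q"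
  shows "wp \<pi> (BackTo i a) Q s t q"
  using assms
proof (induction w arbitrary: s t rs rule: rev_induct)
  case Nil
  then show ?case by (simp add: BackTo_def wp_While)
next
  case (snoc x w)
  let ?s = "s[i := tp (rev w @ a # ls) (x # rs)]"
  have *: "wp \<pi> (BackTo i a) Q ?s (Suc (Suc (Suc t))) q"
    if "\<And>t'. t' \<le> Suc (Suc (Suc t)) + 3 * length w + 4 \<Longrightarrow> Q (s[i := tp ls (a # (w @ [x]) @ rs)]) t' q"
    using that snoc.prems by (intro snoc.IH) auto
  show ?case using snoc.prems * unfolding BackTo_def by (simp, subst wp_While) (simp)
qed

text \<open>No symbol of \<open>w\<close> is blank, so going left first meets a blank in cell 0. As
  \<open>BackTo\<close> moves before it tests, the head may start on the blank behind
  \<open>w\<close>; if it starts on cell 0, the left move leaves it there.\<close>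

lemma wp_Rewind:
  assumes "i < length s" "on w (s ! i)" "0 \<notin> set w"
    and "\<And>t'. t' \<le> t + 3 * length w + 6 \<Longrightarrow> Q (s[i := tp [0] w]) t' q"
  shows "wp \<pi> (Rewind i) Q s t q"
proof -
  from assms(2) obtain ls rs where s: "s ! i = tp ls rs" and w: "rev ls @ rs = 0 # w"
    by (auto simp: on_def)
  show ?thesis
  proof (cases ls rule: rev_cases)
    case Nil
    then show ?thesis using s w assms by (simp add: Rewind_def BackTo_def wp_While)
  next
    case (snoc ls' x)
    then have x: "x = 0" and w: "w = rev ls' @ rs" using w by auto
    have "wp \<pi> (BackTo i 0) (wp \<pi> (mv i GoRight) Q) s t q"
      by (rule wp_BackTo[where w="rev ls'" and ls="[]" and rs=rs])
        (use assms s w snoc x in auto)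
    thus ?thesis by (simp add: Rewind_def)
  qed
qed

definition SkipBits :: "nat \<Rightarrow> cmd" where
  "SkipBits i = While (\<lambda>ss. isbit (ss ! i)) (mv i GoRight)"

lemma wp_SkipBits:
  assumes "i < length s" "s ! i = tp ls (bs @ rs)" "list_all isbit bs" "\<not> isbit (hd0 rs)"
    and "\<And>t'. t' \<le> t + 3 * length bs + 1 \<Longrightarrow> Q (s[i := tp (rev bs @ ls) rs]) t' q"
  shows "wp \<pi> (SkipBits i) Q s t q"
  using assms
proof (induction bs arbitrary: ls s t)
  case Nil
  then show ?case by (simp add: SkipBits_def wp_While) (metis add_Suc_right add.right_neutral list_update_id order_refl)
next
  case (Cons b bs)
  have "wp \<pi> (SkipBits i) Q (s[i := tp (b # ls) (bs @ rs)]) (Suc (Suc (Suc t))) q"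
    by (rule Cons.IH) (use Cons.prems in auto)
  thus ?case using Cons.prems unfolding SkipBits_def by (subst wp_While) simp
qed

section \<open>Dictionary lookup\<close>

text \<open>The machine has six tapes. Tape 0 holds the input and, once it has been read, the result flag of
  \<open>Lookup\<close>; tape 1 is the query tape and finally holds the verdict (1 for acceptance); tape 2 holds
  a copy of the formula; tape 3 is a dictionary of the variable names, each preceded by 3 or 4 for
  the current value false or true; tape 4 holds \<open>k + 1\<close> cells and serves both as a binary counter
  below \<open>2 ^ (k + 1)\<close> and as a unary counter up to \<open>k\<close>; tape 5 holds a flag telling whether the
  current clause is satisfied.\<close>

definition CmpBack :: cmd where
  "CmpBack = mv 2 GoLeft ;; mv 3 GoLeft ;; While (\<lambda>ss. ss ! 2 \<noteq> 3) (mv 2 GoLeft ;; mv 3 GoLeft)"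

definition Cmp :: cmd where
  "Cmp = mv 2 GoRight ;; mv 3 GoRight ;;
     While (\<lambda>ss. isbit (ss ! 2) \<and> ss ! 2 = ss ! 3) (mv 2 GoRight ;; mv 3 GoRight) ;;
     Cond (\<lambda>ss. isbit (ss ! 2) \<or> isbit (ss ! 3)) (wr 0 2 Stay) (wr 0 1 Stay) ;; CmpBack"

text \<open>Flag 1 leaves the head of tape 3 on the marker of the entry found, where its value can
  be read or overwritten; flag 2 leaves it behind the dictionary, where a new entry can be
  appended.\<close>

definition Lookup :: cmd where
  "Lookup = Rewind 3 ;; wr 0 2 Stay ;;
     While (\<lambda>ss. ss ! 0 = 2 \<and> 0 < ss ! 3)
       (Cmp ;; Cond (\<lambda>ss. ss ! 0 = 2) (mv 3 GoRight ;; SkipBits 3) Skip)"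

definition denc :: "(nat \<times> bool) list \<Rightarrow> symbol list" where
  "denc ps = concat (map (\<lambda>(x, b). (if b then 4 else 3) # enc_nat x) ps)"

lemma denc_simps [simp]:
  "denc [] = []" "denc ((x, b) # ps) = (if b then 4 else 3) # enc_nat x @ denc ps"
  "denc (ps @ ps') = denc ps @ denc ps'"
  by (auto simp: denc_def)

lemma zero_notin_enc_nat [simp]: "0 \<notin> set (enc_nat n)" "3 \<notin> set (enc_nat n)"
  using list_all_enc_nat[of n] by (auto simp: list_all_iff)

lemma zero_notin_denc [simp]: "0 \<notin> set (denc ps)"
  by (auto simp: denc_def split: if_splits)

lemma length_le_denc: "length ps \<le> length (denc ps)"
  by (induction ps) auto

lemma hd0_denc [simp]: "\<not> isbit (hd0 (denc ps))"
proof (cases ps)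
  case (Cons p ps')
  thus ?thesis by (cases p; cases "snd p") auto
qed simp

lemma isbit_hd0_append:
  "list_all isbit bs \<Longrightarrow> \<not> isbit (hd0 r) \<Longrightarrow> isbit (hd0 (bs @ r)) \<longleftrightarrow> bs \<noteq> []"
  by (cases bs) auto

text \<open>The loop stops behind a common prefix \<open>us\<close>. Each word is followed by a
  non-bit, so \<open>Cmp\<close> recognises equality by neither head scanning a bit.\<close>

lemma wp_CmpLoop:
  assumes "list_all isbit bs" "list_all isbit cs" "\<not> isbit (hd0 rf)" "\<not> isbit (hd0 rd)"
    and "\<And>us bs' cs' t'. bs = us @ bs' \<Longrightarrow> cs = us @ cs' \<Longrightarrow> bs = cs \<longleftrightarrow> bs' = [] \<and> cs' = [] \<Longrightarrow>
      t' \<le> t + 4 * length us + 1 \<Longrightarrow>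
      Q [t0, t1, tp (rev us @ lf) (bs' @ rf), tp (rev us @ ld) (cs' @ rd), K, g] t' q"
  shows "wp \<pi> (While (\<lambda>ss. isbit (ss ! 2) \<and> ss ! 2 = ss ! 3) (mv 2 GoRight ;; mv 3 GoRight)) Q
    [t0, t1, tp lf (bs @ rf), tp ld (cs @ rd), K, g] t q"
  using assms
proof (induction bs arbitrary: cs lf ld t)
  case Nil
  then show ?case using Nil.prems(5)[of "[]" "[]" cs "Suc t"] by (subst wp_While) auto
next
  case (Cons b bs)
  show ?case
  proof (cases "\<exists>cs'. cs = b # cs'")
    case True
    then obtain cs' where cs: "cs = b # cs'" by blast
    have "wp \<pi> (While (\<lambda>ss. isbit (ss ! 2) \<and> ss ! 2 = ss ! 3) (mv 2 GoRight ;; mv 3 GoRight)) Q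
      [t0, t1, tp (b # lf) (bs @ rf), tp (b # ld) (cs' @ rd), K, g] (Suc (Suc (Suc (Suc t)))) q"
    proof (rule Cons.IH, goal_cases)
      case (5 us bs' cs'' t')
      then show ?case using Cons.prems(5)[of "b # us" bs' cs'' t'] cs by auto
    qed (use Cons.prems cs in auto)
    thus ?thesis using Cons.prems cs by (subst wp_While) simp
  next
    case False
    hence "b \<noteq> hd0 (cs @ rd)" using Cons.prems by (cases cs) auto
    thus ?thesis using Cons.prems(5)[of "[]" "b # bs" cs "Suc t"] False by (subst wp_While) auto
  qed
qed

text \<open>Only tape 2 is tested, since its marker is always 3 while that of a dictionary entry may
  be 3 or 4. Both heads have advanced over the same \<open>us\<close>, so both return to their
  markers.\<close>

lemma wp_CmpBack:
  assumes "3 \<notin> set us"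
    and "\<And>t'. t' \<le> t + 4 * length us + 3 \<Longrightarrow> Q [t0, t1, tp lf (3 # us @ rf), tp ld (h # us @ rd), K, g] t' q"
  shows "wp \<pi> CmpBack Q
    [t0, t1, tp (rev us @ 3 # lf) rf, tp (rev us @ h # ld) rd, K, g] t q"
  using assms
proof (induction us arbitrary: rf rd t rule: rev_induct)
  case Nil
  then show ?case by (simp add: CmpBack_def wp_While)
next
  case (snoc u us)
  have "wp \<pi> CmpBack Q
    [t0, t1, tp (rev us @ 3 # lf) (u # rf), tp (rev us @ h # ld) (u # rd), K, g] (Suc (Suc (Suc (Suc t)))) q"
    using snoc.prems by (intro snoc.IH) auto
  thus ?case using snoc.prems unfolding CmpBack_def by (simp, subst wp_While) simp
qed

lemma wp_Cmp:
  assumes "list_all isbit bs" "list_all isbit cs" "\<not> isbit (hd0 rf)" "\<not> isbit (hd0 rd)"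
    and "\<And>t'. t' \<le> t + 8 * length bs + 10 \<Longrightarrow>
      Q [put (if bs = cs then 1 else 2) t0, t1, tp lf (3 # bs @ rf), tp ld (h # cs @ rd), K, g] t' q"
  shows "wp \<pi> Cmp Q [t0, t1, tp lf (3 # bs @ rf), tp ld (h # cs @ rd), K, g] t q"
  unfolding Cmp_def
  apply simp
  apply (rule wp_CmpLoop[OF assms(1-4)])
  subgoal premises prems for us bs' cs' t'
  proof -
    have us: "3 \<notin> set us" using assms(1) prems(1) by (metis list_all_iff isbit_simps(5) Un_iff set_append)
    have bs: "isbit (hd0 (bs' @ rf)) \<longleftrightarrow> bs' \<noteq> []" "isbit (hd0 (cs' @ rd)) \<longleftrightarrow> cs' \<noteq> []"
      using assms prems(1,2) by (auto intro!: isbit_hd0_append)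
    have "wp \<pi> CmpBack Q [put (if bs = cs then 1 else 2) t0, t1, tp (rev us @ 3 # lf) (bs' @ rf),
      tp (rev us @ h # ld) (cs' @ rd), K, g] t'' q" if "t'' \<le> t' + 3" for t''
      by (rule wp_CmpBack[OF us]) (use assms(5) prems(1,2,4) that in auto)
    thus ?thesis using prems(3) bs by (auto simp: act_Stay)
  qed
  done

fun bval :: "symbol list \<Rightarrow> nat" where
  "bval [] = 0"
| "bval (b # bs) = (b - 1) + 2 * bval bs"

text \<open>Decoding yields the injectivity of names written on tapes and, through
  \<open>address_tp\<close>, the position that a query reads.\<close>

lemma bval_enc_nat [simp]: "bval (enc_nat n) = n"
  by (induction n rule: enc_nat.induct) (subst enc_nat.simps, auto)

lemma enc_nat_inject [simp]: "enc_nat x = enc_nat y \<longleftrightarrow> x = y"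
  by (metis bval_enc_nat)

lemma wp_LookupLoop:
  assumes "length (enc_nat x) < N" "length (denc vs) < N" "\<not> isbit (hd0 rf)"
    and "\<And>as b cs t'. vs = as @ (x, b) # cs \<Longrightarrow> x \<notin> fst ` set as \<Longrightarrow>
      t' \<le> t + length vs * (11 * N + 20) + 1 \<Longrightarrow>
      Q [put 1 t0, t1, tp lf (3 # enc_nat x @ rf), tp (rev (denc as) @ ld) (denc ((x, b) # cs)), K, g] t' q"
    and "\<And>t'. x \<notin> fst ` set vs \<Longrightarrow> t' \<le> t + length vs * (11 * N + 20) + 1 \<Longrightarrow>
      Q [put 2 t0, t1, tp lf (3 # enc_nat x @ rf), tp (rev (denc vs) @ ld) [], K, g] t' q"
  shows "wp \<pi> (While (\<lambda>ss. ss ! 0 = 2 \<and> 0 < ss ! 3)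
       (Cmp ;; Cond (\<lambda>ss. ss ! 0 = 2) (mv 3 GoRight ;; SkipBits 3) Skip)) Q
    [put 2 t0, t1, tp lf (3 # enc_nat x @ rf), tp ld (denc vs), K, g] t q"
  using assms
proof (induction vs arbitrary: ld t)
  case Nil
  then show ?case by (subst wp_While) simp
next
  case (Cons v vs)
  obtain y c where v: "v = (y, c)" by (cases v)
  define h where "h = (if c then 4 else 3 :: symbol)"
  have h: "h > 0" "denc (v # vs) = h # enc_nat y @ denc vs" by (auto simp: h_def v)
  let ?W = "While (\<lambda>ss. ss ! 0 = 2 \<and> 0 < ss ! 3)
       (Cmp ;; Cond (\<lambda>ss. ss ! 0 = 2) (mv 3 GoRight ;; SkipBits 3) Skip)"
  have "wp \<pi> (Cmp ;; Cond (\<lambda>ss. ss ! 0 = 2) (mv 3 GoRight ;; SkipBits 3) Skip)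
    (\<lambda>s t. wp \<pi> ?W Q s (Suc t))
    [put 2 t0, t1, tp lf (3 # enc_nat x @ rf), tp ld (h # enc_nat y @ denc vs), K, g] (Suc t) q"
    unfolding wp_Seq
  proof (rule wp_Cmp, goal_cases)
    case (5 t')
    show ?case
    proof (cases "x = y")
      case True
      have "Q [put 1 t0, t1, tp lf (3 # enc_nat x @ rf), tp ld (denc (v # vs)), K, g] t'' q"
        if "t'' \<le> t' + 4" for t''
        using that 5 Cons.prems(1) Cons.prems(4)[of "[]" c vs t''] True v by (simp del: denc_simps(2))
      thus ?thesis using True h by (simp, subst wp_While) simp
    next
      case False
      have "wp \<pi> (SkipBits 3) (\<lambda>s t. wp \<pi> ?W Q s (Suc (Suc t)))
        [put 2 t0, t1, tp lf (3 # enc_nat x @ rf), tp (h # ld) (enc_nat y @ denc vs), K, g]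
        (Suc (Suc t')) q"
      proof (rule wp_SkipBits[where bs = "enc_nat y" and rs = "denc vs" and ls = "h # ld"], goal_cases)
        case t'': (5 t'')
        have t: "Suc (Suc t'') \<le> t + 11 * N + 20"
          using t'' 5 Cons.prems(1,2) h by simp
        have "wp \<pi> ?W Q [put 2 t0, t1, tp lf (3 # enc_nat x @ rf),
          tp (rev (h # enc_nat y) @ ld) (denc vs), K, g] (Suc (Suc t'')) q"
        proof (rule Cons.IH, goal_cases)
          case (4 as b cs u)
          then show ?case using t Cons.prems(4)[of "v # as" b cs u] False v h_def by simp
        next
          case (5 u)
          then show ?case using t Cons.prems(5)[of u] False v h_def by simp
        qed (use Cons.prems v in auto)
        thus ?case using v by simp
      qed auto
      thus ?thesis using False by simp
    qed
  qed (use Cons.prems in auto)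
  thus ?case using h by (subst wp_While) simp
qed

text \<open>\<open>N\<close> is any bound on the words involved, in the end the length of the input.
  An entry costs about \<open>8 * N\<close> steps to compare and \<open>3 * N\<close> to skip;
  constants such as 45 are generous and absorb the lower-order terms.\<close>

lemma wp_Lookup:
  assumes "length (enc_nat x) < N" "length (denc ps) < N" "\<not> isbit (hd0 rf)" "on (denc ps) D"
    and "\<And>as b cs t'. ps = as @ (x, b) # cs \<Longrightarrow> x \<notin> fst ` set as \<Longrightarrow> t' \<le> t + 45 * N * N \<Longrightarrow>
      Q [put 1 t0, t1, tp lf (3 # enc_nat x @ rf), tp (rev (denc as) @ [0]) (denc ((x, b) # cs)), K, g] t' q"
    and "\<And>t'. x \<notin> fst ` set ps \<Longrightarrow> t' \<le> t + 45 * N * N \<Longrightarrow>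
      Q [put 2 t0, t1, tp lf (3 # enc_nat x @ rf), tp (rev (denc ps) @ [0]) [], K, g] t' q"
  shows "wp \<pi> Lookup Q [t0, t1, tp lf (3 # enc_nat x @ rf), D, K, g] t q"
proof -
  have N: "N \<ge> 1" using assms by auto
  have "length ps < N" using assms(2) length_le_denc[of ps] by simp
  hence "length ps * (11 * N + 20) \<le> N * (11 * N + 20)" by (intro mult_right_mono) auto
  also have "\<dots> \<le> 31 * N * N" using N by (simp add: algebra_simps)
  finally have L: "length ps * (11 * N + 20) \<le> 31 * N * N" .
  have "N \<le> N * N" "1 \<le> N * N" using N by auto
  hence B: "t + 3 * length (denc ps) + 7 + length ps * (11 * N + 20) + 1 \<le> t + 45 * N * N" for t
    using L assms(2) by linarith
  show ?thesis unfolding Lookup_def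
    apply (subst wp_Seq)
    apply (rule wp_Rewind[where w = "denc ps"])
       apply (use assms in simp_all)
    apply (simp add: act_Stay del: wp_While)
    apply (rule wp_LookupLoop[where N = N])
        apply (use assms B in \<open>force+\<close>)
    done
qed

section \<open>Finding an unsatisfied clause\<close>

declare One_nat_def [simp del]

text \<open>With \<open>One_nat_def\<close> out of the simp set, symbols and tape indices stay in
  the form \<open>1\<close>, and access to tape 1 needs its own rules.\<close>

lemma Cons_1_simps [simp]:
  "(x # xs) ! 1 = xs ! 0" "(x # xs)[1 := y] = x # xs[0 := y]" "numeral num.One = (1::nat)"
  "(case 1 of 0 \<Rightarrow> a | Suc j \<Rightarrow> h j) = h 0"
  by (simp_all add: One_nat_def)

text \<open>From here on a clause is a list of variable names; for positive formulas the tape format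
  agrees with that of instances, see \<open>enc_instance_eq\<close>.\<close>

definition lenc :: "nat list \<Rightarrow> symbol list" where
  "lenc C = concat (map (\<lambda>x. 3 # enc_nat x) C)"

definition fenc :: "nat list list \<Rightarrow> symbol list" where
  "fenc \<psi> = concat (map (\<lambda>C. 5 # lenc C) \<psi>)"

lemma lenc_simps [simp]: "lenc [] = []" "lenc (x # C) = 3 # enc_nat x @ lenc C"
  by (auto simp: lenc_def)

lemma fenc_simps [simp]: "fenc [] = []" "fenc (C # \<psi>) = 5 # lenc C @ fenc \<psi>"
  "fenc (\<psi> @ \<psi>') = fenc \<psi> @ fenc \<psi>'"
  by (auto simp: fenc_def)

lemma notin_enc_nat: "\<not> isbit a \<Longrightarrow> a \<notin> set (enc_nat n)"
  using list_all_enc_nat[of n] by (auto simp: list_all_iff)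

lemma notin_lenc [simp]: "0 \<notin> set (lenc C)" "5 \<notin> set (lenc C)" "6 \<notin> set (lenc C)"
  by (induction C) (auto simp: notin_enc_nat)

lemma notin_fenc [simp]: "0 \<notin> set (fenc \<psi>)" "6 \<notin> set (fenc \<psi>)"
  by (induction \<psi>) auto

lemma length_le_lenc: "length C \<le> length (lenc C)"
  by (induction C) auto

lemma length_le_fenc: "length \<psi> \<le> length (fenc \<psi>)"
  by (induction \<psi>) auto

lemma hd0_fenc [simp]: "\<not> isbit (hd0 (fenc \<psi>))" "hd0 (fenc \<psi>) \<noteq> 3"
  by (cases \<psi>; simp)+

lemma hd0_lenc_append [simp]: "\<not> isbit (hd0 rest) \<Longrightarrow> \<not> isbit (hd0 (lenc C @ rest))"
  by (cases C) auto

definition csat :: "(nat \<times> bool) list \<Rightarrow> nat list \<Rightarrow> bool" where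
  "csat ps C \<longleftrightarrow> (\<exists>x \<in> set C. (x, True) \<in> set ps)"

definition LitBody :: cmd where
  "LitBody = Lookup ;; Cond (\<lambda>ss. ss ! 3 = 4) (wr 5 1 Stay) Skip ;; mv 2 GoRight ;; SkipBits 2"

text \<open>An unsatisfied clause is rewound to its marker 5: \<open>FindUnsat\<close> then stops in
  front of it and \<open>Pick\<close> can read it again. A blank under the head of tape 2 thus comes
  to mean that all clauses are satisfied.\<close>

definition ClauseSat :: cmd where
  "ClauseSat = wr 5 2 Stay ;; mv 2 GoRight ;; While (\<lambda>ss. ss ! 2 = 3) LitBody ;;
     Cond (\<lambda>ss. ss ! 5 = 2) (BackTo 2 5) Skip"

definition FindUnsat :: cmd where
  "FindUnsat = Rewind 2 ;; wr 5 1 Stay ;; While (\<lambda>ss. ss ! 5 = 1 \<and> ss ! 2 = 5) ClauseSat"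

lemma on_entry:
  assumes "ps = as @ (x, b) # cs"
  shows "on (denc ps) (tp (rev (denc as) @ [0]) (denc ((x, b) # cs)))"
  using assms by (auto intro!: on_tp)

lemma on_end: "on (denc ps) (tp (rev (denc ps) @ [0]) [])"
  by (auto intro!: on_tp)

lemma wp_LitBody:
  assumes N: "length (denc ps) < N" "length (enc_nat x) < N"
    and ps: "distinct (map fst ps)" "x \<in> fst ` set ps"
    and rest: "\<not> isbit (hd0 rest)" and D: "on (denc ps) D" and g: "scan g = (if b then 1 else 2)"
    and Q: "\<And>t0' D' g' t'. t' \<le> t + 45 * N * N + 3 * N + 6 \<Longrightarrow> on (denc ps) D' \<Longrightarrow>
      scan g' = (if b \<or> (x, True) \<in> set ps then 1 else 2) \<Longrightarrow>
      Q [t0', t1, tp (rev (enc_nat x) @ 3 # lf) rest, D', K, g'] t' q"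
  shows "wp \<pi> LitBody Q [t0, t1, tp lf (3 # enc_nat x @ rest), D, K, g] t q"
  unfolding LitBody_def wp_Seq
proof (rule wp_Lookup[where N = N and ps = ps], goal_cases)
  case (5 as c cs t')
  \<comment> \<open>Names are distinct, so the entry found is the only one for \<open>x\<close> and
    its marker is the value of \<open>x\<close>.\<close>
  have c: "(x, True) \<in> set ps \<longleftrightarrow> c" using ps 5 by (cases c) (auto simp: image_iff)
  have *: "wp \<pi> (SkipBits 2) Q [put 1 t0, t1, tp (3 # lf) (enc_nat x @ rest),
      tp (rev (denc as) @ [0]) (denc ((x, c) # cs)), K, g'] t'' q"
    if "t'' \<le> t' + 4" "scan g' = (if b \<or> c then 1 else 2)" for t'' g'
    by (rule wp_SkipBits[where bs = "enc_nat x" and rs = rest and ls = "3 # lf"])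
      (use that 5 rest c on_entry[OF 5(1)] N(2) in \<open>auto intro!: Q simp del: denc_simps\<close>)
  show ?case using *[of "Suc (Suc (Suc (Suc t')))" "put 1 g"] *[of "Suc (Suc t')" g]
    g by (cases c) (auto simp: act_Stay)
next
  case (6 t')
  then show ?case using ps by simp
qed (use assms in auto)

lemma wp_LitLoop:
  assumes "length (denc ps) < N" "length (lenc C) < N"
    and "distinct (map fst ps)" "set C \<subseteq> fst ` set ps"
    and "\<not> isbit (hd0 rest)" "hd0 rest \<noteq> 3" "on (denc ps) D" "scan g = (if b then 1 else 2)"
    and "\<And>t0' D' g' t'. t' \<le> t + length C * (57 * N * N) + 1 \<Longrightarrow> on (denc ps) D' \<Longrightarrow>
      scan g' = (if b \<or> csat ps C then 1 else 2) \<Longrightarrow>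
      Q [t0', t1, tp (rev (lenc C) @ lf) rest, D', K, g'] t' q"
  shows "wp \<pi> (While (\<lambda>ss. ss ! 2 = 3) LitBody) Q [t0, t1, tp lf (lenc C @ rest), D, K, g] t q"
  using assms
proof (induction C arbitrary: t0 lf D g b t)
  case Nil
  then show ?case by (subst wp_While) (simp add: csat_def)
next
  case (Cons x C)
  have N: "3 * N + 9 \<le> 12 * N * N" using Cons.prems(1) by (cases N) auto
  have "wp \<pi> LitBody (\<lambda>s t. wp \<pi> (While (\<lambda>ss. ss ! 2 = 3) LitBody) Q s (Suc t))
    [t0, t1, tp lf (3 # enc_nat x @ lenc C @ rest), D, K, g] (Suc t) q"
  proof (rule wp_LitBody[where N = N and ps = ps and b = b], goal_cases)
    case (8 t0' D' g' t')
    show ?case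
    proof (rule Cons.IH[where b = "b \<or> (x, True) \<in> set ps"], goal_cases)
      case (9 t'' D'' g'' t0'')
      show ?case
        using Cons.prems(9)[where t' = t'' and D' = D'' and t0' = t0'' and g' = g''] 9 8(1) N
        by (auto simp: csat_def algebra_simps)
    qed (use Cons.prems 8 in auto)
  qed (use Cons.prems in auto)
  thus ?case by (subst wp_While) simp
qed

lemma wp_ClauseSat:
  assumes "length (denc ps) < N" "length (lenc C) < N"
    and "distinct (map fst ps)" "set C \<subseteq> fst ` set ps"
    and "\<not> isbit (hd0 rest)" "hd0 rest \<noteq> 3" "on (denc ps) D"
    and "\<And>t0' D' g' t'. t' \<le> t + 70 * N ^ 3 \<Longrightarrow> on (denc ps) D' \<Longrightarrow>
      csat ps C \<Longrightarrow> scan g' = 1 \<Longrightarrow>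
      Q [t0', t1, tp (rev (lenc C) @ 5 # lf) rest, D', K, g'] t' q"
    and "\<And>t0' D' g' t'. t' \<le> t + 70 * N ^ 3 \<Longrightarrow> on (denc ps) D' \<Longrightarrow>
      \<not> csat ps C \<Longrightarrow> scan g' = 2 \<Longrightarrow>
      Q [t0', t1, tp lf (5 # lenc C @ rest), D', K, g'] t' q"
  shows "wp \<pi> ClauseSat Q [t0, t1, tp lf (5 # lenc C @ rest), D, K, g] t q"
proof -
  have "N \<ge> 1" using assms by auto
  hence N: "N ^ 3 \<ge> N" "N ^ 3 \<ge> 1" using power_increasing[of 1 3 N] by auto
  have "length C \<le> N" using length_le_lenc[of C] assms by simp
  hence C: "length C * (57 * N * N) \<le> 57 * N ^ 3" by (simp add: power3_eq_cube)
  show ?thesis unfolding ClauseSat_def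
    apply (simp add: act_Stay)
    apply (rule wp_LitLoop[where N = N and ps = ps and b = False])
    using assms(1-7) apply simp_all
    subgoal for t0' D' g' t'
      apply (auto intro!: assms(8) split: if_splits)
      subgoal using C N by linarith
      apply (rule wp_BackTo[where w = "lenc C" and ls = lf and rs = rest])
         apply simp_all
      apply (rule assms(9))
      using C N assms(2) by auto
    done
qed

lemma wp_FindLoop:
  assumes "length (denc ps) < N" "length (fenc \<psi>) < N"
    and "distinct (map fst ps)" "\<Union> (set ` set \<psi>) \<subseteq> fst ` set ps"
    and "on (denc ps) D" "scan g = 1"
    and "\<And>t0' D' g' t'. t' \<le> t + length \<psi> * (70 * N ^ 3 + 2) + 1 \<Longrightarrow> on (denc ps) D' \<Longrightarrow>
      (\<forall>C \<in> set \<psi>. csat ps C) \<Longrightarrow> Q [t0', t1, tp (rev (fenc \<psi>) @ lf) [], D', K, g'] t' q"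
    and "\<And>t0' D' g' t' \<rho> C \<sigma>. t' \<le> t + length \<psi> * (70 * N ^ 3 + 2) + 1 \<Longrightarrow> on (denc ps) D' \<Longrightarrow>
      \<psi> = \<rho> @ C # \<sigma> \<Longrightarrow> \<not> csat ps C \<Longrightarrow>
      Q [t0', t1, tp (rev (fenc \<rho>) @ lf) (fenc (C # \<sigma>)), D', K, g'] t' q"
  shows "wp \<pi> (While (\<lambda>ss. ss ! 5 = 1 \<and> ss ! 2 = 5) ClauseSat) Q
    [t0, t1, tp lf (fenc \<psi>), D, K, g] t q"
  using assms
proof (induction \<psi> arbitrary: t0 lf D g t)
  case Nil
  then show ?case by (subst wp_While) simp
next
  case (Cons C \<psi>)
  have "wp \<pi> ClauseSat (\<lambda>s t. wp \<pi> (While (\<lambda>ss. ss ! 5 = 1 \<and> ss ! 2 = 5) ClauseSat) Q s (Suc t))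
    [t0, t1, tp lf (5 # lenc C @ fenc \<psi>), D, K, g] (Suc t) q"
  proof (rule wp_ClauseSat[where N = N and ps = ps], goal_cases)
    case (8 t0' D' g' t')
    show ?case
    proof (rule Cons.IH, goal_cases)
      case (7 t'' D'' t0'' g'')
      show ?case
        using Cons.prems(7)[where t' = t'' and D' = D'' and t0' = t0'' and g' = g''] 7 8
        by (auto simp: algebra_simps)
    next
      case (8 t'' D'' \<rho> C' \<sigma> t0'' g'')
      show ?case
        using Cons.prems(8)[where \<rho> = "C # \<rho>" and t' = t'' and D' = D'' and t0' = t0'' and g' = g'']
          8 \<open>t' \<le> _\<close> by (auto simp: algebra_simps)
    qed (use Cons.prems 8 in auto)
  next
    case (9 t0' D' g' t')
    then show ?case using Cons.prems(8)[where t' = "Suc (Suc t')" and D' = D' and \<rho> = "[]" and t0' = t0' and g' = g'] by (subst wp_While) auto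
  qed (use Cons.prems in auto)
  thus ?case using Cons.prems(6) by (subst wp_While) simp
qed

lemma wp_FindUnsat:
  assumes "length (denc ps) < N" "length (fenc \<psi>) < N"
    and "distinct (map fst ps)" "\<Union> (set ` set \<psi>) \<subseteq> fst ` set ps"
    and "on (fenc \<psi>) F" "on (denc ps) D"
    and "\<And>t0' D' g' t'. t' \<le> t + 85 * N ^ 4 \<Longrightarrow> on (denc ps) D' \<Longrightarrow>
      (\<forall>C \<in> set \<psi>. csat ps C) \<Longrightarrow> Q [t0', t1, tp (rev (fenc \<psi>) @ [0]) [], D', K, g'] t' q"
    and "\<And>t0' D' g' t' \<rho> C \<sigma>. t' \<le> t + 85 * N ^ 4 \<Longrightarrow> on (denc ps) D' \<Longrightarrow>
      \<psi> = \<rho> @ C # \<sigma> \<Longrightarrow> \<not> csat ps C \<Longrightarrow>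
      Q [t0', t1, tp (rev (fenc \<rho>) @ [0]) (fenc (C # \<sigma>)), D', K, g'] t' q"
  shows "wp \<pi> FindUnsat Q [t0, t1, F, D, K, g] t q"
proof -
  have "N \<ge> 1" using assms by auto
  hence N: "N ^ 4 \<ge> N" "N ^ 4 \<ge> 1" using power_increasing[of 1 4 N] by auto
  have "length \<psi> * (70 * N ^ 3 + 2) \<le> N * (70 * N ^ 3 + 2)"
    using length_le_fenc[of \<psi>] assms by (intro mult_right_mono) auto
  also have "\<dots> = 70 * N ^ 4 + 2 * N" by (simp add: algebra_simps power_eq_if)
  finally have B: "t + 3 * length (fenc \<psi>) + 7 + length \<psi> * (70 * N ^ 3 + 2) + 1 \<le> t + 85 * N ^ 4" for t
    using N assms(2) by linarith
  show ?thesis unfolding FindUnsat_def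
    apply (subst wp_Seq)
    apply (rule wp_Rewind[where w = "fenc \<psi>"])
    using assms(1-6) apply simp_all
    subgoal for t'
      apply (simp add: act_Stay)
      apply (rule wp_FindLoop[where N = N and ps = ps])
      using assms(1-6) apply simp_all
      subgoal using B[of t] by (intro assms(7)) auto
      subgoal for t0' D' g' t'' \<rho> C \<sigma>
        using assms(8)[where t' = t'' and D' = D' and \<rho> = \<rho> and t0' = t0' and g' = g'] B[of t] by auto
      done
    done
qed

section \<open>Rounds of queries\<close>

text \<open>The outcome of \<open>FindUnsat\<close> as seen on tape 2. That the clauses in
  \<open>\<rho>\<close> are satisfied is not recorded: any unsatisfied clause will do for a
  round.\<close>

definition fstate :: "nat list list \<Rightarrow> (nat \<times> bool) list \<Rightarrow> tape \<Rightarrow> bool" where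
  "fstate \<psi> ps F \<longleftrightarrow> (\<forall>C \<in> set \<psi>. csat ps C) \<and> F = tp (rev (fenc \<psi>) @ [0]) [] \<or>
     (\<exists>\<rho> C \<sigma>. \<psi> = \<rho> @ C # \<sigma> \<and> \<not> csat ps C \<and> F = tp (rev (fenc \<rho>) @ [0]) (fenc (C # \<sigma>)))"

lemma fstate_scan: "fstate \<psi> ps F \<Longrightarrow> scan F = 0 \<longleftrightarrow> (\<forall>C \<in> set \<psi>. csat ps C)"
  by (auto simp: fstate_def)

lemma fstate_on: "fstate \<psi> ps F \<Longrightarrow> on (fenc \<psi>) F"
  by (auto simp: fstate_def intro!: on_tp)

lemma wp_FindUnsat_fstate:
  assumes "length (denc ps) < N" "length (fenc \<psi>) < N"
    and "distinct (map fst ps)" "\<Union> (set ` set \<psi>) \<subseteq> fst ` set ps"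
    and "on (fenc \<psi>) F" "on (denc ps) D"
    and "\<And>t0' D' g' t' F'. t' \<le> t + 85 * N ^ 4 \<Longrightarrow> on (denc ps) D' \<Longrightarrow> fstate \<psi> ps F' \<Longrightarrow>
      Q [t0', t1, F', D', K, g'] t' q"
  shows "wp \<pi> FindUnsat Q [t0, t1, F, D, K, g] t q"
  by (rule wp_FindUnsat[OF assms(1-6)]; rule assms(7)) (auto simp: fstate_def)

definition AddrCopy :: cmd where
  "AddrCopy = While (\<lambda>ss. isbit (ss ! 2)) (cp 1 2 GoRight ;; mv 2 GoRight)"

text \<open>The word has a marker in front of it on tape 2 but starts in cell 0 on tape 1; hence the
  one additional move of tape 2.\<close>

definition AddrBack :: cmd where
  "AddrBack = mv 2 GoLeft ;; While (\<lambda>ss. ss ! 2 \<noteq> 3) (mv 1 GoLeft ;; mv 2 GoLeft)"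

text \<open>Tape 1 may still hold the end of a longer earlier address; the blank written behind the
  new one cuts it off, because \<open>address\<close> reads the block of bits that starts in cell
  0.\<close>

definition ReadAddr :: cmd where
  "ReadAddr = mv 2 GoRight ;; AddrCopy ;; wr 1 0 Stay ;; AddrBack"

lemma act_tp_tl:
  "act (tp ls rs) (b, GoRight) = tp (b # ls) (tl rs)" "act (tp ls rs) (b, Stay) = tp ls (b # tl rs)"
  by (cases rs; simp)+

lemma wp_AddrCopy:
  assumes "list_all isbit bs" "\<not> isbit (hd0 rest)"
    and "\<And>r' t'. t' \<le> t + 4 * length bs + 1 \<Longrightarrow>
      Q [t0, tp (rev bs @ l) r', tp (rev bs @ lf) rest, D, K, g] t' q"
  shows "wp \<pi> AddrCopy Q [t0, tp l r, tp lf (bs @ rest), D, K, g] t q"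
  using assms
proof (induction bs arbitrary: l r lf t)
  case Nil
  then show ?case unfolding AddrCopy_def by (subst wp_While) simp
next
  case (Cons b bs)
  have "wp \<pi> AddrCopy Q [t0, tp (b # l) (tl r), tp (b # lf) (bs @ rest), D, K, g] (Suc (Suc (Suc (Suc t)))) q"
    by (rule Cons.IH) (use Cons.prems in auto)
  thus ?case using Cons.prems(1) unfolding AddrCopy_def by (subst wp_While) (simp add: act_tp_tl)
qed

lemma wp_AddrBack:
  assumes "3 \<notin> set us"
    and "\<And>t'. t' \<le> t + 4 * length us + 2 \<Longrightarrow> Q [t0, tp [] (us @ r), tp lf (3 # us @ rest), D, K, g] t' q"
  shows "wp \<pi> AddrBack Q [t0, tp (rev us) r, tp (rev us @ 3 # lf) rest, D, K, g] t q"
  using assms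
proof (induction us arbitrary: r rest t rule: rev_induct)
  case Nil
  then show ?case unfolding AddrBack_def by (simp add: wp_While)
next
  case (snoc u us)
  have "wp \<pi> AddrBack Q [t0, tp (rev us) (u # r), tp (rev us @ 3 # lf) (u # rest), D, K, g] (Suc (Suc (Suc (Suc t)))) q"
    using snoc.prems by (intro snoc.IH) auto
  thus ?case using snoc.prems(1) unfolding AddrBack_def by (simp, subst wp_While) simp
qed

lemma wp_ReadAddr:
  assumes "\<not> isbit (hd0 rest)"
    and "\<And>r' t'. t' \<le> t + 8 * length (enc_nat x) + 5 \<Longrightarrow>
      Q [t0, tp [] (enc_nat x @ 0 # r'), tp lf (3 # enc_nat x @ rest), D, K, g] t' q"
  shows "wp \<pi> ReadAddr Q [t0, tp [] r, tp lf (3 # enc_nat x @ rest), D, K, g] t q"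
  unfolding ReadAddr_def
  apply simp
  apply (rule wp_AddrCopy)
    apply (use assms(1) in simp_all)
  subgoal for r' t'
    using wp_AddrBack[of "enc_nat x" "Suc t'" Q t0 "0 # tl r'" lf rest D K g q \<pi>] assms(2)
    by (auto simp: act_tp_tl)
  done

text \<open>The blank behind \<open>bs\<close> is the first non-bit, so the block read is
  \<open>bs\<close>, and \<open>bval\<close> is Horner's form of the sum in
  \<open>address\<close>.\<close>

lemma address_tp:
  assumes "list_all isbit bs"
  shows "address (tp [] (bs @ 0 # r)) = bval bs"
proof -
  let ?u = "fst (tp [] (bs @ 0 # r))"
  have u: "?u i = (bs @ 0 # r) ! i" if "i \<le> length bs" for i
    using that by (auto simp: tp_def)
  have L: "(LEAST i. ?u i \<notin> {1, 2}) = length bs"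
  proof (rule Least_equality)
    show "?u (length bs) \<notin> {1, 2}" using u by simp
    fix i assume "?u i \<notin> {1, 2}"
    thus "length bs \<le> i" using assms u[of i]
      by (cases "i < length bs") (auto simp: nth_append list_all_length isbit_def)
  qed
  have "(\<Sum>i<length bs. (bs ! i - 1) * 2 ^ i) = bval bs"
  proof (induction bs)
    case (Cons b bs)
    show ?case
      by (simp add: sum.lessThan_Suc_shift sum_distrib_left mult.left_commute del: sum.lessThan_Suc flip: Cons)
  qed simp
  moreover have "(\<Sum>i<length bs. (?u i - 1) * 2 ^ i) = (\<Sum>i<length bs. (bs ! i - 1) * 2 ^ i)"
    using u by (intro sum.cong) (auto simp: nth_append)
  ultimately show ?thesis unfolding address_def Let_def L by simp
qed

text \<open>Once a proof bit 1 has been read, running to the blank makes the test of the loop in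
  \<open>Pick\<close> fail, so that a round sets just one variable.\<close>

definition RunRight :: "nat \<Rightarrow> cmd" where
  "RunRight i = While (\<lambda>ss. 0 < ss ! i) (mv i GoRight)"

lemma wp_RunRight:
  assumes "i < length s" "s ! i = tp ls w" "0 \<notin> set w"
    and "\<And>t'. t' \<le> t + 3 * length w + 1 \<Longrightarrow> Q (s[i := tp (rev w @ ls) []]) t' q"
  shows "wp \<pi> (RunRight i) Q s t q"
  using assms
proof (induction w arbitrary: ls s t)
  case Nil
  then show ?case unfolding RunRight_def by (subst wp_While) (metis (no_types) Nil.prems(4) Suc_eq_plus1
     add.right_neutral append_Nil hd0.simps(1) length_map less_irrefl list.size(3) list_update_id mult_0_right
     nth_map order_refl rev.simps(1) scan_tp)
next
  case (Cons b bs)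
  have "wp \<pi> (RunRight i) Q (s[i := tp (b # ls) bs]) (Suc (Suc (Suc t))) q"
    by (rule Cons.IH) (use Cons.prems in auto)
  thus ?case using Cons.prems unfolding RunRight_def by (subst wp_While) simp
qed

definition setT :: "nat \<Rightarrow> (nat \<times> bool) list \<Rightarrow> (nat \<times> bool) list" where
  "setT x ps = map (\<lambda>(y, b). (y, b \<or> y = x)) ps"

lemma fst_setT [simp]: "map fst (setT x ps) = map fst ps"
  by (auto simp: setT_def)

lemma fst_set_setT [simp]: "fst ` set (setT x ps) = fst ` set ps"
  by (metis fst_setT list.set_map)

lemma length_denc_setT [simp]: "length (denc (setT x ps)) = length (denc ps)"
  by (induction ps) (auto simp: setT_def)

lemma setT_notin: "x \<notin> fst ` set ps \<Longrightarrow> setT x ps = ps"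
  by (induction ps) (auto simp: setT_def)

lemma setT_split:
  "distinct (map fst (as @ (x, b) # cs)) \<Longrightarrow> setT x (as @ (x, b) # cs) = as @ (x, True) # cs"
  using setT_notin[of x as] setT_notin[of x cs] by (auto simp: setT_def)

definition PickBody :: cmd where
  "PickBody = ReadAddr ;; Ask (Lookup ;; wr 3 4 Stay ;; RunRight 2) (mv 2 GoRight ;; SkipBits 2)"

definition Pick :: cmd where
  "Pick = mv 2 GoRight ;; While (\<lambda>ss. ss ! 2 = 3) PickBody"

lemma wp_PickBody_yes:
  assumes N: "length (denc ps) < N" "length (3 # enc_nat x @ rest) < N" "0 \<notin> set rest"
    and ps: "distinct (map fst ps)" "x \<in> fst ` set ps" "proof_bit \<pi> x"
    and rest: "\<not> isbit (hd0 rest)" and D: "on (denc ps) D"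
    and Q: "\<And>t0' r' D' t'. t' \<le> t + 45 * N * N + 11 * N + 20 \<Longrightarrow> on (denc (setT x ps)) D' \<Longrightarrow>
      Q [t0', tp [] r', tp (rev (3 # enc_nat x @ rest) @ lf) [], D', K, g] t' (Suc q)"
  shows "wp \<pi> PickBody Q [t0, tp [] r, tp lf (3 # enc_nat x @ rest), D, K, g] t q"
  unfolding PickBody_def wp_Seq
proof (rule wp_ReadAddr, goal_cases)
  case (2 r' t')
  have "wp \<pi> (Lookup ;; wr 3 4 Stay ;; RunRight 2) (\<lambda>s t. Q s (Suc t))
     [t0, tp [] (enc_nat x @ 0 # r'), tp lf (3 # enc_nat x @ rest), D, K, g] (Suc t') (Suc q)"
    unfolding wp_Seq
  proof (rule wp_Lookup[where N = N and ps = ps], goal_cases)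
    case (5 as b cs t'')
    have on': "on (denc (setT x ps)) (tp (rev (denc as) @ [0]) (4 # enc_nat x @ denc cs))"
      using ps(1) 5 by (auto simp: setT_split intro!: on_tp)
    have "wp \<pi> (RunRight 2) (\<lambda>s t. Q s (Suc t))
     [put 1 t0, tp [] (enc_nat x @ 0 # r'), tp lf (3 # enc_nat x @ rest),
      tp (rev (denc as) @ [0]) (4 # enc_nat x @ denc cs), K, g] (Suc t'') (Suc q)"
      apply (rule wp_RunRight[where w = "3 # enc_nat x @ rest" and ls = lf])
      using N(3) apply simp_all
      using Q[OF _ on', where t0' = "put 1 t0" and r' = "enc_nat x @ 0 # r'"] N(2) 5(3) 2 by auto
    thus ?case by simp
  next
    case (6 t'')
    then show ?case using ps(2) by simp
  qed (use N rest D in auto)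
  thus ?case using ps(3) by (simp add: address_tp)
qed (use rest in auto)

lemma wp_PickBody_no:
  assumes N: "length (enc_nat x) < N" 
    and ps: "\<not> proof_bit \<pi> x" and rest: "\<not> isbit (hd0 rest)"
    and Q: "\<And>r' t'. t' \<le> t + 11 * N + 20 \<Longrightarrow>
      Q [t0, tp [] r', tp (rev (enc_nat x) @ 3 # lf) rest, D, K, g] t' (Suc q)"
  shows "wp \<pi> PickBody Q [t0, tp [] r, tp lf (3 # enc_nat x @ rest), D, K, g] t q"
  unfolding PickBody_def wp_Seq
proof (rule wp_ReadAddr, goal_cases)
  case (2 r' t')
  have "wp \<pi> (SkipBits 2) Q 
     [t0, tp [] (enc_nat x @ 0 # r'), tp (3 # lf) (enc_nat x @ rest), D, K, g] (Suc (Suc t')) (Suc q)"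
    apply (rule wp_SkipBits[where bs = "enc_nat x" and rs = rest and ls = "3 # lf"])
    using N rest Q 2 by auto
  thus ?case using ps by (simp add: address_tp)
qed (use rest in auto)

lemma wp_PickLoop:
  assumes "length (denc ps) < N" "length (lenc C @ rest) < N" "0 \<notin> set rest"
    and "distinct (map fst ps)" "set C \<subseteq> fst ` set ps"
    and "\<not> isbit (hd0 rest)" "hd0 rest \<noteq> 3" "on (denc ps) D" "rev lf @ lenc C @ rest = 0 # w"
    and "\<And>t0' r' F' D' t' q' ps'. t' \<le> t + length C * (80 * N * N) + 2 \<Longrightarrow> q' \<le> q + length C \<Longrightarrow>
      on (denc ps') D' \<Longrightarrow> on w F' \<Longrightarrow>
      ps' = ps \<and> (\<forall>x \<in> set C. \<not> proof_bit \<pi> x) \<or> (\<exists>x \<in> set C. proof_bit \<pi> x \<and> ps' = setT x ps) \<Longrightarrow>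
      Q [t0', tp [] r', F', D', K, g] t' q'"
  shows "wp \<pi> (While (\<lambda>ss. ss ! 2 = 3) PickBody) Q [t0, tp [] r, tp lf (lenc C @ rest), D, K, g] t q"
  using assms
proof (induction C arbitrary: t0 r lf t q)
  case Nil
  show ?case using Nil.prems(7) Nil.prems(8,9) by (subst wp_While) (auto intro!: Nil.prems(10) on_tp)
next
  case (Cons x C)
  have N: "11 * N + 30 \<le> 35 * N * N + 6" using Cons.prems(1) by (cases N) auto
  let ?W = "While (\<lambda>ss. ss ! 2 = 3) PickBody"
  have "wp \<pi> PickBody (\<lambda>s t. wp \<pi> ?W Q s (Suc t))
    [t0, tp [] r, tp lf (3 # enc_nat x @ lenc C @ rest), D, K, g] (Suc t) q"
  proof (cases "proof_bit \<pi> x")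
    case True
    show ?thesis
    proof (rule wp_PickBody_yes[where N = N and ps = ps], goal_cases)
      case (9 t0' r' D' t')
      have "on w (tp (rev (3 # enc_nat x @ lenc C @ rest) @ lf) [])"
        using Cons.prems(9) by (auto intro!: on_tp)
      with 9 show ?case using True N
        by (subst wp_While) (auto intro!: Cons.prems(10) simp: algebra_simps)
    qed (use Cons.prems True in auto)
  next
    case False
    show ?thesis
    proof (rule wp_PickBody_no[where N = N], goal_cases)
      case (4 r' t')
      show ?case
      proof (rule Cons.IH, goal_cases)
        case prems: (10 t'' q' ps' D' F' t0' r'')
        show ?case
          by (rule Cons.prems(10)[where ps' = ps'])
            (use False prems 4 N in \<open>auto simp: algebra_simps\<close>)
      qed (use Cons.prems in auto)
    qed (use Cons.prems False in auto)
  qed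
  thus ?case by (subst wp_While) simp
qed

definition tset :: "(nat \<times> bool) list \<Rightarrow> nat set" where
  "tset ps = {x. (x, True) \<in> set ps}"

lemma tset_subset: "tset ps \<subseteq> fst ` set ps"
  by (force simp: tset_def)

lemma finite_tset [simp]: "finite (tset ps)"
  by (rule finite_subset[OF tset_subset]) simp

lemma tset_setT: "x \<in> fst ` set ps \<Longrightarrow> tset (setT x ps) = insert x (tset ps)"
  by (force simp: tset_def setT_def image_iff)

lemma csat_tset: "csat ps C \<longleftrightarrow> (\<exists>x \<in> set C. x \<in> tset ps)"
  by (simp add: csat_def tset_def)

lemma wp_Pick:
  assumes "length (denc ps) < N" "length (lenc C @ rest) < N" "0 \<notin> set rest"
    and "distinct (map fst ps)" "set C \<subseteq> fst ` set ps"
    and "\<not> isbit (hd0 rest)" "hd0 rest \<noteq> 3" "on (denc ps) D" "rev lf @ 5 # lenc C @ rest = 0 # w"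
    and "\<And>t0' r' F' D' t' q' ps'. t' \<le> t + 83 * N ^ 3 \<Longrightarrow> q' \<le> q + length C \<Longrightarrow>
      on (denc ps') D' \<Longrightarrow> on w F' \<Longrightarrow>
      ps' = ps \<and> (\<forall>x \<in> set C. \<not> proof_bit \<pi> x) \<or> (\<exists>x \<in> set C. proof_bit \<pi> x \<and> ps' = setT x ps) \<Longrightarrow>
      Q [t0', tp [] r', F', D', K, g] t' q'"
  shows "wp \<pi> Pick Q [t0, tp [] r, tp lf (5 # lenc C @ rest), D, K, g] t q"
proof -
  have N: "N ^ 3 \<ge> 1" using assms(1) by (cases N) auto
  have "length C \<le> N" using length_le_lenc[of C] assms by simp
  hence C: "length C * (80 * N * N) \<le> 80 * N ^ 3" by (simp add: power3_eq_cube)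
  have B: "Suc (Suc (Suc (t + length C * (80 * N * N)))) \<le> t + 83 * N ^ 3"
    using C N by linarith
  show ?thesis unfolding Pick_def
    apply simp
    apply (rule wp_PickLoop[where N = N and ps = ps and w = w])
    using assms(1-9) apply simp_all
    apply (rule assms(10))
    using B by auto
qed

definition QRound :: cmd where
  "QRound = mv 4 GoRight ;; Pick ;; FindUnsat"

text \<open>Tape 4 holds \<open>k + 1\<close> cells; the one skipped before the loop leaves exactly
  one for each of the \<open>k\<close> rounds.\<close>

definition QMode :: cmd where
  "QMode = Rewind 4 ;; mv 4 GoRight ;; FindUnsat ;;
     While (\<lambda>ss. 0 < ss ! 2 \<and> 0 < ss ! 4) QRound ;;
     Cond (\<lambda>ss. ss ! 2 = 0) (wr 1 1 Stay) (wr 1 2 Stay)"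

lemma wp_QRound:
  assumes "length (denc ps) < N" "length (fenc \<psi>) < N"
    and "distinct (map fst ps)" "\<Union> (set ` set \<psi>) \<subseteq> fst ` set ps" "on (denc ps) D"
    and \<psi>: "\<psi> = \<rho> @ C # \<sigma>"
    and "\<And>t0' r' F' D' g' t' q' ps'. t' \<le> t + 170 * N ^ 4 \<Longrightarrow> q' \<le> q + length C \<Longrightarrow>
      on (denc ps') D' \<Longrightarrow> fstate \<psi> ps' F' \<Longrightarrow>
      ps' = ps \<and> (\<forall>x \<in> set C. \<not> proof_bit \<pi> x) \<or> (\<exists>x \<in> set C. proof_bit \<pi> x \<and> ps' = setT x ps) \<Longrightarrow>
      Q [t0', tp [] r', F', D', tp (3 # lk) rk, g'] t' q'"
  shows "wp \<pi> QRound Q [t0, tp [] r, tp (rev (fenc \<rho>) @ [0]) (fenc (C # \<sigma>)), D, tp lk (3 # rk), g] t q"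
proof -
  have "N \<ge> 1" using assms by auto
  hence N: "N ^ 4 \<ge> N ^ 3" "N ^ 4 \<ge> 1" using power_increasing[of 3 4 N] by auto
  have "wp \<pi> Pick (wp \<pi> FindUnsat Q) [t0, tp [] r, tp (rev (fenc \<rho>) @ [0]) (5 # lenc C @ fenc \<sigma>), D,
    tp (3 # lk) rk, g] (Suc t) q"
  proof (rule wp_Pick[where N = N and ps = ps and w = "fenc \<psi>"], goal_cases)
    case (10 t0' r' F' D' t' q' ps')
    have ps': "map fst ps' = map fst ps" "length (denc ps') = length (denc ps)"
      using 10(5) by auto
    show ?case
    proof (rule wp_FindUnsat_fstate[where N = N and ps = ps' and \<psi> = \<psi>], goal_cases)
      case (7 t0'' D'' g'' t'' F'')
      show ?case by (rule assms(7)) (use 7 10 N in auto)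
    next
      case 4
      then show ?case using assms(4) ps'(1) by (metis list.set_map)
    qed (use assms 10 ps' in auto)
  qed (use assms in auto)
  thus ?thesis by (simp add: QRound_def)
qed

text \<open>Soundness holds for any proof: the set of chosen variables grows by at most one per
  round and is itself the witness. For completeness the invariant is
  \<open>tset ps \<subseteq> H\<close>: an unsatisfied clause has a variable of \<open>H\<close>, so
  a bit 1 is read, and the variable picked lies in \<open>H\<close> but was not yet chosen. Hence
  \<open>k\<close> rounds exhaust the at most \<open>k\<close> missing elements of
  \<open>H\<close>.\<close>

lemma wp_QLoop:
  assumes "length (denc ps) < N" "length (fenc \<psi>) < N"
    and "distinct (map fst ps)" "\<Union> (set ` set \<psi>) \<subseteq> fst ` set ps"
    and "\<forall>C \<in> set \<psi>. length C \<le> p" "on (denc ps) D" "fstate \<psi> ps F"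
    and "\<And>t0' r' F' D' K' g' t' q'. t' \<le> t + k * (170 * N ^ 4 + 3) + 1 \<Longrightarrow> q' \<le> q + k * p \<Longrightarrow>
      (scan F' = 0 \<Longrightarrow> \<exists>A. A \<subseteq> fst ` set ps \<and> card A \<le> card (tset ps) + k \<and> (\<forall>C \<in> set \<psi>. \<exists>x \<in> set C. x \<in> A)) \<Longrightarrow>
      (\<And>H. tset ps \<subseteq> H \<Longrightarrow> finite H \<Longrightarrow> card H \<le> card (tset ps) + k \<Longrightarrow>
        (\<forall>C \<in> set \<psi>. \<exists>x \<in> set C. x \<in> H) \<Longrightarrow> (\<forall>x. proof_bit \<pi> x \<longleftrightarrow> x \<in> H) \<Longrightarrow> scan F' = 0) \<Longrightarrow>
      Q [t0', tp [] r', F', D', K', g'] t' q'"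
  shows "wp \<pi> (While (\<lambda>ss. 0 < ss ! 2 \<and> 0 < ss ! 4) QRound) Q
    [t0, tp [] r, F, D, tp lk (replicate k 3), g] t q"
  using assms
proof (induction k arbitrary: t0 r F D lk g t q ps)
  case 0
  have "Q [t0, tp [] r, F, D, tp lk [], g] (Suc t) q"
  proof (rule 0(8), goal_cases)
    case 3
    show ?case
      using 3 fstate_scan[OF 0(7)] tset_subset[of ps] by (intro exI[of _ "tset ps"]) (auto simp: csat_tset)
  next
    case (4 H)
    \<comment> \<open>With no round left, the sizes force the chosen set to be all of
      \<open>H\<close>.\<close>
    hence "H = tset ps" using card_seteq[of H "tset ps"] by auto
    thus ?case using 4 fstate_scan[OF 0(7)] by (auto simp: csat_tset)
  qed auto
  then show ?case by (subst wp_While) simp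
next
  case (Suc k)
  let ?W = "While (\<lambda>ss. 0 < ss ! 2 \<and> 0 < ss ! 4) QRound"
  show ?case
  proof (cases "scan F = 0")
    case True
    have "Q [t0, tp [] r, F, D, tp lk (replicate (Suc k) 3), g] (Suc t) q"
      using True fstate_scan[OF Suc.prems(7)] tset_subset[of ps]
      by (intro Suc.prems(8)) (auto intro!: exI[of _ "tset ps"] simp: csat_tset)
    thus ?thesis using True by (subst wp_While) simp
  next
    case False
    then obtain \<rho> C \<sigma> where \<psi>: "\<psi> = \<rho> @ C # \<sigma>" and C: "\<not> csat ps C"
      and F: "F = tp (rev (fenc \<rho>) @ [0]) (fenc (C # \<sigma>))"
      using Suc.prems(7) by (auto simp: fstate_def)
    have "wp \<pi> QRound (\<lambda>s t. wp \<pi> ?W Q s (Suc t))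
      [t0, tp [] r, F, D, tp lk (3 # replicate k 3), g] (Suc t) q"
      unfolding F
    proof (rule wp_QRound[where N = N and ps = ps and \<psi> = \<psi>], goal_cases)
      case (7 t0' r' F' D' g' t' q' ps')
      have ps': "map fst ps' = map fst ps" "length (denc ps') = length (denc ps)"
        using 7(5) by auto
      have fps': "fst ` set ps' = fst ` set ps" using ps'(1) by (metis list.set_map)
      have Cp: "length C \<le> p" and Cf: "set C \<subseteq> fst ` set ps" using Suc.prems(4,5) \<psi> by auto
      \<comment> \<open>The picked variable is new because the current values do not satisfy
        \<open>C\<close>.\<close>
      have tset': "tset ps' = tset ps \<and> (\<forall>x \<in> set C. \<not> proof_bit \<pi> x) \<or>
        (\<exists>x \<in> set C. proof_bit \<pi> x \<and> x \<notin> tset ps \<and> tset ps' = insert x (tset ps))"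
        using 7(5)
      proof (elim disjE conjE bexE)
        fix x assume x: "x \<in> set C" "proof_bit \<pi> x" "ps' = setT x ps"
        thus ?thesis using C Cf tset_setT[of x ps] by (intro disjI2 bexI[of _ x]) (auto simp: csat_tset)
      qed simp
      hence card': "card (tset ps') \<le> Suc (card (tset ps))" by auto
      show ?case
      proof (rule Suc.IH[where ps = ps'], goal_cases)
        case prems: (8 t'' q'' F'' t0'' r'' D'' K'' g'')
        show ?case
        proof (rule Suc.prems(8), goal_cases)
          case 1
          then show ?case using prems 7 by auto
        next
          case 2
          then show ?case using prems(2) 7(2) Cp by auto
        next
          case 3
          then show ?case using prems(3) card' unfolding fps' by (metis add_Suc add_Suc_right le_trans add_le_mono1)
        next
          case (4 H)
          \<comment> \<open>\<open>C\<close> contains an element of \<open>H\<close>, whose proof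
            bit is 1; this rules out the case that the round picked nothing.\<close>
          obtain x where "x \<in> set C" "x \<in> H" using 4(4) \<psi> by auto
          with tset' 4(5) obtain y where y: "y \<in> H" "y \<notin> tset ps" "tset ps' = insert y (tset ps)"
            by blast
          show ?case by (rule prems(4)[of H]) (use 4 y in auto)
        qed
      qed (use Suc.prems 7 ps' fps' in auto)
    qed (use Suc.prems \<psi> in auto)
    thus ?thesis using False F by (subst wp_While) simp
  qed
qed

lemma wp_QMode:
  assumes "length (denc ps) < N" "length (fenc \<psi>) < N"
    and "distinct (map fst ps)" "\<Union> (set ` set \<psi>) \<subseteq> fst ` set ps" "tset ps = {}"
    and "\<forall>C \<in> set \<psi>. length C \<le> p" "on (fenc \<psi>) F" "on (denc ps) D" "on (replicate (Suc k) 3) K"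
    and "\<And>s' t' q'. t' \<le> t + (k + 1) * (300 * N ^ 4) \<Longrightarrow> q' \<le> q + k * p \<Longrightarrow>
      (scan (s' ! 1) = 1 \<Longrightarrow> \<exists>A. A \<subseteq> fst ` set ps \<and> card A \<le> k \<and> (\<forall>C \<in> set \<psi>. \<exists>x \<in> set C. x \<in> A)) \<Longrightarrow>
      (\<And>H. finite H \<Longrightarrow> card H \<le> k \<Longrightarrow>
        (\<forall>C \<in> set \<psi>. \<exists>x \<in> set C. x \<in> H) \<Longrightarrow> (\<forall>x. proof_bit \<pi> x \<longleftrightarrow> x \<in> H) \<Longrightarrow> scan (s' ! 1) = 1) \<Longrightarrow>
      length s' = 6 \<Longrightarrow> Q s' t' q'"
  shows "wp \<pi> QMode Q [t0, tp [] r, F, D, K, g] t q"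
proof -
  have "N \<ge> 1" using assms by auto
  hence N: "N ^ 4 \<ge> 1" by auto
  have *: "3 * k + 20 + 85 * N ^ 4 + k * (170 * N ^ 4 + 3) \<le> (k + 1) * (300 * N ^ 4)"
    using N by (cases "N ^ 4") (simp_all add: algebra_simps)
  show ?thesis unfolding QMode_def wp_Seq
  proof (rule wp_Rewind[where w = "replicate (Suc k) 3"], goal_cases)
    case (4 t1)
    have "wp \<pi> FindUnsat (wp \<pi> (While (\<lambda>ss. 0 < ss ! 2 \<and> 0 < ss ! 4) QRound)
        (wp \<pi> (Cond (\<lambda>ss. ss ! 2 = 0) (wr 1 1 Stay) (wr 1 2 Stay)) Q))
      [t0, tp [] r, F, D, tp [3, 0] (replicate k 3), g] (Suc t1) q"
    proof (rule wp_FindUnsat_fstate[where N = N and ps = ps and \<psi> = \<psi>], goal_cases)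
      case (7 t0' D' g' t2 F')
      show ?case
      proof (rule wp_QLoop[where N = N and ps = ps and \<psi> = \<psi> and p = p], goal_cases)
        case prems: (8 t0'' r'' F'' D'' K'' g'' t3 q3)
        have t3: "Suc (Suc (Suc (Suc t3))) \<le> t + (k + 1) * (300 * N ^ 4)" using prems(1) 7(1) 4 * by simp
        let ?s = "\<lambda>a. [t0'', tp [] (a # tl r''), F'', D'', K'', g'']"
        have "Q (?s a) t' q3" if "t' \<le> Suc (Suc (Suc t3))" "a = 1 \<longleftrightarrow> scan F'' = 0" for a t'
          by (rule assms(10)) (use that t3 prems(2-4) assms(5) in auto)
        thus ?case by (auto simp: act_tp_tl)
      qed (use assms 7 in auto)
    qed (use assms in auto)
    thus ?case by simp
  qed (use assms in auto)
qed

section \<open>Binary counters and the threshold\<close>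

text \<open>Least significant bit first, like the tapes. It measures both the counter on tape 4 and
  the values in the dictionary, since assignments are enumerated by incrementing the dictionary as a
  binary number.\<close>

fun bv :: "bool list \<Rightarrow> nat" where
  "bv [] = 0"
| "bv (b # bs) = of_bool b + 2 * bv bs"

lemma bv_less: "bv bs < 2 ^ length bs"
  by (induction bs) auto

lemma bv_inject: "length bs = length cs \<Longrightarrow> bv bs = bv cs \<Longrightarrow> bs = cs"
proof (induction bs cs rule: list_induct2)
  case (Cons b bs c cs)
  have "of_bool b = (of_bool c :: nat) \<and> bv bs = bv cs"
    using Cons.prems by (cases b; cases c) (simp_all, presburger+)
  with Cons.IH show ?case by (cases b; cases c) auto
qed simp

lemma bv_all: "False \<notin> set bs \<Longrightarrow> bv bs + 1 = 2 ^ length bs"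
  by (induction bs) auto

lemma bv_none: "True \<notin> set bs \<Longrightarrow> bv bs = 0"
  by (induction bs) auto

lemma bv_carry: "False \<notin> set as \<Longrightarrow> bv (map (\<lambda>_. False) as @ True # cs) = bv (as @ False # cs) + 1"
  by (induction as) auto

definition clr :: "(nat \<times> bool) list \<Rightarrow> (nat \<times> bool) list" where
  "clr ps = map (\<lambda>(x, _). (x, False)) ps"

lemma clr_simps [simp]: "clr [] = []" "clr ((x, b) # ps) = (x, False) # clr ps"
  "map fst (clr ps) = map fst ps" "map snd (clr ps) = map (\<lambda>_. False) (map snd ps)"
  by (auto simp: clr_def split_def)

lemma length_denc_cong: "map fst ps = map fst qs \<Longrightarrow> length (denc ps) = length (denc qs)"
proof (induction ps arbitrary: qs)
  case (Cons p ps)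
  then obtain q qs' where "qs = q # qs'" "fst q = fst p" "map fst ps = map fst qs'"
    by (cases qs) auto
  thus ?case using Cons.IH[of qs'] by (cases p; cases q) auto
qed simp

definition IncLoop :: "nat \<Rightarrow> cmd" where
  "IncLoop i = While (\<lambda>ss. ss ! i = 4) (wr i 3 GoRight ;; SkipBits i)"

definition Inc :: "nat \<Rightarrow> cmd" where
  "Inc i = IncLoop i ;; Cond (\<lambda>ss. ss ! i = 3) (wr i 4 Stay) Skip"

lemma split_at_False: 
  "(False \<notin> set (map snd ps)) \<or> (\<exists>as y cs. ps = as @ (y, False) # cs \<and> (False \<notin> set (map snd as)))"
proof (induction ps)
  case (Cons p ps)
  show ?case
  proof (cases p)
    case (Pair x b)
    show ?thesis
    proof (cases b)
      case False
      thus ?thesis using Pair by (intro disjI2 exI[of _ "[]"]) auto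
    next
      case True
      show ?thesis using Cons.IH
      proof (elim disjE exE conjE)
        fix as y cs assume "ps = as @ (y, False) # cs" "False \<notin> set (map snd as)"
        thus ?thesis using True Pair by (intro disjI2 exI[of _ "p # as"]) auto
      qed (use True Pair in auto)
    qed
  qed
qed simp

lemma wp_IncLoop:
  assumes "i < length s" "s ! i = tp ls (denc as @ rs)" "False \<notin> set (map snd as)"
    and "\<not> isbit (hd0 rs)" "hd0 rs \<noteq> 4"
    and "\<And>t'. t' \<le> t + 7 * length (denc as) + 1 \<Longrightarrow> Q (s[i := tp (rev (denc (clr as)) @ ls) rs]) t' q"
  shows "wp \<pi> (IncLoop i) Q s t q"
  using assms
proof (induction as arbitrary: s ls t)
  case Nil
  have "s[i := tp ls rs] = s" using Nil.prems(2) by (metis append_Nil denc_simps(1) list_update_id)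
  with Nil show ?case unfolding IncLoop_def by (subst wp_While) simp
next
  case (Cons p as)
  obtain x where p: "p = (x, True)" using Cons.prems(3) by (cases p) auto
  have nb: "\<not> isbit (hd0 (denc as @ rs))"
    using Cons.prems(4) hd0_denc[of as] by (cases "denc as") auto
  have "wp \<pi> (SkipBits i) (\<lambda>s t. wp \<pi> (IncLoop i) Q s (Suc t)) 
    (s[i := tp (3 # ls) (enc_nat x @ denc as @ rs)]) (Suc (Suc t)) q"
  proof (rule wp_SkipBits[where bs = "enc_nat x" and rs = "denc as @ rs" and ls = "3 # ls"], goal_cases)
    case (5 t')
    show ?case
      by (rule Cons.IH[where ls = "rev (enc_nat x) @ 3 # ls"]) (use Cons.prems p 5 in auto)
  qed (use Cons.prems(1) nb in auto)
  thus ?case using Cons.prems(1,2) p unfolding IncLoop_def by (subst wp_While) simp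
qed

text \<open>An overflow leaves all digits cleared and the head on the blank behind them;
  \<open>Thresh\<close> and \<open>Next\<close> detect it by that blank.\<close>

lemma wp_Inc:
  assumes "i < length s" "s ! i = tp ls (denc ps)"
    and "\<And>t'. False \<notin> set (map snd ps) \<Longrightarrow> t' \<le> t + 7 * length (denc ps) + 4 \<Longrightarrow>
      Q (s[i := tp (rev (denc (clr ps)) @ ls) []]) t' q"
    and "\<And>as y cs t'. ps = as @ (y, False) # cs \<Longrightarrow> False \<notin> set (map snd as) \<Longrightarrow>
      t' \<le> t + 7 * length (denc ps) + 4 \<Longrightarrow>
      Q (s[i := tp (rev (denc (clr as)) @ ls) (denc ((y, True) # cs))]) t' q"
  shows "wp \<pi> (Inc i) Q s t q"
  using split_at_False[of ps]
proof (elim disjE exE conjE)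
  assume all: "False \<notin> set (map snd ps)"
  show ?thesis unfolding Inc_def wp_Seq
    by (rule wp_IncLoop[where as = ps and rs = "[]"]) (use assms(1,2) all in \<open>auto intro!: assms(3)\<close>)
next
  fix as y cs assume ps: "ps = as @ (y, False) # cs" and as: "False \<notin> set (map snd as)"
  show ?thesis unfolding Inc_def wp_Seq
    by (rule wp_IncLoop[where as = as and rs = "3 # enc_nat y @ denc cs"])
      (use assms(1,2) as in \<open>auto simp: ps intro!: assms(4)[of as y cs, simplified]\<close>)
qed

text \<open>A counter is a dictionary whose entries all have the name 0. As 0 is encoded by the
  empty word, every digit takes one cell, and the same \<open>Inc\<close> serves tapes 3 and
  4.\<close>

definition kenc :: "bool list \<Rightarrow> symbol list" where
  "kenc ks = denc (map (Pair 0) ks)"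

lemma enc_nat_0 [simp]: "enc_nat 0 = []"
  by (simp add: enc_nat.simps)

lemma length_kenc [simp]: "length (kenc ks) = length ks"
  by (induction ks) (auto simp: kenc_def)

lemma notin_kenc [simp]: "0 \<notin> set (kenc ks)"
  by (simp add: kenc_def)

lemma clr_Pair: "clr (map (Pair 0) ks) = map (Pair 0) (map (\<lambda>_. False) ks)"
  by (auto simp: clr_def)

definition ThreshBody :: cmd where
  "ThreshBody = Inc 4 ;; Cond (\<lambda>ss. ss ! 4 = 0) Skip (Rewind 4 ;; mv 3 GoRight ;; SkipBits 3)"

text \<open>Increments the counter on tape 4 once per dictionary entry; it overflows, leaving the head of
  tape 4 on a blank, iff there are at least \<open>2 ^ (k + 1)\<close> entries.\<close>

definition Thresh :: cmd where
  "Thresh = Rewind 3 ;; Rewind 4 ;; While (\<lambda>ss. 0 < ss ! 3 \<and> 0 < ss ! 4) ThreshBody"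

lemma map_Pair_split:
  assumes "map (Pair 0) ks = as @ (y, b) # cs"
  obtains as' cs' where "ks = as' @ b # cs'" "as = map (Pair 0) as'" "y = 0" "cs = map (Pair 0) cs'"
  using assms by (auto simp: map_eq_append_conv map_eq_Cons_conv)

text \<open>Generalised to a counter already at \<open>bv ks\<close> and a dictionary already read
  up to \<open>us\<close>; whether it overflows then depends only on
  \<open>bv ks + length vs\<close>.\<close>

lemma wp_ThreshLoop:
  assumes "length (denc (us @ vs)) < N" "ks \<noteq> []"
    and "\<And>t' D' K'. t' \<le> t + length vs * (10 * length ks + 3 * N + 20) + 1 \<Longrightarrow> on (denc (us @ vs)) D' \<Longrightarrow>
      (if bv ks + length vs \<ge> 2 ^ length ks then K' = tp (rev (kenc (map (\<lambda>_. False) ks)) @ [0]) []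
       else (\<exists>ks' \<noteq> []. length ks' = length ks \<and> K' = tp [0] (kenc ks'))) \<Longrightarrow>
      Q [t0, t1, F, D', K', g] t' q"
  shows "wp \<pi> (While (\<lambda>ss. 0 < ss ! 3 \<and> 0 < ss ! 4) ThreshBody) Q
    [t0, t1, F, tp (rev (denc us) @ [0]) (denc vs), tp [0] (kenc ks), g] t q"
  using assms
proof (induction vs arbitrary: us ks t)
  case Nil
  show ?case using bv_less[of ks] Nil.prems(2) by (subst wp_While) (auto intro!: Nil.prems(3) on_tp)
next
  case (Cons v vs)
  define W where "W = While (\<lambda>ss. 0 < ss ! 3 \<and> 0 < ss ! 4) ThreshBody"
  obtain x b where v: "v = (x, b)" by (cases v)
  define h where "h = (if b then 4 else 3 :: symbol)"
  have h: "h > 0" "denc (v # vs) = h # enc_nat x @ denc vs" by (auto simp: h_def v)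
  have K0: "hd0 (kenc ks) > 0" using Cons.prems(2) by (cases ks) (auto simp: kenc_def)
  have onD: "on (denc (us @ v # vs)) (tp (rev (denc us) @ [0]) (h # enc_nat x @ denc vs))"
    using h by (auto intro!: on_tp)
  have "wp \<pi> ThreshBody (\<lambda>s t. wp \<pi> W Q s (Suc t))
    [t0, t1, F, tp (rev (denc us) @ [0]) (h # enc_nat x @ denc vs), tp [0] (kenc ks), g] (Suc t) q"
    unfolding ThreshBody_def wp_Seq
  proof (rule wp_Inc[where ls = "[0]" and ps = "map (Pair 0) ks"], goal_cases)
    case (3 t')
    \<comment> \<open>The counter stood at its maximum, so this one further entry reaches the
      threshold.\<close>
    have "bv ks + 1 = 2 ^ length ks" using 3 by (intro bv_all) auto
    hence *: "bv ks + length (v # vs) \<ge> 2 ^ length ks" by simp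
    have len: "length (denc (map (Pair 0) ks)) = length ks" by (simp flip: kenc_def)
    have "Q [t0, t1, F, tp (rev (denc us) @ [0]) (h # enc_nat x @ denc vs),
       tp (rev (kenc (map (\<lambda>_. False) ks)) @ [0]) [], g] t'' q" if "t'' \<le> t' + 4" for t''
      by (rule Cons.prems(3)[OF _ onD], use 3 that len in simp)
        (use 3 that * in \<open>simp_all add: kenc_def\<close>)
    thus ?case by (simp add: clr_Pair kenc_def) (subst W_def, subst wp_While, simp)
  next
    case (4 as y cs t')
    obtain as' cs' where ks: "ks = as' @ False # cs'" "as = map (Pair 0) as'" "y = 0" "cs = map (Pair 0) cs'"
      using map_Pair_split[OF 4(1)] .
    let ?ks = "map (\<lambda>_. False) as' @ True # cs'"
    have bv: "bv ?ks = bv ks + 1" unfolding ks(1) using 4(2) ks(2) by (intro bv_carry) auto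
    have "wp \<pi> (Rewind 4 ;; mv 3 GoRight ;; SkipBits 3) (\<lambda>s t. wp \<pi> W Q s (Suc t))
      [t0, t1, F, tp (rev (denc us) @ [0]) (h # enc_nat x @ denc vs),
       tp (rev (kenc (map (\<lambda>_. False) as')) @ [0]) (4 # kenc cs'), g] (Suc t') q"
      unfolding wp_Seq
    proof (rule wp_Rewind[where w = "kenc ?ks"], goal_cases)
      case 2
      show ?case by (auto intro!: on_tp simp: kenc_def)
    next
      case t'': (4 t'')
      have "wp \<pi> (SkipBits 3) (\<lambda>s t. wp \<pi> W Q s (Suc t))
         [t0, t1, F, tp (h # rev (denc us) @ [0]) (enc_nat x @ denc vs), tp [0] (kenc ?ks), g] (Suc t'') q"
      proof (rule wp_SkipBits[where bs = "enc_nat x" and rs = "denc vs" and ls = "h # rev (denc us) @ [0]"], goal_cases)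
        case (5 u)
        \<comment> \<open>An opaque name keeps the simplifier from taking the new counter
          apart.\<close>
        obtain kk where kk: "kk = ?ks" by simp
        have len: "length kk = length ks" by (simp add: ks(1) kk)
        have clr: "map (\<lambda>_. False) kk = map (\<lambda>_. False) ks" using len by (simp add: map_replicate_const)
        have bv': "bv kk = bv ks + 1" using bv kk by simp
        have "wp \<pi> W Q [t0, t1, F, tp (rev (denc (us @ [v])) @ [0]) (denc vs), tp [0] (kenc kk), g] (Suc u) q"
        proof (rule Cons.IH[folded W_def], goal_cases)
          case (3 u' D' K')
          have "Suc (Suc u) \<le> t + 10 * length ks + 3 * N + 20"
            using 5 t'' 4(3) Cons.prems(1) v len unfolding kk by (simp flip: kenc_def)
          hence *: "u' \<le> t + length (v # vs) * (10 * length ks + 3 * N + 20) + 1"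
            using 3(1) unfolding len by simp
          show ?case by (rule Cons.prems(3)[OF *]) (use 3(2,3) bv' len clr in \<open>simp_all split: if_splits\<close>)
        qed (use Cons.prems len in auto)
        hence "wp \<pi> W Q [t0, t1, F, tp (rev (denc (us @ [v])) @ [0]) (denc vs), tp [0] (kenc ?ks), g] (Suc u) q"
          unfolding kk .
        thus ?case using h by (simp add: v h_def)
      qed auto
      thus ?case by simp
    qed auto
    thus ?case using ks by (simp add: clr_Pair kenc_def)
  qed (auto simp: kenc_def)
  thus ?case using h K0 unfolding W_def by (subst wp_While) simp
qed

text \<open>An overflow has just reset all \<open>Suc k\<close> cells to 3, which is the unary
  counter that \<open>QMode\<close> starts from. Otherwise the cells hold some mixture of 3 and 4;
  the exhaustive search needs only \<open>Suc k\<close> nonblank cells.\<close>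

lemma wp_Thresh:
  assumes "length (denc ps) < N" "length ks = Suc k" "True \<notin> set ks"
    and "on (denc ps) D" "on (kenc ks) K"
    and "\<And>t' D' K'. t' \<le> t + (k + 1) * (70 * N * N) \<Longrightarrow> on (denc ps) D' \<Longrightarrow>
      (if length ps \<ge> 2 ^ Suc k then K' = tp (rev (replicate (Suc k) 3) @ [0]) []
       else (\<exists>ks'. length ks' = Suc k \<and> K' = tp [0] (kenc ks'))) \<Longrightarrow>
      Q [t0, t1, F, D', K', g] t' q"
  shows "wp \<pi> Thresh Q [t0, t1, F, D, K, g] t q"
proof -
  have kF: "kenc (map (\<lambda>_. False) ks') = replicate (length ks') 3" for ks' :: "bool list"
    by (induction ks') (auto simp: kenc_def)
  have "length ps \<le> N" using length_le_denc[of ps] assms(1) by simp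
  hence "length ps * (10 * Suc k + 3 * N + 20) \<le> N * (10 * Suc k + 3 * N + 20)" by simp
  moreover have "N * (10 * Suc k + 3 * N + 20) + 3 * N + 3 * Suc k + 20 \<le> (k + 1) * (70 * N * N)"
    using assms(1) by (cases N) (auto simp: algebra_simps)
  ultimately have B: "length ps * (10 * Suc k + 3 * N + 20) + 3 * N + 3 * Suc k + 20 \<le> (k + 1) * (70 * N * N)"
    by linarith
  show ?thesis unfolding Thresh_def wp_Seq
  proof (rule wp_Rewind[where w = "denc ps"], goal_cases)
    case (4 t1')
    have "wp \<pi> (Rewind 4) (wp \<pi> (While (\<lambda>ss. 0 < ss ! 3 \<and> 0 < ss ! 4) ThreshBody) Q)
      [t0, t1, F, tp [0] (denc ps), K, g] t1' q"
    proof (rule wp_Rewind[where w = "kenc ks"], goal_cases)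
      case t2: (4 t2)
      have "wp \<pi> (While (\<lambda>ss. 0 < ss ! 3 \<and> 0 < ss ! 4) ThreshBody) Q
        [t0, t1, F, tp (rev (denc []) @ [0]) (denc ps), tp [0] (kenc ks), g] t2 q"
      proof (rule wp_ThreshLoop[where N = N], goal_cases)
        case (3 u D' K')
        have "u \<le> t + (k + 1) * (70 * N * N)" using 3(1) t2 4 B assms(1,2) by simp
        thus ?case by (rule assms(6)) (use 3 assms(2) bv_none[OF assms(3)] 
          kF[of ks] in \<open>auto split: if_splits\<close>)
      qed (use assms in auto)
      thus ?case by simp
    qed (use assms in auto)
    thus ?case by simp
  qed (use assms in auto)
qed

section \<open>Exhaustive search\<close>

definition wt :: "(nat \<times> bool) list \<Rightarrow> nat" where
  "wt ps = length (filter snd ps)"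

lemma wt_simps [simp]: "wt [] = 0" "wt ((x, b) # ps) = of_bool b + wt ps"
  by (auto simp: wt_def)

lemma wt_card: "distinct (map fst ps) \<Longrightarrow> wt ps = card (tset ps)"
proof (induction ps)
  case (Cons p ps)
  obtain x b where p: "p = (x, b)" by (cases p)
  have "tset (p # ps) = (if b then insert x (tset ps) else tset ps)"
    by (auto simp: tset_def p)
  moreover have "x \<notin> tset ps" using Cons.prems tset_subset[of ps] by (auto simp: p)
  ultimately show ?case using Cons by (simp add: p)
qed (simp add: tset_def)

definition WeightBody :: cmd where
  "WeightBody = Cond (\<lambda>ss. ss ! 3 = 4 \<and> 0 < ss ! 4) (mv 4 GoRight) Skip ;; mv 3 GoRight ;; SkipBits 3"

definition Weight :: cmd where
  "Weight = Rewind 3 ;; Rewind 4 ;; While (\<lambda>ss. 0 < ss ! 3) WeightBody"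

lemma wp_WeightLoop:
  assumes "0 \<notin> set w"
    and "\<And>t'. t' \<le> t + 9 * length (denc ps) + 1 \<Longrightarrow>
      Q [t0, t1, F, tp (rev (denc ps) @ ld) [], tp (rev (take (wt ps) w) @ lk) (drop (wt ps) w), g] t' q"
  shows "wp \<pi> (While (\<lambda>ss. 0 < ss ! 3) WeightBody) Q [t0, t1, F, tp ld (denc ps), tp lk w, g] t q"
  using assms
proof (induction ps arbitrary: ld lk w t)
  case Nil
  then show ?case by (subst wp_While) simp
next
  case (Cons p ps)
  obtain x b where p: "p = (x, b)" by (cases p)
  define h where "h = (if b then 4 else 3 :: symbol)"
  have h: "h > 0" "denc (p # ps) = h # enc_nat x @ denc ps" by (auto simp: h_def p)
  define W where "W = While (\<lambda>ss. 0 < ss ! 3) WeightBody"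
  have *: "wp \<pi> (SkipBits 3) (\<lambda>s t. wp \<pi> W Q s (Suc t))
     [t0, t1, F, tp (h # ld) (enc_nat x @ denc ps), tp (rev (take (of_bool b) w) @ lk) (drop (of_bool b) w), g] t'' q"
    if "t'' \<le> t + 6" for t''
  proof (rule wp_SkipBits[where bs = "enc_nat x" and rs = "denc ps" and ls = "h # ld"], goal_cases)
    case (5 t')
    have "wp \<pi> W Q [t0, t1, F, tp (rev (enc_nat x) @ h # ld) (denc ps),
       tp (rev (take (of_bool b) w) @ lk) (drop (of_bool b) w), g] (Suc t') q"
    proof (rule Cons.IH[folded W_def], goal_cases)
      case 1
      then show ?case using Cons.prems(1) by (meson in_set_dropD)
    next
      case (2 u)
      have "take (of_bool b + wt ps) w = take (of_bool b) w @ take (wt ps) (drop (of_bool b) w)"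
        by (rule take_add)
      thus ?case using Cons.prems(2)[of u] 2 5 that by (simp add: p h_def add.commute)
    qed
    thus ?case by simp
  qed auto
  have "wp \<pi> WeightBody (\<lambda>s t. wp \<pi> W Q s (Suc t))
     [t0, t1, F, tp ld (h # enc_nat x @ denc ps), tp lk w, g] (Suc t) q"
  proof (cases "b \<and> w \<noteq> []")
    case True
    then obtain a w' where w: "w = a # w'" by (cases w) auto
    have "a > 0" using Cons.prems(1) w by auto
    thus "wp \<pi> WeightBody (\<lambda>s t. wp \<pi> W Q s (Suc t))
     [t0, t1, F, tp ld (h # enc_nat x @ denc ps), tp lk w, g] (Suc t) q"
      using True w *[of "Suc (Suc (Suc (Suc (Suc t))))"] by (subst WeightBody_def) (simp add: h_def One_nat_def)
  next
    case False
    thus "wp \<pi> WeightBody (\<lambda>s t. wp \<pi> W Q s (Suc t))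
     [t0, t1, F, tp ld (h # enc_nat x @ denc ps), tp lk w, g] (Suc t) q"
      using *[of "Suc (Suc (Suc t))"] by (subst WeightBody_def) (cases b; simp add: h_def)
  qed
  thus ?case using h unfolding W_def by (subst wp_While) simp
qed

definition FindAcc :: cmd where
  "FindAcc = FindUnsat ;; Cond (\<lambda>ss. ss ! 2 = 0) (wr 1 1 Stay) Skip"

text \<open>The head of tape 4 has advanced by the weight, but no further than the blank behind the
  \<open>k + 1\<close> cells. A nonblank cell followed by a blank is the last one, reached exactly
  for weight \<open>k\<close>; the additional cell separates weight \<open>k\<close> from larger
  ones.\<close>

definition Check :: cmd where
  "Check = Weight ;; Cond (\<lambda>ss. 0 < ss ! 4) (mv 4 GoRight ;; Cond (\<lambda>ss. ss ! 4 = 0) FindAcc Skip) Skip"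

definition good :: "nat list list \<Rightarrow> nat \<Rightarrow> (nat \<times> bool) list \<Rightarrow> bool" where
  "good \<psi> k ps \<longleftrightarrow> wt ps = k \<and> (\<forall>C \<in> set \<psi>. csat ps C)"

lemma wp_Check:
  assumes "length (denc ps) < N" "length (fenc \<psi>) < N"
    and "distinct (map fst ps)" "\<Union> (set ` set \<psi>) \<subseteq> fst ` set ps"
    and "on (fenc \<psi>) F" "on (denc ps) D" "0 \<notin> set w" "length w = Suc k" "on w K"
    and "\<And>t0' t1' F' D' K' g' t'. t' \<le> t + (k + 1) * (130 * N ^ 4) \<Longrightarrow>
       on (fenc \<psi>) F' \<Longrightarrow> on (denc ps) D' \<Longrightarrow> on w K' \<Longrightarrow>
      t1' = (if good \<psi> k ps then 1 else 0) \<Longrightarrow>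
      Q [t0', tp [] (t1' # r), F', D', K', g'] t' q"
  shows "wp \<pi> Check Q [t0, tp [] (0 # r), F, D, K, g] t q"
proof -
  have "N \<ge> 1" using assms by auto
  hence N: "N ^ 4 \<ge> N" "N ^ 4 \<ge> 1" using power_increasing[of 1 4 N] by auto
  have "85 * N ^ 4 + 12 * N + 3 * k + 30 \<le> (k + 1) * (130 * N ^ 4)"
    using N by (cases "N ^ 4") (auto simp: algebra_simps)
  hence B: "85 * N ^ 4 + 3 * length (denc ps) + 9 * length (denc ps) + 3 * k + 30 \<le> (k + 1) * (130 * N ^ 4)"
    using assms(1) by linarith
  let ?R = "wp \<pi> (Cond (\<lambda>ss. 0 < ss ! 4) (mv 4 GoRight ;; Cond (\<lambda>ss. ss ! 4 = 0) FindAcc Skip) Skip) Q"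
  let ?w = "wt ps"
  have main: "?R [t0, tp [] (0 # r), F, tp (rev (denc ps) @ [0]) [], tp (rev (take ?w w) @ [0]) (drop ?w w), g] u q"
    if u: "u \<le> t + 3 * length (denc ps) + 6 + 3 * Suc k + 6 + 9 * length (denc ps) + 1" for u
  \<comment> \<open>The cells left on tape 4 tell the weight: none if it exceeds \<open>k\<close>,
    one if it equals \<open>k\<close>, more if it is smaller.\<close>
  proof (cases "drop ?w w")
    case Nil
    hence "\<not> good \<psi> k ps" using assms(8) by (auto simp: good_def)
    moreover have "on w (tp (rev w @ [0]) [])" by (auto intro!: on_tp)
    ultimately show ?thesis using Nil u B assms(5) on_end[of ps]
      by (auto intro!: assms(10))
  next
    case (Cons a v)
    have a: "a > 0" using Cons assms(7) by (metis gr0I in_set_dropD list.set_intros(1))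
    have v: "v = [] \<longleftrightarrow> ?w = k" using arg_cong[OF Cons, of length] assms(8) by auto
    have K: "on w (tp (a # rev (take ?w w) @ [0]) v)"
      using append_take_drop_id[of ?w w] unfolding Cons by (auto intro!: on_tp)
    show ?thesis
    proof (cases v)
      case Nil
      have "wp \<pi> FindAcc (\<lambda>s t. Q s (Suc (Suc t)))
        [t0, tp [] (0 # r), F, tp (rev (denc ps) @ [0]) [], tp (a # rev (take ?w w) @ [0]) [], g]
        (Suc (Suc (Suc u))) q"
        unfolding FindAcc_def wp_Seq
      proof (rule wp_FindUnsat_fstate[where N = N and ps = ps and \<psi> = \<psi>], goal_cases)
        case (7 t0' D' g' t' F')
        have "good \<psi> k ps \<longleftrightarrow> scan F' = 0"
          using fstate_scan[OF 7(3)] v Nil by (auto simp: good_def)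
        thus ?case using 7 u B K Nil fstate_on[OF 7(3)]
          by (auto intro!: assms(10))
      qed (use assms on_end in auto)
      thus ?thesis using Cons Nil a by simp
    next
      case (Cons b v')
      have "\<not> good \<psi> k ps" using Cons v by (auto simp: good_def)
      moreover have "b > 0" using \<open>drop ?w w = a # v\<close> Cons assms(7)
        by (metis gr0I in_set_dropD list.set_intros(1,2))
      ultimately show ?thesis using \<open>drop ?w w = a # v\<close> a K Cons u B assms(5) on_end[of ps]
        by (auto intro!: assms(10))
    qed
  qed
  show ?thesis unfolding Check_def Weight_def wp_Seq
  proof (rule wp_Rewind[where w = "denc ps"], goal_cases)
    case (4 t2)
    have "wp \<pi> (Rewind 4) (wp \<pi> (While (\<lambda>ss. 0 < ss ! 3) WeightBody) ?R)
      [t0, tp [] (0 # r), F, tp [0] (denc ps), K, g] t2 q"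
    proof (rule wp_Rewind[where w = w], goal_cases)
      case t3: (4 t3)
      have "wp \<pi> (While (\<lambda>ss. 0 < ss ! 3) WeightBody) ?R
        [t0, tp [] (0 # r), F, tp [0] (denc ps), tp [0] w, g] t3 q"
        by (rule wp_WeightLoop; (rule main)?) (use assms(7,8) 4 t3 in auto)
      thus ?case by simp
    qed (use assms in auto)
    thus ?case by simp
  qed (use assms in auto)
qed

definition Next :: cmd where
  "Next = Rewind 3 ;; Inc 3 ;; Cond (\<lambda>ss. ss ! 3 = 0) (wr 1 2 Stay) Skip"

lemma wp_Next:
  assumes "length (denc ps) < N" "on (denc ps) D"
    and "\<And>t' D'. t' \<le> t + 40 * N \<Longrightarrow> on (denc (clr ps)) D' \<Longrightarrow> bv (map snd ps) + 1 = 2 ^ length ps \<Longrightarrow>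
      Q [t0, tp [] (2 # r), F, D', K, g] t' q"
    and "\<And>t' D' ps'. t' \<le> t + 40 * N \<Longrightarrow> on (denc ps') D' \<Longrightarrow> map fst ps' = map fst ps \<Longrightarrow>
      bv (map snd ps') = bv (map snd ps) + 1 \<Longrightarrow>
      Q [t0, tp [] (0 # r), F, D', K, g] t' q"
  shows "wp \<pi> Next Q [t0, tp [] (0 # r), F, D, K, g] t q"
  unfolding Next_def wp_Seq
proof (rule wp_Rewind[where w = "denc ps"], goal_cases)
  case (4 t1)
  let ?R = "wp \<pi> (Cond (\<lambda>ss. ss ! 3 = 0) (wr 1 2 Stay) Skip) Q"
  have "wp \<pi> (Inc 3) ?R [t0, tp [] (0 # r), F, tp [0] (denc ps), K, g] t1 q"
  proof (rule wp_Inc[where ls = "[0]" and ps = ps], goal_cases)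
    case (3 t2)
    have "bv (map snd ps) + 1 = 2 ^ length ps" using bv_all[OF 3(1)] by simp
    thus ?case using 3 4 assms(1) on_end[of "clr ps"] by (auto intro!: assms(3))
  next
    case (4 as y cs t2)
    have "on (denc (clr as @ (y, True) # cs)) (tp (rev (denc (clr as)) @ [0]) (4 # enc_nat y @ denc cs))"
      by (auto intro!: on_tp)
    moreover have "map fst (clr as @ (y, True) # cs) = map fst ps" using 4 by simp
    moreover have "bv (map snd (clr as @ (y, True) # cs)) = bv (map snd ps) + 1"
      using bv_carry[OF 4(2), of "map snd cs"] 4(1) by simp
    ultimately show ?case using 4(1,3) \<open>t1 \<le> _\<close> assms(1)
      by (auto intro!: assms(4)[of _ "clr as @ (y, True) # cs"] simp del: map_append)
  qed auto
  thus ?case by simp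
qed (use assms in auto)

text \<open>On tape 1 the blank means that the search goes on, 1 that a good assignment was found, 2
  that the dictionary overflowed without one.\<close>

definition BMode :: cmd where
  "BMode = wr 1 0 Stay ;; While (\<lambda>ss. ss ! 1 = 0) (Check ;; Cond (\<lambda>ss. ss ! 1 = 0) Next Skip)"

lemma pairs_eqI: "map fst ps = map fst qs \<Longrightarrow> bv (map snd ps) = bv (map snd qs) \<Longrightarrow> ps = qs"
  by (metis bv_inject length_map zip_map_fst_snd)

text \<open>\<open>m\<close> counts the assignments from the current one on, so it is positive as
  \<open>bv\<close> stays below \<open>2 ^ length ps\<close>. The conclusion speaks only of
  assignments with numbers from the current one upwards, which makes it inductive.\<close>

lemma wp_BLoop:
  assumes "length (denc ps) < N" "length (fenc \<psi>) < N"
    and "distinct (map fst ps)" "\<Union> (set ` set \<psi>) \<subseteq> fst ` set ps"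
    and "on (fenc \<psi>) F" "on (denc ps) D" "0 \<notin> set w" "length w = Suc k" "on w K"
    and "bv (map snd ps) + m = 2 ^ length ps"
    and "\<And>t0' t1' F' D' K' g' t'. t' \<le> t + m * ((k + 1) * (130 * N ^ 4) + 40 * N + 5) + 1 \<Longrightarrow>
      (t1' = 1 \<longleftrightarrow> (\<exists>qs. map fst qs = map fst ps \<and> bv (map snd qs) \<ge> bv (map snd ps) \<and> good \<psi> k qs)) \<Longrightarrow>
      Q [t0', tp [] (t1' # r), F', D', K', g'] t' q"
  shows "wp \<pi> (While (\<lambda>ss. ss ! 1 = 0) (Check ;; Cond (\<lambda>ss. ss ! 1 = 0) Next Skip)) Q
    [t0, tp [] (0 # r), F, D, K, g] t q"
  using assms
proof (induction m arbitrary: ps t0 F D K g t)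
  case 0
  then show ?case using bv_less[of "map snd ps"] by simp
next
  case (Suc m)
  define W where "W = While (\<lambda>ss. ss ! 1 = 0) (Check ;; Cond (\<lambda>ss. ss ! 1 = 0) Next Skip)"
  have "wp \<pi> Check (wp \<pi> (Cond (\<lambda>ss. ss ! 1 = 0) Next Skip) (\<lambda>s t. wp \<pi> W Q s (Suc t)))
    [t0, tp [] (0 # r), F, D, K, g] (Suc t) q"
  proof (rule wp_Check[where N = N and ps = ps and \<psi> = \<psi> and w = w and k = k], goal_cases)
    case (10 t0' t1' F' D' K' g' t')
    show ?case
    proof (cases "good \<psi> k ps")
      case True
      have "Q [t0', tp [] (1 # r), F', D', K', g'] (Suc (Suc (Suc t'))) q"
        by (rule Suc.prems(11)) (use 10(1) True in auto)
      thus ?thesis using True 10(5) unfolding W_def by simp (subst wp_While, simp)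
    next
      case False
      have "wp \<pi> Next (\<lambda>s t. wp \<pi> W Q s (Suc (Suc t)))
        [t0', tp [] (0 # r), F', D', K', g'] (Suc t') q"
      proof (rule wp_Next[where N = N and ps = ps], goal_cases)
        case (3 t'' D'')
        have "\<not> (\<exists>qs. map fst qs = map fst ps \<and> bv (map snd qs) \<ge> bv (map snd ps) \<and> good \<psi> k qs)"
        proof safe
          fix qs assume qs: "map fst qs = map fst ps" "bv (map snd qs) \<ge> bv (map snd ps)" "good \<psi> k qs"
          have "length qs = length ps" using qs(1) by (metis length_map)
          hence "bv (map snd qs) = bv (map snd ps)"
            using bv_less[of "map snd qs"] qs(2) 3(3) by simp
          hence "qs = ps" using qs(1) by (intro pairs_eqI)
          thus False using qs False by simp
        qed
        hence "Q [t0', tp [] (2 # r), F', D'', K', g'] (Suc (Suc (Suc t''))) q"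
          by (intro Suc.prems(11)) (use 10(1) 3(1) in auto)
        thus ?case unfolding W_def by (subst wp_While) simp
      next
        case (4 t'' D'' ps')
        have fps': "fst ` set ps' = fst ` set ps" "length ps' = length ps"
          using 4(3) by (metis list.set_map, metis length_map)
        show ?case unfolding W_def
        proof (rule Suc.IH[where ps = ps'], goal_cases)
          case (11 u t1'' t0'' F'' D''' K'' g'')
          have "(\<exists>qs. map fst qs = map fst ps' \<and> bv (map snd ps') \<le> bv (map snd qs) \<and> good \<psi> k qs) \<longleftrightarrow>
            (\<exists>qs. map fst qs = map fst ps \<and> bv (map snd ps) \<le> bv (map snd qs) \<and> good \<psi> k qs)"
          proof (intro iffI; elim exE conjE)
            fix qs assume qs: "map fst qs = map fst ps" "bv (map snd qs) \<ge> bv (map snd ps)" "good \<psi> k qs"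
            \<comment> \<open>The current assignment is not good, so a good one has a strictly
              larger number, hence at least that of \<open>ps'\<close>.\<close>
            have "bv (map snd qs) \<noteq> bv (map snd ps)" using pairs_eqI[OF qs(1)] qs(3) False by auto
            thus "\<exists>qs. map fst qs = map fst ps' \<and> bv (map snd ps') \<le> bv (map snd qs) \<and> good \<psi> k qs"
              using qs 4 by (intro exI[of _ qs]) auto
          qed (use 4 in auto)
          thus ?case using 11 4(1) 10(1) by (intro Suc.prems(11)) auto
        qed (use Suc.prems 10 4 fps' length_denc_cong[OF 4(3)] in auto)
      qed (use Suc.prems 10 in auto)
      thus ?thesis using False 10(5) by simp
    qed
  qed (use Suc.prems in auto)
  thus ?case unfolding W_def by (subst wp_While) simp
qed

lemma wp_BMode:
  assumes "length (denc ps) < N" "length (fenc \<psi>) < N"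
    and "distinct (map fst ps)" "\<Union> (set ` set \<psi>) \<subseteq> fst ` set ps"
    and "on (fenc \<psi>) F" "on (denc ps) D" "0 \<notin> set w" "length w = Suc k" "on w K"
    and "True \<notin> set (map snd ps)"
    and "\<And>s' t'. t' \<le> t + 2 ^ length ps * ((k + 1) * (180 * N ^ 4)) + 2 \<Longrightarrow>
      (scan (s' ! 1) = 1 \<longleftrightarrow> (\<exists>qs. map fst qs = map fst ps \<and> good \<psi> k qs)) \<Longrightarrow> length s' = 6 \<Longrightarrow>
      Q s' t' q"
  shows "wp \<pi> BMode Q [t0, tp [] r, F, D, K, g] t q"
proof -
  have bv0: "bv (map snd ps) = 0" using assms(10) by (rule bv_none)
  have "N \<ge> 1" using assms by auto
  hence N: "N ^ 4 \<ge> N" "N ^ 4 \<ge> 1" using power_increasing[of 1 4 N] by auto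
  have "(k + 1) * (130 * N ^ 4) + 40 * N + 5 \<le> (k + 1) * (180 * N ^ 4)"
    using N by (cases "N ^ 4") (auto simp: algebra_simps)
  hence B: "2 ^ length ps * ((k + 1) * (130 * N ^ 4) + 40 * N + 5) \<le> 2 ^ length ps * ((k + 1) * (180 * N ^ 4))"
    by (intro mult_left_mono) auto
  have "wp \<pi> (While (\<lambda>ss. ss ! 1 = 0) (Check ;; Cond (\<lambda>ss. ss ! 1 = 0) Next Skip)) Q
    [t0, tp [] (0 # tl r), F, D, K, g] (Suc t) q"
  proof (rule wp_BLoop[where N = N and ps = ps and \<psi> = \<psi> and w = w and k = k and m = "2 ^ length ps"], goal_cases)
    case (11 t0' t1' F' D' K' g' t')
    have "t' \<le> t + 2 ^ length ps * ((k + 1) * (180 * N ^ 4)) + 2" using 11(1) B by linarith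
    thus ?case by (rule assms(11)) (use 11(2) bv0 in auto)
  qed (use assms bv0 in auto)
  thus ?thesis by (simp add: BMode_def act_tp_tl)
qed

section \<open>Building the work tapes\<close>

definition Copy :: cmd where
  "Copy = While (\<lambda>ss. ss ! 0 \<noteq> 6) (cp 2 0 GoRight ;; mv 0 GoRight)"

lemma wp_Copy:
  assumes "6 \<notin> set w"
    and "\<And>t'. t' \<le> t + 4 * length w + 1 \<Longrightarrow>
      Q [tp (rev w @ l) (6 # b), t1, tp (rev w @ lf) [], D, K, g] t' q"
  shows "wp \<pi> Copy Q [tp l (w @ 6 # b), t1, tp lf [], D, K, g] t q"
  using assms
proof (induction w arbitrary: l lf t)
  case Nil
  then show ?case unfolding Copy_def by (subst wp_While) simp
next
  case (Cons a w)
  have "wp \<pi> Copy Q [tp (a # l) (w @ 6 # b), t1, tp (a # lf) [], D, K, g] (Suc (Suc (Suc (Suc t)))) q"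
    using Cons.prems by (intro Cons.IH) auto
  thus ?case using Cons.prems(1) unfolding Copy_def by (subst wp_While) simp
qed

section \<open>Converting the parameter from binary to unary\<close>

definition DecLoop :: cmd where
  "DecLoop = While (\<lambda>ss. ss ! 0 = 1) (wr 0 2 GoRight)"

definition Dec :: cmd where
  "Dec = mv 0 GoRight ;; DecLoop"

text \<open>Subtraction of 1 with borrow: leading digits 0 (symbol 1) become 1 (symbol 2), and the
  first digit 1 is left under the head for \<open>KBody\<close> to clear. If there is none, the
  value was 0 and the borrow runs into the blank.\<close>

lemma wp_DecLoop:
  assumes "list_all isbit bs"
    and "\<And>t' t0'. bval bs = 0 \<Longrightarrow> scan t0' = 0 \<Longrightarrow> t' \<le> t + 3 * length bs + 1 \<Longrightarrow> Q (t0' # ts) t' q"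
    and "\<And>t' as cs. bs = as @ 2 # cs \<Longrightarrow> set as \<subseteq> {1} \<Longrightarrow> t' \<le> t + 3 * length bs + 1 \<Longrightarrow>
      Q (tp (map (\<lambda>_. 2) as @ l) (2 # cs) # ts) t' q"
  shows "wp \<pi> DecLoop Q (tp l bs # ts) t q"
  using assms
proof (induction bs arbitrary: l t)
  case Nil
  then show ?case unfolding DecLoop_def by (subst wp_While) simp
next
  case (Cons b bs)
  show ?case
  proof (cases "b = 1")
    case True
    have "wp \<pi> DecLoop Q (tp (2 # l) bs # ts) (Suc (Suc (Suc t))) q"
    proof (rule Cons.IH, goal_cases)
      case (2 t' t0')
      then show ?case using True by (intro Cons.prems(2)) auto
    next
      case (3 as cs t')
      have *: "Q (tp (map (\<lambda>_. 2) (b # as) @ l) (2 # cs) # ts) t' q"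
        using True 3 by (intro Cons.prems(3)) auto
      have **: "map (\<lambda>_. 2) (b # as) @ l = map (\<lambda>_. 2) as @ 2 # l"
        by (induction as) auto
      show ?case using * unfolding ** .
    qed (use Cons.prems in auto)
    thus ?thesis using True unfolding DecLoop_def by (subst wp_While) simp
  next
    case False
    hence b: "b = 2" using Cons.prems(1) by (simp add: isbit_def One_nat_def)
    have "Q (tp l (2 # bs) # ts) (Suc t) q"
      using b Cons.prems(3)[of "[]" bs "Suc t"] by simp
    thus ?thesis using b unfolding DecLoop_def by (subst wp_While) simp
  qed
qed

lemma bval_borrow: "set as \<subseteq> {1} \<Longrightarrow> bval (map (\<lambda>_. 2) as @ 1 # cs) + 1 = bval (as @ 2 # cs)"
  by (induction as) auto

definition KBody :: cmd where
  "KBody = wr 0 1 Stay ;; wr 4 3 GoRight ;; BackTo 0 6 ;; Dec"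

text \<open>One cell is written in advance and one per successful decrement, \<open>k + 1\<close> in
  all. The \<open>k\<close> rounds may be exponential in the length of the binary parameter, which
  fixed-parameter time allows.\<close>

definition KBuild :: cmd where
  "KBuild = wr 4 3 GoRight ;; Dec ;; While (\<lambda>ss. 0 < ss ! 0) KBody"

text \<open>Decrementing keeps the high zeros, so the word need not be an \<open>enc_nat\<close> and
  is described by its value. The rule starts at \<open>Dec\<close> because each loop body ends with
  one.\<close>

lemma wp_KLoop:
  assumes "list_all isbit bs" "bval bs = v"
    and "\<And>t' t0'. t' \<le> t + (v + 1) * (6 * length bs + 20) \<Longrightarrow> scan t0' = 0 \<Longrightarrow>
      Q [t0', t1, F, D, tp (replicate v 3 @ lk) [], g] t' q"
  shows "wp \<pi> Dec (wp \<pi> (While (\<lambda>ss. 0 < ss ! 0) KBody) Q) [tp l (6 # bs), t1, F, D, tp lk [], g] t q"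
  using assms
proof (induction v arbitrary: bs lk t Q)
  case 0
  have "wp \<pi> DecLoop (wp \<pi> (While (\<lambda>ss. 0 < ss ! 0) KBody) Q) [tp (6 # l) bs, t1, F, D, tp lk [], g] (Suc t) q"
  proof (rule wp_DecLoop[OF 0(1)], goal_cases)
    case (1 t' t0')
    then show ?case using 0(3)[of "Suc t'" t0'] by (subst wp_While) simp
  next
    case (2 t' as cs)
    then show ?case using 0(2) bval_borrow[OF 2(2), of cs] by simp
  qed
  thus ?case by (simp add: Dec_def)
next
  case (Suc v)
  define W where "W = While (\<lambda>ss. 0 < ss ! 0) KBody"
  have "wp \<pi> DecLoop (wp \<pi> W Q) [tp (6 # l) bs, t1, F, D, tp lk [], g] (Suc t) q"
  proof (rule wp_DecLoop[OF Suc(2)], goal_cases)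
    case (1 t' t0')
    then show ?case using Suc.prems(2) by simp
  next
    case (2 t' as cs)
    let ?bs = "map (\<lambda>_. 2) as @ 1 # cs"
    have len: "length ?bs = length bs" and bits: "list_all isbit ?bs"
      using 2(1) Suc.prems(1) by (auto simp: list_all_iff)
    have "bval ?bs = v" using bval_borrow[OF 2(2), of cs] 2(1) Suc.prems(2) by simp
    have "wp \<pi> (BackTo 0 6) (wp \<pi> Dec (\<lambda>s t. wp \<pi> W Q s (Suc t)))
      [tp (map (\<lambda>_. 2) as @ 6 # l) (1 # cs), t1, F, D, tp (3 # lk) [], g] (Suc (Suc (Suc t'))) q"
    proof (rule wp_BackTo[where w = "map (\<lambda>_. 2) as" and ls = l and rs = "1 # cs"], goal_cases)
      case (4 u)
      have "wp \<pi> Dec (wp \<pi> W (\<lambda>s t. Q s (Suc t))) [tp l (6 # ?bs), t1, F, D, tp (3 # lk) [], g] u q"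
        unfolding W_def
      proof (rule Suc.IH[OF bits \<open>bval ?bs = v\<close>], goal_cases)
        case (1 t'' t0')
        have "length as \<le> length bs" using 2(1) by simp
        hence "Suc t'' \<le> t + (Suc v + 1) * (6 * length bs + 20)"
          using 1(1) 4 2(3) unfolding len by simp
        moreover have *: "replicate v 3 @ 3 # lk = replicate (Suc v) 3 @ lk"
          by (simp add: replicate_app_Cons_same)
        ultimately show ?case using 1(2) unfolding * by (intro Suc.prems(3))
      qed
      \<comment> \<open>The jump after the body is moved from the end of the loop to its front:
        \<open>wp\<close> commutes with shifting the clock.\<close>
      hence "wp \<pi> Dec (\<lambda>s t. wp \<pi> W Q s (Suc t)) [tp l (6 # ?bs), t1, F, D, tp (3 # lk) [], g] u q"
        by (rule wp_mono) (auto simp: wp_def)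
      thus ?case by simp
    qed (auto simp: map_replicate_const)
    hence "wp \<pi> KBody (\<lambda>s t. wp \<pi> W Q s (Suc t))
      [tp (map (\<lambda>_. 2) as @ 6 # l) (2 # cs), t1, F, D, tp lk [], g] (Suc t') q"
      unfolding KBody_def by simp
    thus ?case unfolding W_def by (subst wp_While) simp
  qed
  thus ?case by (simp add: Dec_def W_def)
qed

section \<open>Building the dictionary\<close>

definition AppendLoop :: cmd where
  "AppendLoop = While (\<lambda>ss. isbit (ss ! 2)) (cp 3 2 GoRight ;; mv 2 GoRight)"

lemma wp_AppendLoop:
  assumes "list_all isbit bs" "\<not> isbit (hd0 rest)"
    and "\<And>t'. t' \<le> t + 4 * length bs + 1 \<Longrightarrow>
      Q [t0, t1, tp (rev bs @ lf) rest, tp (rev bs @ ld) [], K, g] t' q"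
  shows "wp \<pi> AppendLoop Q [t0, t1, tp lf (bs @ rest), tp ld [], K, g] t q"
  using assms
proof (induction bs arbitrary: ld lf t)
  case Nil
  then show ?case unfolding AppendLoop_def by (subst wp_While) simp
next
  case (Cons b bs)
  have "wp \<pi> AppendLoop Q [t0, t1, tp (b # lf) (bs @ rest), tp (b # ld) [], K, g] (Suc (Suc (Suc (Suc t)))) q"
    by (rule Cons.IH) (use Cons.prems in auto)
  thus ?case using Cons.prems(1) unfolding AppendLoop_def by (subst wp_While) simp
qed

definition ienc :: "nat option list \<Rightarrow> symbol list" where
  "ienc is = concat (map (\<lambda>i. case i of None \<Rightarrow> [5] | Some x \<Rightarrow> 3 # enc_nat x) is)"

lemma ienc_simps [simp]: "ienc [] = []" "ienc (None # is) = 5 # ienc is" "ienc (Some x # is) = 3 # enc_nat x @ ienc is"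
  "ienc (is @ js) = ienc is @ ienc js"
  by (auto simp: ienc_def)

text \<open>The formula as a flat stream of clause markers (\<open>None\<close>) and variables, so
  that one loop, hence one induction, builds the dictionary.\<close>

definition items :: "nat list list \<Rightarrow> nat option list" where
  "items \<psi> = concat (map (\<lambda>C. None # map Some C) \<psi>)"

lemma ienc_items: "ienc (items \<psi>) = fenc \<psi>"
proof -
  have "ienc (map Some C) = lenc C" for C by (induction C) auto
  thus ?thesis by (induction \<psi>) (auto simp: items_def)
qed

lemma hd0_ienc [simp]: "\<not> isbit (hd0 (ienc is))"
proof (cases "is")
  case (Cons i js)
  thus ?thesis by (cases i) auto
qed simp

lemma Some_in_items: "Some x \<in> set (items \<psi>) \<longleftrightarrow> x \<in> \<Union> (set ` set \<psi>)"
  by (auto simp: items_def)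

lemma length_le_ienc: "length is \<le> length (ienc is)"
proof (induction "is")
  case (Cons i js)
  thus ?case by (cases i) auto
qed simp

text \<open>The marker 3 copied from the literal doubles as the value false of the new
  entry.\<close>

definition DBody :: cmd where
  "DBody = Cond (\<lambda>ss. ss ! 2 = 3)
     (Lookup ;; Cond (\<lambda>ss. ss ! 3 = 0) (cp 3 2 GoRight ;; mv 2 GoRight ;; AppendLoop)
        (mv 2 GoRight ;; SkipBits 2))
     (mv 2 GoRight)"

definition DBuild :: cmd where
  "DBuild = Rewind 2 ;; While (\<lambda>ss. 0 < ss ! 2) DBody"

lemma wp_DBody_Some:
  assumes N: "length (denc ps) < N" "length (enc_nat x) < N"
    and rest: "\<not> isbit (hd0 rest)" and D: "on (denc ps) D"
    and Q: "\<And>t0' D' t'. t' \<le> t + 45 * N * N + 4 * N + 10 \<Longrightarrow>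
      on (denc (if x \<in> fst ` set ps then ps else ps @ [(x, False)])) D' \<Longrightarrow>
      Q [t0', t1, tp (rev (3 # enc_nat x) @ lf) rest, D', K, g] t' q"
  shows "wp \<pi> DBody Q [t0, t1, tp lf (3 # enc_nat x @ rest), D, K, g] t q"
proof -
  have "wp \<pi> Lookup (wp \<pi> (Cond (\<lambda>ss. ss ! 3 = 0) (cp 3 2 GoRight ;; mv 2 GoRight ;; AppendLoop)
        (mv 2 GoRight ;; SkipBits 2)) (\<lambda>s t. Q s (Suc t)))
     [t0, t1, tp lf (3 # enc_nat x @ rest), D, K, g] (Suc t) q"
  proof (rule wp_Lookup[where N = N and ps = ps], goal_cases)
    case (5 as b cs t')
    have *: "wp \<pi> (SkipBits 2) (\<lambda>s t. Q s (Suc t)) [put 1 t0, t1, tp (3 # lf) (enc_nat x @ rest),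
      tp (rev (denc as) @ [0]) (denc ((x, b) # cs)), K, g] (Suc (Suc t')) q"
    proof (rule wp_SkipBits[where bs = "enc_nat x" and rs = rest and ls = "3 # lf"], goal_cases)
      case prems: (5 u)
      have "Q [put 1 t0, t1, tp (rev (3 # enc_nat x) @ lf) rest,
        tp (rev (denc as) @ [0]) (denc ((x, b) # cs)), K, g] (Suc u) q"
        by (rule Q) (use 5 prems N on_entry[OF 5(1)] in \<open>auto simp del: denc_simps\<close>)
      thus ?case by simp
    qed (use rest in auto)
    thus ?case by (cases b) auto
  next
    case (6 t')
    have "wp \<pi> AppendLoop (\<lambda>s t. Q s (Suc (Suc t))) [put 2 t0, t1, tp (3 # lf) (enc_nat x @ rest),
      tp (3 # rev (denc ps) @ [0]) [], K, g] (Suc (Suc (Suc t'))) q"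
    proof (rule wp_AppendLoop, goal_cases)
      case (3 u)
      have "Q [put 2 t0, t1, tp (rev (3 # enc_nat x) @ lf) rest,
        tp (rev (enc_nat x) @ 3 # rev (denc ps) @ [0]) [], K, g] (Suc (Suc u)) q"
        by (rule Q) (use 6 3 N in \<open>auto intro!: on_tp\<close>)
      thus ?case by simp
    qed (use rest in auto)
    thus ?case by simp
  qed (use assms in auto)
  thus ?thesis unfolding DBody_def by simp
qed

text \<open>A new entry is as long as the literal it comes from, so the dictionary and the unread
  part of the formula together never outgrow \<open>N\<close>.\<close>

lemma wp_DLoop:
  assumes "length (denc ps) + length (ienc is) < N" "on (denc ps) D" "distinct (map fst ps)"
    and "True \<notin> set (map snd ps)"
    and "\<And>t0' D' t' ps'. t' \<le> t + length is * (70 * N * N) + 1 \<Longrightarrow> on (denc ps') D' \<Longrightarrow>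
      length (denc ps') \<le> length (denc ps) + length (ienc is) \<Longrightarrow>
      distinct (map fst ps') \<Longrightarrow> True \<notin> set (map snd ps') \<Longrightarrow>
      fst ` set ps' = fst ` set ps \<union> {x. Some x \<in> set is} \<Longrightarrow>
      Q [t0', t1, tp (rev (ienc is) @ lf) [], D', K, g] t' q"
  shows "wp \<pi> (While (\<lambda>ss. 0 < ss ! 2) DBody) Q [t0, t1, tp lf (ienc is), D, K, g] t q"
  using assms
proof (induction "is" arbitrary: t0 lf D t ps)
  case Nil
  then show ?case by (subst wp_While) simp
next
  case (Cons i js)
  define W where "W = While (\<lambda>ss. 0 < ss ! 2) DBody"
  have N: "4 * N + 12 \<le> 25 * N * N" using Cons.prems(1) by (cases N) auto
  show ?case
  proof (cases i)
    case None
    have "wp \<pi> W Q [t0, t1, tp (5 # lf) (ienc js), D, K, g] (Suc (Suc (Suc (Suc t)))) q"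
      unfolding W_def
    proof (rule Cons.IH[where ps = ps], goal_cases)
      case (5 t' ps' D' t0')
      have "Q [t0', t1, tp (rev (ienc (i # js)) @ lf) [], D', K, g] t' q"
        by (rule Cons.prems(5)[of _ ps']) (use 5 None N in auto)
      thus ?case using None by simp
    qed (use Cons.prems None in auto)
    thus ?thesis using None unfolding W_def by (subst wp_While) (simp add: DBody_def)
  next
    case (Some x)
    have "wp \<pi> DBody (\<lambda>s t. wp \<pi> W Q s (Suc t)) [t0, t1, tp lf (3 # enc_nat x @ ienc js), D, K, g] (Suc t) q"
    proof (rule wp_DBody_Some[where N = N and ps = ps], goal_cases)
      case (5 t0' D' t')
      define ps1 where "ps1 = (if x \<in> fst ` set ps then ps else ps @ [(x, False)])"
      show ?case unfolding W_def
      proof (rule Cons.IH[where ps = ps1], goal_cases)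
        case prems: (5 t'' ps' D'' t0'')
        have "Q [t0'', t1, tp (rev (ienc (i # js)) @ lf) [], D'', K, g] t'' q"
        proof (rule Cons.prems(5)[of _ ps'], goal_cases)
          case 1
          show ?case using prems(1) 5(1) N by (simp add: algebra_simps)
        next
          case 3
          show ?case using prems(3) Some by (auto simp: ps1_def split: if_splits)
        next
          case 6
          show ?case using prems(6) Some by (auto simp: ps1_def split: if_splits)
        qed (use prems in auto)
        thus ?case using Some by simp
      qed (use 5 Cons.prems Some in \<open>auto simp: ps1_def\<close>)
    qed (use Cons.prems Some in auto)
    thus ?thesis using Some unfolding W_def by (subst wp_While) simp
  qed
qed

lemma wp_DBuild:
  assumes "length (fenc \<psi>) < N" "on (fenc \<psi>) F"
    and "\<And>t0' D' t' ps. t' \<le> t + 80 * N ^ 3 \<Longrightarrow> on (denc ps) D' \<Longrightarrow>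
      length (denc ps) < N \<Longrightarrow>
      distinct (map fst ps) \<Longrightarrow> True \<notin> set (map snd ps) \<Longrightarrow>
      fst ` set ps = \<Union> (set ` set \<psi>) \<Longrightarrow>
      Q [t0', t1, tp (rev (fenc \<psi>) @ [0]) [], D', K, g] t' q"
  shows "wp \<pi> DBuild Q [t0, t1, F, tp [0] [], K, g] t q"
proof -
  have N: "N ^ 3 \<ge> N" "N ^ 3 \<ge> 1" using power_increasing[of 1 3 N] assms(1) by auto
  have "length (items \<psi>) \<le> N" using length_le_ienc[of "items \<psi>"] assms(1) by (simp add: ienc_items)
  hence "length (items \<psi>) * (70 * N * N) \<le> 70 * N ^ 3" by (simp add: power3_eq_cube)
  hence B: "length (items \<psi>) * (70 * N * N) + 3 * length (fenc \<psi>) + 7 \<le> 80 * N ^ 3"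
    using N assms(1) by linarith
  show ?thesis unfolding DBuild_def wp_Seq
  proof (rule wp_Rewind[where w = "fenc \<psi>"], goal_cases)
    case (4 t1')
    have "wp \<pi> (While (\<lambda>ss. 0 < ss ! 2) DBody) Q [t0, t1, tp [0] (ienc (items \<psi>)), tp [0] [], K, g] t1' q"
    proof (rule wp_DLoop[where ps = "[]" and N = N], goal_cases)
      case (5 t0' D' t' ps')
      show ?case unfolding ienc_items
        by (rule assms(3)[of _ ps']) (use 5 4 B assms(1) in \<open>auto simp: ienc_items Some_in_items\<close>)
    qed (use assms(1) in \<open>auto simp: ienc_items intro!: on_tp\<close>)
    thus ?case by (simp add: ienc_items)
  qed (use assms in auto)
qed

section \<open>The verifier\<close>

text \<open>The first moves leave cell 0 of the work tapes blank, as \<open>on\<close> demands.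
  \<open>KBuild\<close> uses up the parameter on tape 0, which is then free for the flag of
  \<open>Lookup\<close>. A blank on tape 4 after \<open>Thresh\<close> signals the overflow.\<close>

definition Main :: cmd where
  "Main = mv 2 GoRight ;; mv 3 GoRight ;; mv 4 GoRight ;; Copy ;; KBuild ;; DBuild ;; Thresh ;;
     Cond (\<lambda>ss. ss ! 4 = 0) QMode BMode"

definition hits :: "nat list list \<Rightarrow> nat set \<Rightarrow> bool" where
  "hits \<psi> A \<longleftrightarrow> (\<forall>C \<in> set \<psi>. \<exists>x \<in> set C. x \<in> A)"

lemma wp_Main:
  fixes \<psi> :: "nat list list" and k p :: nat
  defines "V \<equiv> \<Union> (set ` set \<psi>)" and "N \<equiv> length (fenc \<psi> @ 6 # enc_nat k)"
  assumes p: "\<forall>C \<in> set \<psi>. length C \<le> p"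
    and Q: "\<And>s' t' q'. t' \<le> 2 ^ 2 ^ Suc k * ((k + 1) * 800) * N ^ 4 \<Longrightarrow>
      q' \<le> (if 2 ^ Suc k \<le> card V then k * p else 0) \<Longrightarrow>
      (scan (s' ! 1) = 1 \<Longrightarrow> \<exists>A \<subseteq> V. card A = k \<and> hits \<psi> A) \<Longrightarrow>
      (\<And>A. A \<subseteq> V \<Longrightarrow> card A = k \<Longrightarrow> hits \<psi> A \<Longrightarrow> (\<forall>x. proof_bit \<pi> x \<longleftrightarrow> x \<in> A) \<Longrightarrow>
        scan (s' ! 1) = 1) \<Longrightarrow> length s' = 6 \<Longrightarrow> Q s' t' q'"
  shows "wp \<pi> Main Q (map input_tape [fenc \<psi> @ 6 # enc_nat k, [], [], [], [], []]) 0 0"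
proof -
  have N: "length (fenc \<psi>) < N" "length (enc_nat k) < N" "N \<ge> 1" by (auto simp: N_def)
  have finV: "finite V" by (auto simp: V_def)
  have Npow: "N ^ 4 \<ge> N" "N ^ 4 \<ge> N ^ 2" "N ^ 4 \<ge> N ^ 3" "N ^ 4 \<ge> 1"
    using power_increasing[of _ 4 N] N(3) power_increasing[of 1 4 N] by auto
  \<comment> \<open>Times are compared in two units: \<open>B\<close> for the polynomial phases and
    \<open>E * B\<close> for the search through fewer than \<open>E\<close> assignments.\<close>
  define B where "B = (k + 1) * N ^ 4"
  have Bk: "(k + 1) * N \<le> B" "k + 1 \<le> B" "N ^ 4 \<le> B" "(k + 1) * N ^ 2 \<le> B"
    using Npow mult_le_mono[OF order_refl[of "k + 1"] Npow(1)] mult_le_mono[OF order_refl[of "k + 1"] Npow(2)]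
      mult_le_mono[OF order_refl[of "k + 1"] Npow(4)]
    by (auto simp: B_def)
  define E where "E = (2::nat) ^ 2 ^ Suc k"
  have E: "E \<ge> 1" by (simp add: E_def)
  have EB: "B \<le> E * B" using E by simp
  have total: "2 ^ 2 ^ Suc k * ((k + 1) * 800) * N ^ 4 = 800 * (E * B)"
    by (simp add: E_def B_def mult_ac)
  show ?thesis
    unfolding Main_def
    apply (simp add: input_tape_tp del: hd0.simps One_nat_def)
    apply (simp del: wp_Cond)
    apply (rule wp_Copy)
     apply simp
    unfolding KBuild_def
    apply simp
  proof (rule wp_KLoop[OF list_all_enc_nat bval_enc_nat], goal_cases)
    case (1 tc t0 ta)
    have "t0 \<le> 3 + 4 * length (fenc \<psi>) + 2 + (k + 1) * (6 * length (enc_nat k) + 20)" using 1 by simp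
    moreover have "(k + 1) * (6 * length (enc_nat k) + 20) \<le> (k + 1) * (6 * N + 20)"
      using N(2) by (intro mult_left_mono) auto
    moreover have "\<dots> = 6 * ((k + 1) * N) + 20 * (k + 1)" by (simp add: algebra_simps)
    ultimately have "t0 \<le> 5 + 4 * length (fenc \<psi>) + (6 * ((k + 1) * N) + 20 * (k + 1))" by simp
    moreover have "6 * ((k + 1) * N) \<le> 6 * B" "20 * (k + 1) \<le> 20 * B"
      using mult_le_mono2[OF Bk(1), of 6] mult_le_mono2[OF Bk(2), of 20] .
    moreover have "length (fenc \<psi>) \<le> B" "1 \<le> B" using N(1) Npow(1) Bk(2,3) by linarith+
    ultimately have t0: "t0 \<le> 40 * B" by linarith
    show ?case unfolding wp_Seq
    proof (rule wp_DBuild[where N = N and \<psi> = \<psi>], goal_cases)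
      case (3 u0 D t2 ps)
      have t2: "t2 \<le> 120 * B" using 3(1) t0 Npow Bk by linarith
      have cV: "length ps = card V" "fst ` set ps = V"
        using distinct_card[OF 3(4)] 3(6) by (auto simp: V_def)
      show ?case
      proof (rule wp_Thresh[where N = N and ks = "replicate (Suc k) False" and k = k and ps = ps], goal_cases)
        case (6 t3 D' K')
        have t3: "t3 \<le> 190 * B" using 6(1) t2 Bk by (simp add: algebra_simps power2_eq_square)
        have kenc: "on (replicate (Suc k) 3) (tp (rev (replicate (Suc k) 3) @ [0]) [])"
          by (intro on_tp) auto
        show ?case
        proof (cases "2 ^ Suc k \<le> length ps")
          case True
          hence K': "K' = tp (rev (replicate (Suc k) 3) @ [0]) []" using 6(3) by simp
          have ts: "tset ps = {}" using 3(5) by (force simp: tset_def)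
          \<comment> \<open>The threshold ensures that there are enough variables to pad the chosen
            set to size \<open>k\<close>.\<close>
          have "k \<le> card V" using True cV less_exp[of "Suc k"] by simp
          have "wp \<pi> QMode (\<lambda>s t. Q s (Suc t)) 
            [u0, tp [] [], tp (rev (fenc \<psi>) @ [0]) [], D', K', tp [] []] (Suc t3) 0"
          proof (rule wp_QMode[where N = N and ps = ps and \<psi> = \<psi> and k = k and p = p], goal_cases)
            case (10 s' t' q')
            show ?case
            proof (rule Q, goal_cases)
              case 1
              show ?case unfolding total using 10(1) t3 EB Bk(2) by (simp add: B_def algebra_simps)
            next
              case 2
              show ?case using 10(2) True cV by simp
            next
              case 3
              then obtain A where A: "A \<subseteq> V" "card A \<le> k" "hits \<psi> A"
                using 10(3) cV by (auto simp: hits_def)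
              obtain A' where "A \<subseteq> A'" "A' \<subseteq> V" "card A' = k"
                using exists_subset_between[OF A(2) \<open>k \<le> card V\<close> A(1) finV] by blast
              moreover from this A(3) have "hits \<psi> A'" unfolding hits_def by blast
              ultimately show ?case by blast
            next
              case (4 A)
              show ?case by (rule 10(4)[of A]) (use 4 finV in \<open>auto simp: hits_def intro: finite_subset\<close>)
            qed (use 10 in auto)
          qed (use N 3 6 p ts kenc K' in \<open>auto simp: V_def intro!: on_tp\<close>)
          thus ?thesis using K' by simp
        next
          case False
          then obtain ks' where ks': "length ks' = Suc k" "K' = tp [0] (kenc ks')" using 6(3) by auto
          have K1: "hd0 (kenc ks') > 0" using ks'(1) by (cases ks') (auto simp: kenc_def)
          have pw: "(2::nat) ^ length ps \<le> E" unfolding E_def using False by (intro power_increasing) auto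
          have "wp \<pi> BMode Q
            [u0, tp [] [], tp (rev (fenc \<psi>) @ [0]) [], D', K', tp [] []] (Suc t3) 0"
          proof (rule wp_BMode[where N = N and ps = ps and \<psi> = \<psi> and k = k and w = "kenc ks'"], goal_cases)
            case (11 s' t')
            have "2 ^ length ps * ((k + 1) * (180 * N ^ 4)) = 180 * (2 ^ length ps * B)"
              by (simp add: B_def mult_ac)
            also have "\<dots> \<le> 180 * (E * B)" using pw by simp
            finally have t': "t' \<le> 800 * (E * B)" using 11(1) t3 EB Bk(2) by linarith
            show ?case
            proof (rule Q, goal_cases)
              case 1
              show ?case unfolding total by (rule t')
            next
              case 3
              then obtain qs where qs: "map fst qs = map fst ps" "good \<psi> k qs" using 11(2) by auto
              have "fst ` set qs = V" using qs(1) cV by (metis list.set_map)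
              hence "tset qs \<subseteq> V" using tset_subset[of qs] by simp
              moreover have "card (tset qs) = k" using wt_card[of qs] qs 3 \<open>distinct (map fst ps)\<close> by (simp add: good_def)
              ultimately show ?case using qs(2) by (auto simp: good_def hits_def csat_tset)
            next
              case (4 A)
              let ?qs = "map (\<lambda>(x, _). (x, x \<in> A)) ps"
              have f: "map fst ?qs = map fst ps" by auto
              have ts: "tset ?qs = A" using 4(1) cV(2) by (force simp: tset_def)
              have "wt ?qs = card (tset ?qs)" by (rule wt_card) (simp only: f 3(4))
              hence "good \<psi> k ?qs" using 4(2,3) by (simp add: good_def csat_tset hits_def ts)
              thus ?case using 11(2) f by blast
            qed (use 11 in auto)
          qed (use N 3 6 ks' in \<open>auto simp: V_def intro!: on_tp\<close>)
          thus ?thesis using ks' K1 by simp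
        qed
      next
        case 5
        have "kenc (replicate (Suc k) False) = replicate (Suc k) 3"
          by (induction k) (auto simp: kenc_def)
        thus ?case by (auto intro!: on_tp simp: replicate_app_Cons_same)
      qed (use 3 in auto)
    qed (use N in \<open>auto intro!: on_tp\<close>)
  qed
qed

section \<open>Computability of the time bound\<close>

lemma computable_comp: "computable f \<Longrightarrow> computable g \<Longrightarrow> computable (\<lambda>n. f (g n))"
proof -
  assume "computable f" "computable g"
  then obtain e e' where "\<And>n. rec_eval e [n] (f n)" "\<And>n. rec_eval e' [n] (g n)"
    by (auto simp: computable_def)
  hence "rec_eval (Comp e [e']) [n] (f (g n))" for n
    by (intro rec_eval.intros(4)[where ys = "[g n]"]) auto
  thus ?thesis by (auto simp: computable_def)
qed

lemma computable_Suc: "computable f \<Longrightarrow> computable (\<lambda>n. Suc (f n))"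
  by (rule computable_comp[of Suc]) (auto simp: computable_def intro!: exI[of _ Succ] rec_eval.intros)

lemma computable_id: "computable (\<lambda>n. n)"
  using rec_eval.intros(3)[of 0 "[n]" for n] by (auto simp: computable_def intro!: exI[of _ "Proj 0"])

lemma computable_const: "computable (\<lambda>_. c)"
proof (induction c)
  case 0
  show ?case by (auto simp: computable_def intro!: exI[of _ Zero] rec_eval.intros)
qed (rule computable_Suc)

abbreviation rec_add :: recf where "rec_add \<equiv> PrimRec (Proj 0) (Comp Succ [Proj 1])"

lemma rec_eval_Proj: "i < length xs \<Longrightarrow> y = xs ! i \<Longrightarrow> rec_eval (Proj i) xs y"
  by (simp add: rec_eval.intros(3))

lemma rec_eval_add: "rec_eval rec_add [a, b] (a + b)"
proof (induction a)
  case 0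
  show ?case by (auto intro!: rec_eval.intros(5) rec_eval_Proj)
next
  case (Suc a)
  have "rec_eval (Comp Succ [Proj 1]) [a, a + b, b] (Suc (a + b))"
    by (rule rec_eval.intros(4)[where ys = "[a + b]"]) (auto intro!: rec_eval.intros(2) rec_eval_Proj)
  with rec_eval.intros(6)[OF Suc] show ?case by simp
qed

lemma rec_eval_mult: "rec_eval (PrimRec Zero (Comp rec_add [Proj 1, Proj 2])) [a, b] (a * b)"
proof (induction a)
  case 0
  show ?case by (auto intro!: rec_eval.intros(1,5))
next
  case (Suc a)
  have "rec_eval (Comp rec_add [Proj 1, Proj 2]) [a, a * b, b] (a * b + b)"
    by (rule rec_eval.intros(4)[where ys = "[a * b, b]"]) (auto intro!: rec_eval_add rec_eval_Proj)
  with rec_eval.intros(6)[OF Suc] show ?case by (simp add: add.commute)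
qed

lemma computable_mult:
  assumes "computable f" "computable g"
  shows "computable (\<lambda>n. f n * g n)"
proof -
  obtain e e' where "\<And>n. rec_eval e [n] (f n)" "\<And>n. rec_eval e' [n] (g n)"
    using assms by (auto simp: computable_def)
  hence "rec_eval (Comp (PrimRec Zero (Comp rec_add [Proj 1, Proj 2])) [e, e']) [n] (f n * g n)" for n
    by (intro rec_eval.intros(4)[where ys = "[f n, g n]"]) (auto intro: rec_eval_mult)
  thus ?thesis by (auto simp: computable_def)
qed

lemma computable_power2:
  assumes "computable f"
  shows "computable (\<lambda>n. 2 ^ f n)"
proof (rule computable_comp[OF _ assms])
  let ?e = "PrimRec (Comp Succ [Zero]) (Comp rec_add [Proj 1, Proj 1])"
  have "rec_eval ?e [n] (2 ^ n)" for n
  proof (induction n)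
    case 0
    have "rec_eval (Comp Succ [Zero]) [] (Suc 0)"
      by (rule rec_eval.intros(4)[where ys = "[0]"]) (auto intro!: rec_eval.intros)
    thus ?case by (auto intro!: rec_eval.intros(5) simp: One_nat_def)
  next
    case (Suc n)
    have "rec_eval (Comp rec_add [Proj 1, Proj 1]) [n, 2 ^ n] (2 ^ n + 2 ^ n)"
      by (rule rec_eval.intros(4)[where ys = "[2 ^ n, 2 ^ n]"]) (auto intro!: rec_eval_add rec_eval_Proj)
    hence "rec_eval ?e [Suc n] (2 ^ n + 2 ^ n)" by (rule rec_eval.intros(6)[OF Suc])
    thus ?case by (simp only: power_Suc mult_2)
  qed
  thus "computable (\<lambda>n. 2 ^ n)" by (auto simp: computable_def)
qed

text \<open>The outer \<open>Suc\<close> grants another \<open>length w ^ 4 >= 1\<close> steps,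
  because the machine has halted only strictly after the running time of its program: the final test
  takes one more step.\<close>

definition time_factor :: "nat \<Rightarrow> nat" where
  "time_factor k = Suc (2 ^ 2 ^ Suc k * (Suc k * 800))"

lemma computable_time_factor: "computable time_factor"
  unfolding time_factor_def
  by (intro computable_Suc computable_mult computable_power2 computable_id computable_const)

lemma wf_nth: "i < 6 \<Longrightarrow> \<forall>ss::symbol list. length ss = 6 \<longrightarrow> set ss \<subseteq> {..<7} \<longrightarrow> ss ! i < 7"
  by (metis lessThan_iff nth_mem subsetD)

lemma wf_Main: "wf_cmd 6 7 Main"
  by (simp add: wf_nth Main_def Copy_def KBuild_def KBody_def Dec_def DecLoop_def BackTo_def DBuild_def
    DBody_def Lookup_def Cmp_def CmpBack_def Rewind_def SkipBits_def AppendLoop_def Thresh_def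
    ThreshBody_def Inc_def IncLoop_def QMode_def QRound_def Pick_def PickBody_def ReadAddr_def
    AddrCopy_def AddrBack_def RunRight_def FindUnsat_def ClauseSat_def LitBody_def BMode_def Check_def
    Weight_def WeightBody_def FindAcc_def Next_def)

section \<open>Instances, hitting sets and the specification of the verifier\<close>

abbreviation names :: "cnf \<Rightarrow> nat list list" where
  "names \<phi> \<equiv> map (map var_of) \<phi>"

lemma enc_instance_eq:
  assumes "\<phi> \<in> Gamma21_pos"
  shows "enc_instance (\<phi>, k) = fenc (names \<phi>) @ 6 # enc_nat k"
proof -
  have "enc_clause C = 5 # lenc (map var_of C)" if "C \<in> set \<phi>" for C
  proof -
    have "enc_literal l = 3 # enc_nat (var_of l)" if "l \<in> set C" for l
      using assms \<open>C \<in> set \<phi>\<close> that by (cases l) (auto simp: Gamma21_pos_def)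
    hence "map enc_literal C = map (\<lambda>l. 3 # enc_nat (var_of l)) C" by simp
    from arg_cong[OF this, of concat] show ?thesis by (simp add: enc_clause_def lenc_def comp_def)
  qed
  hence "map enc_clause \<phi> = map (\<lambda>C. 5 # lenc (map var_of C)) \<phi>" by simp
  from arg_cong[OF this, of concat] show ?thesis by (simp add: enc_instance_def fenc_def comp_def)
qed

text \<open>In a positive formula a clause is satisfied iff it meets the set of true variables, so
  an assignment can be replaced by that set.\<close>

lemma has_weighted_sat_iff:
  assumes "\<phi> \<in> Gamma21_pos"
  shows "has_weighted_sat \<phi> k \<longleftrightarrow> (\<exists>A \<subseteq> vars \<phi>. card A = k \<and> hits (names \<phi>) A)"
proof -
  have sat: "satisfies \<alpha> \<phi> \<longleftrightarrow> hits (names \<phi>) {x \<in> vars \<phi>. \<alpha> x}" for \<alpha>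
  proof -
    have "(\<exists>l \<in> set C. sat_literal \<alpha> l) \<longleftrightarrow> (\<exists>x \<in> var_of ` set C. x \<in> vars \<phi> \<and> \<alpha> x)"
      if "C \<in> set \<phi>" for C
    proof -
      have "sat_literal \<alpha> l \<longleftrightarrow> \<alpha> (var_of l)" "var_of l \<in> vars \<phi>" if "l \<in> set C" for l
        using assms that \<open>C \<in> set \<phi>\<close> by (cases l; force simp: Gamma21_pos_def vars_def)+
      thus ?thesis by blast
    qed
    thus ?thesis unfolding satisfies_def hits_def by simp
  qed
  show ?thesis
  proof
    assume "\<exists>A \<subseteq> vars \<phi>. card A = k \<and> hits (names \<phi>) A"
    then obtain A where A: "A \<subseteq> vars \<phi>" "card A = k" "hits (names \<phi>) A" by auto
    hence "{x \<in> vars \<phi>. x \<in> A} = A" by auto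
    thus "has_weighted_sat \<phi> k"
      unfolding has_weighted_sat_def sat using A by (intro exI[of _ "\<lambda>x. x \<in> A"]) simp
  next
    assume "has_weighted_sat \<phi> k"
    then obtain \<alpha> where "hits (names \<phi>) {x \<in> vars \<phi>. \<alpha> x}" "card {x \<in> vars \<phi>. \<alpha> x} = k"
      unfolding has_weighted_sat_def sat by blast
    thus "\<exists>A \<subseteq> vars \<phi>. card A = k \<and> hits (names \<phi>) A"
      by (intro exI[of _ "{x \<in> vars \<phi>. \<alpha> x}"]) blast
  qed
qed

definition verifier :: ptm where
  "verifier = machine 6 7 Main (\<lambda>ss. ss ! 1 = 1)"

lemma set_enc_instance: "\<phi> \<in> Gamma21_pos \<Longrightarrow> set (enc_instance (\<phi>, k)) \<subseteq> {1..<7}"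
proof -
  have "set (enc_nat n) \<subseteq> {1..<7}" for n
    using list_all_enc_nat[of n] by (fastforce simp: list_all_iff isbit_def)
  moreover have "set (lenc C) \<subseteq> {1..<7}" for C
    using calculation by (induction C) auto
  hence "set (fenc \<psi>) \<subseteq> {1..<7}" for \<psi>
    by (induction \<psi>) auto
  ultimately show "\<phi> \<in> Gamma21_pos \<Longrightarrow> ?thesis" by (simp add: enc_instance_eq)
qed

lemma verifier_spec:
  fixes k :: nat
  assumes "\<phi> \<in> Gamma21_pos"
  defines "w \<equiv> enc_instance (\<phi>, k)"
  shows "x \<in> set_pmf (run verifier \<pi> w (time_factor k * length w ^ 4)) \<Longrightarrow> halted verifier x"
    and "x \<in> set_pmf (run verifier \<pi> w t) \<Longrightarrow> coins x = 0 \<and>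
      queries x \<le> (if 2 ^ Suc k \<le> num_vars \<phi> then k * max_clause_length \<phi> else 0)"
    and "\<not> has_weighted_sat \<phi> k \<Longrightarrow> accept_prob verifier \<pi> w = 0"
    and "A \<subseteq> vars \<phi> \<Longrightarrow> card A = k \<Longrightarrow> hits (names \<phi>) A \<Longrightarrow> (\<forall>x. proof_bit \<pi> x \<longleftrightarrow> x \<in> A) \<Longrightarrow>
      accept_prob verifier \<pi> w = 1"
proof -
  let ?p = "max_clause_length \<phi>"
  have w: "w = fenc (names \<phi>) @ 6 # enc_nat k" using enc_instance_eq[OF assms(1)] by (simp add: w_def)
  have V: "\<Union> (set ` set (names \<phi>)) = vars \<phi>" by (auto simp: vars_def)
  have p: "\<forall>C \<in> set (names \<phi>). length C \<le> ?p"
    by (auto simp: max_clause_length_def intro!: Max_ge)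
  have "wp \<pi> Main (\<lambda>s' t' q'. t' \<le> 2 ^ 2 ^ Suc k * ((k + 1) * 800) * length w ^ 4 \<and>
      q' \<le> (if 2 ^ Suc k \<le> num_vars \<phi> then k * ?p else 0) \<and>
      (scan (s' ! 1) = 1 \<longrightarrow> has_weighted_sat \<phi> k) \<and>
      (\<forall>A. A \<subseteq> vars \<phi> \<longrightarrow> card A = k \<longrightarrow> hits (names \<phi>) A \<longrightarrow> (\<forall>x. proof_bit \<pi> x \<longleftrightarrow> x \<in> A) \<longrightarrow>
        scan (s' ! 1) = 1) \<and> length s' = 6)
    (map input_tape [w, [], [], [], [], []]) 0 0"
    unfolding w
  proof (rule wp_Main[OF p, unfolded V], goal_cases)
    case (1 s' t' q')
    thus ?case unfolding num_vars_def has_weighted_sat_iff[OF assms(1)] by blast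
  qed
  then obtain n r s' where
    exec: "exec \<pi> Main (map input_tape [w, [], [], [], [], []]) n r s'"
    and n: "n \<le> 2 ^ 2 ^ Suc k * ((k + 1) * 800) * length w ^ 4"
    and r: "r \<le> (if 2 ^ Suc k \<le> num_vars \<phi> then k * ?p else 0)"
    and sound: "scan (s' ! 1) = 1 \<Longrightarrow> has_weighted_sat \<phi> k"
    and complete: "\<And>A. A \<subseteq> vars \<phi> \<Longrightarrow> card A = k \<Longrightarrow> hits (names \<phi>) A \<Longrightarrow>
      (\<forall>x. proof_bit \<pi> x \<longleftrightarrow> x \<in> A) \<Longrightarrow> scan (s' ! 1) = 1"
    and len: "length s' = 6"
    unfolding wp_def add_0 by blast
  have init: "map input_tape [w, [], [], [], [], []] = input_tape w # replicate (6 - 1) (input_tape [])"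
    by (simp add: numeral_eq_Suc One_nat_def)
  have 1: "map scan s' ! 1 = scan (s' ! 1)" using len by simp
  have "set w \<subseteq> {..<7}" using set_enc_instance[OF assms(1), of k] by (auto simp: w_def)
  have nums: "(7::nat) \<ge> 3" "(6::nat) \<ge> 2" by simp_all
  note mc = machine_correct[where p = "\<lambda>ss. ss ! 1 = 1", OF wf_Main nums \<open>set w \<subseteq> {..<7}\<close>
    exec[unfolded init], folded verifier_def, unfolded 1]
  have "length w ^ 4 \<ge> 1" by (simp add: w)
  moreover have "time_factor k * length w ^ 4 =
    2 ^ 2 ^ Suc k * ((k + 1) * 800) * length w ^ 4 + length w ^ 4"
    by (simp add: time_factor_def)
  ultimately have "time_factor k * length w ^ 4 > n" using n by linarith
  thus "x \<in> set_pmf (run verifier \<pi> w (time_factor k * length w ^ 4)) \<Longrightarrow> halted verifier x"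
    by (rule mc(1))
  show "x \<in> set_pmf (run verifier \<pi> w t) \<Longrightarrow> coins x = 0 \<and>
      queries x \<le> (if 2 ^ Suc k \<le> num_vars \<phi> then k * ?p else 0)"
    using mc(2)[of x t] r by simp
  show "\<not> has_weighted_sat \<phi> k \<Longrightarrow> accept_prob verifier \<pi> w = 0"
    using mc(3) sound by auto
  show "A \<subseteq> vars \<phi> \<Longrightarrow> card A = k \<Longrightarrow> hits (names \<phi>) A \<Longrightarrow> (\<forall>x. proof_bit \<pi> x \<longleftrightarrow> x \<in> A) \<Longrightarrow>
      accept_prob verifier \<pi> w = 1"
    using mc(3) complete[of A] by auto
qed

lemma ex_proof_string:
  assumes "finite A"
  shows "\<exists>\<pi>. \<forall>x. proof_bit \<pi> x \<longleftrightarrow> x \<in> A"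
proof -
  \<comment> \<open>The string reaches the largest element of \<open>A\<close>, later positions
    being answered by 0; \<open>insert 0\<close> gives \<open>Max\<close> a value for empty
    \<open>A\<close>.\<close>
  have "proof_bit (map (\<lambda>x. x \<in> A) [0..<Suc (Max (insert 0 A))]) x \<longleftrightarrow> x \<in> A" for x
    using assms Max_ge[of "insert 0 A" x] by (auto simp: proof_bit_def less_Suc_eq_le simp del: upt_Suc Max_insert)
  thus ?thesis by blast
qed

lemma verifier_pcp: "pcp_verifier (WSAT Gamma21_pos) verifier"
  unfolding pcp_verifier_def
proof (intro conjI ballI impI allI)
  show "wf_ptm verifier" unfolding verifier_def by (rule wf_machine[OF wf_Main]) auto
  show "fpt_time (WSAT Gamma21_pos) verifier"
    unfolding fpt_time_def
    by (intro exI[of _ time_factor] exI[of _ 4] conjI computable_time_factor)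
      (auto simp: WSAT_def intro: verifier_spec(1))
next
  fix x assume x: "x \<in> instances (WSAT Gamma21_pos)"
  obtain \<phi> k where xk: "x = (\<phi>, k)" by (cases x)
  hence \<phi>: "\<phi> \<in> Gamma21_pos" using x by (simp add: WSAT_def)
  show "set (enc (WSAT Gamma21_pos) x) \<subseteq> {1..<num_symbols verifier}"
    using set_enc_instance[OF \<phi>] by (simp add: WSAT_def xk verifier_def machine_def)
  {
    assume "x \<in> yes (WSAT Gamma21_pos)"
    then obtain A where A: "A \<subseteq> vars \<phi>" "card A = k" "hits (names \<phi>) A"
      using has_weighted_sat_iff[OF \<phi>] by (auto simp: WSAT_def xk)
    have "finite (vars \<phi>)" by (auto simp: vars_def)
    then obtain \<pi> where "\<forall>x. proof_bit \<pi> x \<longleftrightarrow> x \<in> A"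
      using ex_proof_string finite_subset[OF A(1)] by blast
    thus "\<exists>\<pi>. accept_prob verifier \<pi> (enc (WSAT Gamma21_pos) x) = 1"
      using verifier_spec(4)[OF \<phi> A] by (auto simp: WSAT_def xk)
  next
    fix \<pi>
    assume "x \<notin> yes (WSAT Gamma21_pos)"
    thus "accept_prob verifier \<pi> (enc (WSAT Gamma21_pos) x) \<le> 1 / 2"
      using verifier_spec(3)[OF \<phi>] \<phi> by (auto simp: WSAT_def xk)
  }
qed

text \<open>Many variables force \<open>Suc k <= m\<close>. For \<open>k > 0\<close> this gives
  \<open>k < m\<close> and \<open>m >= 2\<close>, so the logarithm is at least 1; for
  \<open>k = 0\<close> nothing is queried.\<close>

lemma query_bound:
  fixes k m n p :: nat
  assumes "n \<le> 2 ^ m"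
  shows "real (if 2 ^ Suc k \<le> n then k * p else 0) \<le> real p * real m * log 2 (real m)"
proof (cases "2 ^ Suc k \<le> n \<and> k > 0")
  case True
  hence "(2::nat) ^ Suc k \<le> 2 ^ m" using assms by linarith
  hence m: "k < m" using power_le_imp_le_exp[of "2::nat" "Suc k" m] by simp
  have "log 2 2 \<le> log 2 (real m)" using True m by (intro log_mono) auto
  moreover have "real (k * p) \<le> real p * real m"
    using m mult_left_mono[of "real k" "real m" "real p"] by (simp add: mult.commute)
  ultimately have "real (k * p) * log 2 2 \<le> real p * real m * log 2 (real m)" by (intro mult_mono) auto
  thus ?thesis using True by simp
next
  case False
  \<comment> \<open>At \<open>m = 0\<close> the factor \<open>m\<close> makes the product 0 whatever
    the logarithm is; for \<open>m >= 1\<close> the logarithm is nonnegative.\<close>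
  have "0 \<le> real m * log 2 (real m)" by (cases "m = 0") auto
  hence "0 \<le> real p * real m * log 2 (real m)" by (simp add: mult.assoc)
  thus ?thesis using False by (cases "2 ^ Suc k \<le> n") simp_all
qed

theorem theorem4:
  fixes m :: "cnf \<times> nat \<Rightarrow> nat"
  assumes "\<And>\<phi> k. \<phi> \<in> Gamma21_pos \<Longrightarrow> max (num_vars \<phi>) (num_clauses \<phi>) \<le> 2 ^ m (\<phi>, k)"
  shows "WSAT Gamma21_pos \<in> p_PCP
    (\<lambda>(\<phi>, k). real (max_clause_length \<phi>) * real (m (\<phi>, k)) * log 2 (real (m (\<phi>, k))))
    (\<lambda>(\<phi>, k). real (max_clause_length \<phi>) * real (m (\<phi>, k)) * log 2 (real (m (\<phi>, k))))"
proof -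
  let ?r = "\<lambda>(\<phi>, k). real (max_clause_length \<phi>) * real (m (\<phi>, k)) * log 2 (real (m (\<phi>, k)))"
  have "restricted (WSAT Gamma21_pos) ?r ?r verifier"
    unfolding restricted_def
  proof (intro exI[of _ 1] ballI allI)
    fix x \<pi> t c
    assume x: "x \<in> instances (WSAT Gamma21_pos)"
      and c: "c \<in> set_pmf (run verifier \<pi> (enc (WSAT Gamma21_pos) x) t)"
    obtain \<phi> k where xk: "x = (\<phi>, k)" by (cases x)
    hence \<phi>: "\<phi> \<in> Gamma21_pos" using x by (simp add: WSAT_def)
    have c: "coins c = 0" "queries c \<le> (if 2 ^ Suc k \<le> num_vars \<phi> then k * max_clause_length \<phi> else 0)"
      using verifier_spec(2)[OF \<phi>] c by (auto simp: WSAT_def xk)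
    have "num_vars \<phi> \<le> 2 ^ m (\<phi>, k)" using assms[OF \<phi>, of k] by simp
    from query_bound[OF this] have "real (queries c) \<le> ?r x"
      using c(2) unfolding xk prod.case by (meson of_nat_mono order_trans)
    moreover have "real (coins c) \<le> real (queries c)" using c(1) by simp
    ultimately show "real (coins c) \<le> 1 * ?r x \<and> real (queries c) \<le> 1 * ?r x" by linarith
  qed
  with verifier_pcp show ?thesis unfolding p_PCP_def by blast
qed

end
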